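(* Let $\Omega\subset\mathbb{R}^N$ be a uniformly convex domain, and let $s>\frac12$. Then there exists a function $\psi_1\in C^{0,2s-1}(\overline\Omega)$, positive in $\Omega$, such that $$\begin{cases}\mathcal{I}_1^+\psi_1+\mu_1^+\psi_1=0&\text{in }\Omega\\ \psi_1=0&\text{in }\mathbb{R}^N\setminus\Omega.\end{cases}$$
   Context: Here $s\in(0,1)$ is the fixed fractional order. A uniformly convex domain is a bounded domain $\Omega\subset\mathbb{R}^N$ of the form $\Omega=\bigcap_{y\in Y}B_R(y)$ for some $R>0$ and some set $Y\subset\mathbb{R}^N$, where $B_R(y)$ is the ball of center $y$ and radius $R$. Set $\delta(u,x,y)=u(x+y)+u(x-y)-2u(x)$ and let $C_s=C_{1,s}>0$ be the normalizing constant of the one-dimensional fractional Laplacian. The operator is $\mathcal{I}_1^+u(x)=\sup_{|\xi|=1}\mathcal{I}_\xi u(x)$, where $\mathcal{I}_\xi u(x)=C_s\int_0^{+\infty}\delta(u,x,\tau\xi)\tau^{-1-2s}\,d\tau$. Viscosity sense: for $\mu\in\mathbb{R}$, $u\in L^\infty(\mathbb{R}^N)\cap LSC(\Omega)$ (resp. $USC(\Omega)$) satisfies $\mathcal{I}_1^+u+\mu u\le0$ (resp. $\ge0$) in $\Omega$ if for every $x_0\in\Omega$, $\rho>0$ and $\varphi\in C^2(B_\rho(x_0))$ such that $x_0$ is a minimum (resp. maximum) point of $u-\varphi$ in $B_\rho(x_0)$, $$C_s\sup_{|\xi|=1}\left(\int_0^\rho\frac{\delta(\varphi,x_0,\tau\xi)}{\tau^{1+2s}}\,d\tau+\int_\rho^{+\infty}\frac{\delta(u,x_0,\tau\xi)}{\tau^{1+2s}}\,d\tau\right)+\mu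 u(x_0)\le0\quad(\text{resp. }\ge0).$$ A solution of $\mathcal{I}_1^+u+\mu u=0$ is a continuous function satisfying both inequalities. The principal eigenvalue is $$\mu_1^+=\sup\left\{\mu\in\mathbb{R}:\ \exists v\in LSC(\Omega)\cap L^\infty(\mathbb{R}^N),\ v>0\text{ in }\Omega,\ v\ge0\text{ in }\mathbb{R}^N,\ \mathcal{I}_1^+v+\mu v\le0\text{ in }\Omega\right\}.$$ *)

theory Defs
  imports "HOL-Analysis.Analysis"
begin

text \<open>The ambient space \<open>\<real>\<^sup>N\<close> is an arbitrary type of class \<open>euclidean_space\<close>, so \<open>N \<ge> 1\<close> is its
  dimension. Functions on \<open>\<real>\<^sup>N\<close> are total functions, defined at every point.\<close>

section \<open>Function classes\<close>

definition lsc_on :: "'a::topological_space set \<Rightarrow> ('a \<Rightarrow> real) \<Rightarrow> bool" where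
  "lsc_on A u \<longleftrightarrow> (\<forall>x\<in>A. \<forall>c. c < u x \<longrightarrow> (\<forall>\<^sub>F y in at x within A. c < u y))"

definition usc_on :: "'a::topological_space set \<Rightarrow> ('a \<Rightarrow> real) \<Rightarrow> bool" where
  "usc_on A u \<longleftrightarrow> (\<forall>x\<in>A. \<forall>c. u x < c \<longrightarrow> (\<forall>\<^sub>F y in at x within A. u y < c))"

text \<open>The operator below integrates \<open>u\<close> along lines, which are null sets when \<open>N \<ge> 2\<close>, so
  \<open>L\<^sup>\<infinity>(\<real>\<^sup>N)\<close> cannot be read modulo null sets: its elements are taken to be the bounded Borel functions,
  whose restrictions to lines are again Borel.\<close>

definition Linf :: "('a::euclidean_space \<Rightarrow> real) \<Rightarrow> bool" where
  "Linf u \<longleftrightarrow> u \<in> borel_measurable borel \<and> bounded (range u)"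

text \<open>\<open>C\<^sup>2(U)\<close> for open \<open>U\<close>; \<open>D\<close> and \<open>H\<close> are the first and second Frechet derivatives.\<close>

definition C2_on :: "'a::euclidean_space set \<Rightarrow> ('a \<Rightarrow> real) \<Rightarrow> bool" where
  "C2_on U f \<longleftrightarrow>
     (\<exists>(D :: 'a \<Rightarrow> 'a \<Rightarrow>\<^sub>L real) (H :: 'a \<Rightarrow> 'a \<Rightarrow>\<^sub>L 'a \<Rightarrow>\<^sub>L real).
        (\<forall>x\<in>U. (f has_derivative blinfun_apply (D x)) (at x)) \<and>
        (\<forall>x\<in>U. (D has_derivative blinfun_apply (H x)) (at x)) \<and>
        continuous_on U H)"

text \<open>\<open>C\<^sup>0\<^sup>,\<^sup>\<alpha>(A)\<close> for \<open>\<alpha> > 0\<close> and compact \<open>A\<close>, where continuity and boundedness follow from the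
  Hoelder estimate.\<close>

definition holder_on :: "real \<Rightarrow> 'a::metric_space set \<Rightarrow> ('a \<Rightarrow> real) \<Rightarrow> bool" where
  "holder_on \<alpha> A f \<longleftrightarrow> (\<exists>C. \<forall>x\<in>A. \<forall>y\<in>A. \<bar>f x - f y\<bar> \<le> C * dist x y powr \<alpha>)"


section \<open>Uniformly convex domains\<close>

text \<open>Openness is part of being a domain: an infinite intersection of open balls need not be open.\<close>

definition uniformly_convex_domain :: "'a::euclidean_space set \<Rightarrow> bool" where
  "uniformly_convex_domain \<Omega> \<longleftrightarrow>
     open \<Omega> \<and> connected \<Omega> \<and> \<Omega> \<noteq> {} \<and> bounded \<Omega> \<and> (\<exists>R>0. \<exists>Y. \<Omega> = (\<Inter>y\<in>Y. ball y R))"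


section \<open>The operator and viscosity solutions\<close>

text \<open>The constant \<open>C\<^sub>1\<^sub>,\<^sub>s\<close> for which the one-dimensional fractional Laplacian
  \<open>- C\<^sub>1\<^sub>,\<^sub>s \<integral>\<^sub>0\<^sup>\<infinity> \<delta>(u,x,\<tau>) \<tau>\<^sup>-\<^sup>1\<^sup>-\<^sup>2\<^sup>s d\<tau>\<close> has Fourier symbol \<open>\<bar>\<xi>\<bar>\<^sup>2\<^sup>s\<close>.\<close>

definition frac_const :: "real \<Rightarrow> real" where
  "frac_const s = inverse (LINT z|lborel. (1 - cos z) / \<bar>z\<bar> powr (1 + 2 * s))"

definition second_diff :: "('a::real_vector \<Rightarrow> real) \<Rightarrow> 'a \<Rightarrow> 'a \<Rightarrow> real" where
  "second_diff u x y = u (x + y) + u (x - y) - 2 * u x"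

text \<open>Lebesgue integral with values in \<open>[-\<infinity>, \<infinity>]\<close>, meaningful when the positive or the negative part
  has finite integral. Extended values are needed because a test function that is \<open>C\<^sup>2\<close> only on the
  open ball \<open>B\<^sub>\<rho>(x\<^sub>0)\<close> may be unbounded near its boundary: if it touches a bounded \<open>u\<close> from below
  (above) at \<open>x\<^sub>0\<close>, the integral of its second differences exists but may be \<open>-\<infinity>\<close> (\<open>\<infinity>\<close>).\<close>

definition ext_integral :: "real set \<Rightarrow> (real \<Rightarrow> real) \<Rightarrow> ereal" where
  "ext_integral A f =
     enn2ereal (\<integral>\<^sup>+t\<in>A. ennreal (f t) \<partial>lborel) - enn2ereal (\<integral>\<^sup>+t\<in>A. ennreal (- f t) \<partial>lborel)"

text \<open>The operator \<open>\<I>\<^sub>1\<^sup>+\<close> at \<open>x\<close>, with \<open>u\<close> replaced by the test function \<open>\<phi>\<close> inside \<open>B\<^sub>\<rho>(x)\<close>.\<close>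

definition I1_plus ::
  "real \<Rightarrow> real \<Rightarrow> ('a::euclidean_space \<Rightarrow> real) \<Rightarrow> ('a \<Rightarrow> real) \<Rightarrow> 'a \<Rightarrow> ereal" where
  "I1_plus s \<rho> \<phi> u x =
     ereal (frac_const s) *
     (SUP \<xi>\<in>sphere 0 1.
        ext_integral {0<..<\<rho>} (\<lambda>\<tau>. second_diff \<phi> x (\<tau> *\<^sub>R \<xi>) / \<tau> powr (1 + 2 * s)) +
        ext_integral {\<rho><..} (\<lambda>\<tau>. second_diff u x (\<tau> *\<^sub>R \<xi>) / \<tau> powr (1 + 2 * s)))"

definition viscosity_supersol ::
  "real \<Rightarrow> 'a::euclidean_space set \<Rightarrow> real \<Rightarrow> ('a \<Rightarrow> real) \<Rightarrow> bool" where
  "viscosity_supersol s \<Omega> \<mu> u \<longleftrightarrow>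
     Linf u \<and> lsc_on \<Omega> u \<and>
     (\<forall>x0\<in>\<Omega>. \<forall>\<rho>>0. \<forall>\<phi>.
        C2_on (ball x0 \<rho>) \<phi> \<and> (\<forall>y\<in>ball x0 \<rho>. u x0 - \<phi> x0 \<le> u y - \<phi> y) \<longrightarrow>
        I1_plus s \<rho> \<phi> u x0 + ereal (\<mu> * u x0) \<le> 0)"

definition viscosity_subsol ::
  "real \<Rightarrow> 'a::euclidean_space set \<Rightarrow> real \<Rightarrow> ('a \<Rightarrow> real) \<Rightarrow> bool" where
  "viscosity_subsol s \<Omega> \<mu> u \<longleftrightarrow>
     Linf u \<and> usc_on \<Omega> u \<and>
     (\<forall>x0\<in>\<Omega>. \<forall>\<rho>>0. \<forall>\<phi>.
        C2_on (ball x0 \<rho>) \<phi> \<and> (\<forall>y\<in>ball x0 \<rho>. u y - \<phi> y \<le> u x0 - \<phi> x0) \<longrightarrow>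
        0 \<le> I1_plus s \<rho> \<phi> u x0 + ereal (\<mu> * u x0))"

definition viscosity_sol ::
  "real \<Rightarrow> 'a::euclidean_space set \<Rightarrow> real \<Rightarrow> ('a \<Rightarrow> real) \<Rightarrow> bool" where
  "viscosity_sol s \<Omega> \<mu> u \<longleftrightarrow>
     continuous_on \<Omega> u \<and> viscosity_supersol s \<Omega> \<mu> u \<and> viscosity_subsol s \<Omega> \<mu> u"

text \<open>The supremum is taken in \<open>[-\<infinity>, \<infinity>]\<close>, so that no boundedness is built into the definition.\<close>

definition principal_eigenvalue :: "real \<Rightarrow> 'a::euclidean_space set \<Rightarrow> ereal" where
  "principal_eigenvalue s \<Omega> =
     Sup (ereal ` {\<mu>. \<exists>v. lsc_on \<Omega> v \<and> Linf v \<and> (\<forall>x\<in>\<Omega>. 0 < v x) \<and> (\<forall>x. 0 \<le> v x) \<and>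
                         viscosity_supersol s \<Omega> \<mu> v})"


section \<open>Sanity checks\<close>

lemma ext_integral_eq_LINT:
  assumes "set_integrable lborel A f"
  shows "ext_integral A f = ereal (LINT t:A|lborel. f t)"
proof -
  let ?g = "\<lambda>t. indicator A t * f t"
  have g: "integrable lborel ?g"
    using assms by (simp add: set_integrable_def)
  have *: "(\<integral>\<^sup>+t\<in>A. ennreal (c * f t) \<partial>lborel) = (\<integral>\<^sup>+t. ennreal (c * ?g t) \<partial>lborel)" for c
    by (intro nn_integral_cong) (simp split: split_indicator)
  obtain r q where "0 \<le> r" "0 \<le> q"
    and "(\<integral>\<^sup>+t. ennreal (?g t) \<partial>lborel) = ennreal r"
    and "(\<integral>\<^sup>+t. ennreal (- ?g t) \<partial>lborel) = ennreal q"
    and "integral\<^sup>L lborel ?g = r - q"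
    using g by (rule integrableE) blast
  then show ?thesis
    using *[of 1] *[of "-1"]
    by (simp add: ext_integral_def set_lebesgue_integral_def enn2ereal_ennreal)
qed

lemma frac_const_integrable:
  assumes "0 < s" "s < 1"
  shows "integrable lborel (\<lambda>z::real. (1 - cos z) / \<bar>z\<bar> powr (1 + 2 * s))"
proof -
  define g :: "real \<Rightarrow> real" where "g = (\<lambda>z. indicator {0..1} z *\<^sub>R z powr (1 - 2 * s) +
    2 * (indicator {1..} z *\<^sub>R z powr (- 1 - 2 * s)))"
  have "set_integrable lebesgue {0..1} (\<lambda>z. z powr (1 - 2 * s))"
    using assms by (intro nonnegative_absolutely_integrable_1 integrable_on_powr_from_0) auto
  then have 1: "set_integrable lborel {0..1} (\<lambda>z. z powr (1 - 2 * s))"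
    unfolding set_integrable_def by (subst (asm) integrable_completion) auto
  have "(\<lambda>z. z powr (- 1 - 2 * s)) integrable_on {1..}"
    using has_integral_powr_to_inf[of "- 1 - 2 * s" 1] assms by (auto simp: integrable_on_def)
  then have "set_integrable lebesgue {1..} (\<lambda>z. z powr (- 1 - 2 * s))"
    by (intro nonnegative_absolutely_integrable_1) auto
  then have 2: "set_integrable lborel {1..} (\<lambda>z. z powr (- 1 - 2 * s))"
    unfolding set_integrable_def by (subst (asm) integrable_completion) auto
  have g: "integrable lborel g"
    using 1 2 unfolding g_def set_integrable_def
    by (intro Bochner_Integration.integrable_add integrable_mult_right) auto
  have g': "integrable lborel (\<lambda>z. g (- z))"
    using lborel_integrable_real_affine[OF g, of "- 1" 0] by simp
  have g_nonneg: "0 \<le> g z" for z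
    unfolding g_def by simp
  have half: "a \<le> b" if "2 * a \<le> b" "0 \<le> a" for a b :: real
    using that by linarith
  have pos: "(1 - cos z) / z powr (1 + 2 * s) \<le> g z" if "0 < z" for z :: real
  proof (cases "z \<le> 1")
    case True
    have "1 - cos z = 2 * (sin (z / 2))\<^sup>2"
      using cos_double_sin[of "z / 2"] by simp
    also have "(sin (z / 2))\<^sup>2 \<le> (z / 2)\<^sup>2"
      using abs_sin_x_le_abs_x[of "z / 2"] by (simp only: abs_le_square_iff)
    finally have "2 * (1 - cos z) \<le> z\<^sup>2"
      by (simp add: power_divide)
    then have "1 - cos z \<le> z\<^sup>2"
      using half[of "1 - cos z" "z\<^sup>2"] by simp
    then have "1 - cos z \<le> z powr 2"
      using that by simp
    then have "(1 - cos z) / z powr (1 + 2 * s) \<le> z powr 2 / z powr (1 + 2 * s)"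
      by (intro divide_right_mono) auto
    also have "\<dots> = z powr (1 - 2 * s)"
      unfolding powr_diff[symmetric] by (rule arg_cong[where f = "(powr) z"]) simp
    also have "\<dots> \<le> g z"
      using that True by (simp add: g_def)
    finally show ?thesis .
  next
    case False
    have "(1 - cos z) / z powr (1 + 2 * s) \<le> 2 / z powr (1 + 2 * s)"
      using cos_ge_minus_one[of z] by (intro divide_right_mono) (linarith | simp)+
    also have "\<dots> = 2 * z powr (- 1 - 2 * s)"
      using powr_minus_divide[of z "1 + 2 * s"] by simp
    also have "\<dots> \<le> g z"
      using False by (simp add: g_def)
    finally show ?thesis .
  qed
  have bound: "(1 - cos z) / \<bar>z\<bar> powr (1 + 2 * s) \<le> g z + g (- z)" for z :: real
    using pos[of z] pos[of "- z"] g_nonneg[of z] g_nonneg[of "- z"]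
    by (cases z "0::real" rule: linorder_cases) auto
  have nonneg: "0 \<le> (1 - cos z) / \<bar>z\<bar> powr (1 + 2 * s)" for z :: real
    by simp
  show ?thesis
  proof (rule Bochner_Integration.integrable_bound[OF Bochner_Integration.integrable_add[OF g g']])
    show "AE z in lborel. norm ((1 - cos z) / \<bar>z\<bar> powr (1 + 2 * s)) \<le> norm (g z + g (- z))"
    proof (rule AE_I2)
      fix z :: real
      show "norm ((1 - cos z) / \<bar>z\<bar> powr (1 + 2 * s)) \<le> norm (g z + g (- z))"
        using bound[of z] nonneg[of z] by (simp only: real_norm_def)
    qed
  qed simp
qed

lemma frac_const_pos:
  assumes "0 < s" "s < 1"
  shows "0 < frac_const s"
proof -
  let ?F = "\<lambda>z::real. (1 - cos z) / \<bar>z\<bar> powr (1 + 2 * s)"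
  have "integral\<^sup>L lborel ?F \<noteq> 0"
  proof
    assume "integral\<^sup>L lborel ?F = 0"
    then have "AE z in lborel. ?F z = 0"
      using integral_nonneg_eq_0_iff_AE[OF frac_const_integrable[OF assms]] by simp
    moreover have "?F z \<noteq> 0" if "z \<in> {1..2}" for z
      using that cos_monotone_0_pi[of 0 z] pi_gt3 by auto
    ultimately have "AE z in lborel. z \<notin> {1..2::real}"
      by (auto elim!: eventually_mono)
    then have "emeasure lborel {1..2::real} = 0"
      by (subst (asm) AE_iff_measurable[of "{1..2}"]) auto
    then show False
      by simp
  qed
  moreover have "0 \<le> integral\<^sup>L lborel ?F"
    by (rule integral_nonneg_AE) simp
  ultimately have "0 < integral\<^sup>L lborel ?F"
    by (metis order_le_imp_less_or_eq)
  then show ?thesis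
    unfolding frac_const_def by (rule positive_imp_inverse_positive)
qed

end

theory Submission
  imports Defs "HOL-Complex_Analysis.Great_Picard" "HOL-Real_Asymp.Real_Asymp"
begin

text \<open>A supersolution satisfies a one-dimensional inequality along every line. Since \<open>s > 1/2\<close>, the
  function \<open>\<bar>t\<bar>\<^sup>2\<^sup>s\<^sup>-\<^sup>1\<close> is \<open>s\<close>-harmonic on the line off \<open>0\<close>, so a strict
  supersolution lies above the cone \<open>u(y) - L \<bar>x - y\<bar>\<^sup>2\<^sup>s\<^sup>-\<^sup>1\<close> as soon as this holds outside the domain;
  hence boundary decay gives a global Hoelder bound. Decay comes from the barriers
  \<open>(R\<^sup>2 - \<bar>x - y\<bar>\<^sup>2)\<^sup>2\<^sup>s\<^sup>-\<^sup>1\<close>: the minimum of a supersolution of \<open>\<I> u + \<mu> u = - 1\<close> with a large multiple of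
  the barrier is again one, so the minimal supersolution is Hoelder, and by minimality it is a solution.
  As \<open>\<mu>\<close> increases to the eigenvalue these solutions blow up, for otherwise they would be supersolutions beyond
  it; their normalizations converge to an eigenfunction.\<close>

section \<open>Integrals over the half-line\<close>

text \<open>The two viscosity inequalities are asymmetric: a supersolution is controlled in every
  direction, a subsolution only in some direction, which may jump from point to point. Regularity
  therefore comes from the supersolution side: in the cone argument the direction is taken through
  the vertex, where the cone restricts to the one-dimensional power. This decides the form of
  Perron's method: it works from above, because supersolutions under a common barrier are
  equi-Hoelder and their infimum stays continuous. The cone argument needs a strictly negative bound
  on the operator, hence the auxiliary right-hand side - 1. The shape of the domain enters through
  the barrier: at each point the ball with the farthest centre stands for the whole intersection,
  and the curvature of that ball pushes the operator below a fixed negative constant in all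
  directions at once, tangential ones included. Barrier and cone share the exponent 2s - 1, so
  boundary decay turns into a Hoelder bound without loss.\<close>

text \<open>Integrability and value are carried together: the integral of a non-integrable function
  is the default 0, which would make inequalities between bare integrals meaningless.\<close>

definition hl_integral :: "(real \<Rightarrow> real) \<Rightarrow> real \<Rightarrow> bool" where
  "hl_integral f c \<longleftrightarrow> has_bochner_integral lborel (\<lambda>t. indicator {0<..} t * f t) c"

lemma hl_integral_add: "hl_integral f a \<Longrightarrow> hl_integral g b \<Longrightarrow> hl_integral (\<lambda>t. f t + g t) (a + b)"
  unfolding hl_integral_def by (drule (1) has_bochner_integral_add) (simp add: algebra_simps)

lemma hl_integral_cmult: "hl_integral f a \<Longrightarrow> hl_integral (\<lambda>t. k * f t) (k * a)"
  using has_bochner_integral_mult_right[of k lborel "\<lambda>t. indicator {0<..} t * f t" a]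
  by (simp add: hl_integral_def ac_simps)

lemma hl_integral_diff: "hl_integral f a \<Longrightarrow> hl_integral g b \<Longrightarrow> hl_integral (\<lambda>t. f t - g t) (a - b)"
  using hl_integral_add[of f a "\<lambda>t. - 1 * g t" "-1 * b"] hl_integral_cmult[of g b "-1"] by simp

lemma hl_integral_uminus: "hl_integral f a \<Longrightarrow> hl_integral (\<lambda>t. - f t) (- a)"
  using hl_integral_cmult[of f a "-1"] by simp

lemma hl_integral_cong:
  assumes "\<And>t. 0 < t \<Longrightarrow> f t = g t"
  shows "hl_integral f a \<longleftrightarrow> hl_integral g a"
  unfolding hl_integral_def
  by (intro has_bochner_integral_cong) (auto simp: assms indicator_def)

lemma hl_integral_mono:
  assumes "hl_integral f a" "hl_integral g b" "\<And>t. 0 < t \<Longrightarrow> f t \<le> g t"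
  shows "a \<le> b"
proof -
  have "integral\<^sup>L lborel (\<lambda>t. indicator {0<..} t * f t) \<le> integral\<^sup>L lborel (\<lambda>t. indicator {0<..} t * g t)"
    using assms by (intro integral_mono) (auto simp: hl_integral_def has_bochner_integral_iff split: split_indicator)
  then show ?thesis
    using assms by (simp add: hl_integral_def has_bochner_integral_iff)
qed

lemma hl_integral_scale:
  assumes "hl_integral f a" "0 < k"
  shows "hl_integral (\<lambda>t. f (k * t)) (a / k)"
proof -
  have "has_bochner_integral lborel (\<lambda>t. indicator {0<..} (0 + k * t) * f (0 + k * t)) (a /\<^sub>R \<bar>k\<bar>)"
    using assms unfolding hl_integral_def
    by (subst (asm) lborel_has_bochner_integral_real_affine_iff[where c=k and t=0]) auto
  also have "(\<lambda>t. indicator {0<..} (0 + k * t) * f (0 + k * t)) = (\<lambda>t. indicator {0<..} t * f (k * t))"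
    using assms by (auto simp: fun_eq_iff indicator_def zero_less_mult_iff)
  finally show ?thesis
    using assms by (simp add: hl_integral_def divide_inverse_commute)
qed

lemma hl_integral_sandwich:
  assumes [measurable]: "f \<in> borel_measurable borel"
    and "hl_integral g a" "hl_integral h b"
    and "\<And>t. 0 < t \<Longrightarrow> g t \<le> f t" "\<And>t. 0 < t \<Longrightarrow> f t \<le> h t"
  obtains c where "hl_integral f c" "a \<le> c" "c \<le> b"
proof -
  have "integrable lborel (\<lambda>t. indicator {0<..} t * f t)"
  proof (rule Bochner_Integration.integrable_bound)
    show "integrable lborel (\<lambda>t. \<bar>indicator {0<..} t * g t\<bar> + \<bar>indicator {0<..} t * h t\<bar>)"
      using assms by (intro Bochner_Integration.integrable_add integrable_abs)
        (auto simp: hl_integral_def has_bochner_integral_iff)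
    show "AE t in lborel. norm (indicator {0<..} t * f t)
        \<le> norm (\<bar>indicator {0<..} t * g t\<bar> + \<bar>indicator {0<..} t * h t\<bar>)"
    proof (rule AE_I2)
      show "norm (indicator {0<..} t * f t)
        \<le> norm (\<bar>indicator {0<..} t * g t\<bar> + \<bar>indicator {0<..} t * h t\<bar>)" for t
        using assms(4)[of t] assms(5)[of t] by (auto split: split_indicator)
    qed
  qed simp
  then have "hl_integral f (integral\<^sup>L lborel (\<lambda>t. indicator {0<..} t * f t))"
    by (auto simp: hl_integral_def has_bochner_integral_iff)
  then show ?thesis
    using that hl_integral_mono assms by metis
qed

text \<open>Fatou's lemma for the nonnegative functions \<open>f n + G\<close>, which also yields
  integrability of the limit. The integrals \<open>j n\<close> may fail to converge; only their
  convergent upper bounds \<open>c n\<close> enter.\<close>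

lemma hl_integral_fatou:
  fixes f :: "nat \<Rightarrow> real \<Rightarrow> real"
  assumes [measurable]: "\<And>n. f n \<in> borel_measurable borel"
    and G: "hl_integral G b"
    and lower: "\<And>n t. 0 < t \<Longrightarrow> - G t \<le> f n t"
    and lim: "\<And>t. 0 < t \<Longrightarrow> (\<lambda>n. f n t) \<longlonglongrightarrow> g t"
    and int: "\<And>n. hl_integral (f n) (j n)" and j: "\<And>n. j n \<le> c n" and c: "c \<longlonglongrightarrow> c'"
  obtains i where "hl_integral g i" "i \<le> c'"
proof -
  let ?I = "indicator {0<..} :: real \<Rightarrow> real"
  let ?h = "\<lambda>n t. ?I t * (f n t + G t)" and ?k = "\<lambda>t. ?I t * (g t + G t)"
  have h: "has_bochner_integral lborel (?h n) (j n + b)" for n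
    using hl_integral_add[OF int[of n] G] by (simp add: hl_integral_def)
  then have [measurable]: "?h n \<in> borel_measurable lborel" for n
    using borel_measurable_has_bochner_integral by blast
  have lim': "(\<lambda>n. ?h n t) \<longlonglongrightarrow> ?k t" for t
    by (cases "0 < t") (auto intro!: tendsto_intros lim)
  have km [measurable]: "?k \<in> borel_measurable lborel"
    by (rule borel_measurable_LIMSEQ_real[OF lim']) measurable
  have hnn: "0 \<le> ?h n t" for n t
    using lower[of t n] by (auto split: split_indicator)
  have knn: "0 \<le> ?k t" for t
    using hnn by (intro LIMSEQ_le_const[OF lim'[of t]]) auto
  have hi: "(\<integral>\<^sup>+t. ennreal (?h n t) \<partial>lborel) = ennreal (j n + b)" for n
    using h[of n] hnn by (simp add: has_bochner_integral_iff nn_integral_eq_integral)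
  have "(\<integral>\<^sup>+t. ennreal (?k t) \<partial>lborel) = (\<integral>\<^sup>+t. liminf (\<lambda>n. ennreal (?h n t)) \<partial>lborel)"
    by (intro nn_integral_cong lim_imp_Liminf[symmetric] tendsto_ennrealI lim' trivial_limit_sequentially)
  also have "\<dots> \<le> liminf (\<lambda>n. \<integral>\<^sup>+t. ennreal (?h n t) \<partial>lborel)"
    by (rule nn_integral_liminf) measurable
  also have "\<dots> \<le> liminf (\<lambda>n. ennreal (c n + b))"
    unfolding hi by (intro Liminf_mono always_eventually allI ennreal_leI) (use j in auto)
  also have "\<dots> = ennreal (c' + b)"
    by (intro lim_imp_Liminf tendsto_ennrealI tendsto_intros c) simp
  finally have le: "(\<integral>\<^sup>+t. ennreal (?k t) \<partial>lborel) \<le> ennreal (c' + b)" .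
  then have ki: "integrable lborel ?k"
    using knn by (intro integrableI_nonneg) (auto simp: top.not_eq_extremum le_less_trans)
  have "0 \<le> j n + b" for n
    using h[of n] Bochner_Integration.integral_nonneg[of lborel "?h n", OF hnn]
    by (simp only: has_bochner_integral_iff)
  then have "0 \<le> c n + b" for n
    using j[of n] by (metis add.commute add_le_cancel_left order_trans)
  then have "0 \<le> c' + b"
    by (intro LIMSEQ_le_const[of "\<lambda>n. c n + b"] tendsto_intros c) auto
  moreover have "ennreal (integral\<^sup>L lborel ?k) \<le> ennreal (c' + b)"
    using le ki knn by (simp add: nn_integral_eq_integral)
  ultimately have "integral\<^sup>L lborel ?k \<le> c' + b"
    by simp
  moreover have "hl_integral (\<lambda>t. g t + G t) (integral\<^sup>L lborel ?k)"
    using ki by (simp add: hl_integral_def has_bochner_integral_iff)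
  then have "hl_integral g (integral\<^sup>L lborel ?k - b)"
    using hl_integral_diff[OF _ G, of "\<lambda>t. g t + G t"] by simp
  ultimately show ?thesis
    using that[of "integral\<^sup>L lborel ?k - b"] by simp
qed

section \<open>Closed-form integrals of powers\<close>

lemma FTC_open:
  fixes f F :: "real \<Rightarrow> real" and a b :: ereal
  assumes "a < b"
    and "\<And>x. a < ereal x \<Longrightarrow> ereal x < b \<Longrightarrow> DERIV F x :> f x"
    and "\<And>x. a < ereal x \<Longrightarrow> ereal x < b \<Longrightarrow> isCont f x"
    and "\<And>x. a < ereal x \<Longrightarrow> ereal x < b \<Longrightarrow> 0 \<le> f x"
    and "((F \<circ> real_of_ereal) \<longlongrightarrow> A) (at_right a)"
    and "((F \<circ> real_of_ereal) \<longlongrightarrow> B) (at_left b)"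
  shows "has_bochner_integral lborel (\<lambda>t. indicator (einterval a b) t * f t) (B - A)"
proof -
  have "set_integrable lborel (einterval a b) f" "(LBINT x=a..b. f x) = B - A"
    using interval_integral_FTC_nonneg[of a b F f A B] assms by auto
  then show ?thesis
    using assms(1)
    by (simp add: less_imp_le interval_lebesgue_integral_def set_integrable_def set_lebesgue_integral_def has_bochner_integral_iff)
qed

lemma einterval_0_1: "einterval 0 1 = {0<..<1}"
  by (auto simp: einterval_def zero_ereal_def one_ereal_def)

lemma einterval_inf: "einterval (ereal r) \<infinity> = {r<..}"
  by (auto simp: einterval_def)

lemma einterval_0: "einterval 0 (ereal r) = {0<..<r}"
  by (auto simp: einterval_def zero_ereal_def)

lemma power_tail_integral:
  fixes p r :: real
  assumes "0 < p" "0 < r"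
  shows "has_bochner_integral lborel (\<lambda>t. indicator {r<..} t * t powr (- 1 - p)) (r powr (- p) / p)"
proof -
  have "has_bochner_integral lborel (\<lambda>t. indicator (einterval (ereal r) \<infinity>) t * t powr (- 1 - p)) (0 - (- (r powr (- p) / p)))"
  proof (rule FTC_open)
    show "DERIV (\<lambda>t. - (t powr (- p) / p)) x :> x powr (- 1 - p)" if "ereal r < ereal x" for x
      using that assms by (auto intro!: derivative_eq_intros simp: divide_simps minus_diff_commute)
    show "isCont (\<lambda>t. t powr (- 1 - p)) x" if "ereal r < ereal x" for x
      using that assms by (auto intro!: continuous_intros)
    show "(((\<lambda>t. - (t powr (- p) / p)) \<circ> real_of_ereal) \<longlongrightarrow> - (r powr (- p) / p)) (at_right (ereal r))"
      unfolding ereal_tendsto_simps using assms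
      by (auto intro!: tendsto_intros)
    show "(((\<lambda>t. - (t powr (- p) / p)) \<circ> real_of_ereal) \<longlongrightarrow> 0) (at_left \<infinity>)"
      unfolding ereal_tendsto_simps using assms by real_asymp
  qed auto
  then show ?thesis by (simp add: einterval_inf)
qed

lemma power_head_integral:
  fixes p r :: real
  assumes "0 < p" "0 < r"
  shows "has_bochner_integral lborel (\<lambda>t. indicator {0<..<r} t * t powr (p - 1)) (r powr p / p)"
proof -
  have "has_bochner_integral lborel (\<lambda>t. indicator (einterval 0 (ereal r)) t * t powr (p - 1)) (r powr p / p - 0)"
  proof (rule FTC_open)
    show "DERIV (\<lambda>t. t powr p / p) x :> x powr (p - 1)" if "0 < ereal x" for x
      using that assms by (auto intro!: derivative_eq_intros)
    show "isCont (\<lambda>t. t powr (p - 1)) x" if "0 < ereal x" for x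
      using that assms by (auto intro!: continuous_intros)
    show "(((\<lambda>t. t powr p / p) \<circ> real_of_ereal) \<longlongrightarrow> 0) (at_right 0)"
      unfolding ereal_tendsto_simps zero_ereal_def using assms by real_asymp
    show "(((\<lambda>t. t powr p / p) \<circ> real_of_ereal) \<longlongrightarrow> r powr p / p) (at_left (ereal r))"
      unfolding ereal_tendsto_simps using assms by (auto intro!: tendsto_intros)
  qed (use assms in auto)
  then show ?thesis by (simp add: einterval_0)
qed

text \<open>In the variable w = (c + e t) / t, with dw = - c / t^2 dt, the claimed derivative times
  dt is w^a dw. The kernel exponent 2 + a = 1 + 2s is tied to a = 2s - 1 exactly so that this
  substitution works; the closed forms below rest on it.\<close>

lemma DERIV_affine_powr_quotient:
  fixes x c e a :: real
  assumes "0 < x" "0 < c + e * x" "0 < a"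
  shows "DERIV (\<lambda>t. (c + e * t) powr (1 + a) * t powr (- 1 - a) / (1 + a)) x
    :> - (c * (c + e * x) powr a / x powr (2 + a))"
proof -
  have "((\<lambda>t. (c + e * t) powr (1 + a) * t powr (- 1 - a)) has_real_derivative
      (1 + a) * (c + e * x) powr a * e * x powr (- 1 - a)
        + (c + e * x) powr (1 + a) * ((- 1 - a) * x powr (- 2 - a))) (at x)"
    using assms by (auto intro!: derivative_eq_intros simp: minus_diff_commute)
  then have "((\<lambda>t. (c + e * t) powr (1 + a) * t powr (- 1 - a) / (1 + a)) has_real_derivative
      ((1 + a) * (c + e * x) powr a * e * x powr (- 1 - a)
        + (c + e * x) powr (1 + a) * ((- 1 - a) * x powr (- 2 - a))) / (1 + a)) (at x)"
    by (rule DERIV_cdivide)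
  also have "x powr (- 1 - a) = x * x powr (- 2 - a)"
    using assms powr_add[of x 1 "-2-a"] by simp
  also have "(c + e * x) powr (1 + a) = (c + e * x) * (c + e * x) powr a"
    using assms by (auto simp: powr_add)
  also have "x powr (- 2 - a) = 1 / x powr (2 + a)"
    using powr_minus_divide[of x "2 + a"] by simp
  also have "((1 + a) * (c + e * x) powr a * e * (x * (1 / x powr (2 + a)))
        + (c + e * x) * (c + e * x) powr a * ((- 1 - a) * (1 / x powr (2 + a)))) / (1 + a)
      = - (c * (c + e * x) powr a / x powr (2 + a))"
    using assms by (simp add: divide_simps) (simp add: algebra_simps)
  finally show ?thesis .
qed

lemma DERIV_powr_quotient:
  fixes x a :: real
  assumes "0 < x" "0 < a"
  shows "DERIV (\<lambda>t. t powr (- 1 - a) / (1 + a)) x :> - (1 / x powr (2 + a))"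
  using DERIV_affine_powr_quotient[of x 1 0 a] assms by simp

text \<open>The weighted arithmetic-geometric mean inequality for \<open>z\<close> and
  \<open>A\<close>, multiplied by \<open>A powr (a - 1)\<close>. This form includes
  \<open>z = 0\<close>, where the power is not differentiable.\<close>

lemma powr_le_tangent:
  fixes z A a :: real
  assumes "0 < a" "a < 1" "0 \<le> z" "0 < A"
  shows "z powr a \<le> A powr a + a * A powr (a - 1) * (z - A)"
proof -
  have A: "A powr (a - 1) * A powr (1 - a) = 1" "A powr (a - 1) * A = A powr a"
    using assms powr_add[of A "a - 1" "1 - a"] powr_add[of A "a - 1" 1] by simp_all
  have "z powr a * A powr (1 - a) \<le> a * z + (1 - a) * A"
    using Youngs_inequality_0[of a "1 - a" z A] assms by (cases "z = 0") auto
  then have "A powr (a - 1) * (z powr a * A powr (1 - a)) \<le> A powr (a - 1) * (a * z + (1 - a) * A)"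
    by (rule mult_left_mono) simp
  also have "A powr (a - 1) * (z powr a * A powr (1 - a)) = z powr a"
    using A(1) by (metis mult.commute mult.left_commute mult.right_neutral)
  also have "A powr (a - 1) * (a * z + (1 - a) * A) = a * A powr (a - 1) * (z - A) + A powr (a - 1) * A"
    by (simp add: algebra_simps)
  finally show ?thesis
    using A(2) by simp
qed

lemma powr_sum_le:
  fixes x y a :: real
  assumes "0 < a" "a < 1" "0 \<le> x" "0 \<le> y" "0 < A" "x + y \<le> 2 * A"
  shows "x powr a + y powr a \<le> 2 * A powr a"
proof -
  have "x powr a + y powr a \<le> 2 * A powr a + a * A powr (a - 1) * (x + y - 2 * A)"
    using powr_le_tangent[of a x A] powr_le_tangent[of a y A] assms by (simp add: algebra_simps)
  also have "\<dots> \<le> 2 * A powr a"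
    using assms by (simp add: mult_nonneg_nonpos)
  finally show ?thesis .
qed

lemma inner_integral:
  fixes a :: real
  assumes "0 < a" "a < 1"
  shows "has_bochner_integral lborel
    (\<lambda>t. indicator {0<..<1} t * ((2 - (1 + t) powr a - (1 - t) powr a) / t powr (2 + a)))
    ((2 powr (1 + a) - 2) / (1 + a))"
proof -
  \<comment> \<open>The terms of the integrand are not separately integrable at 0. In the symmetric
    combination the numerator of the primitive is O(t^2), so the primitive tends to 0 at 0 because
    \<open>a < 1\<close>.\<close>
  let ?F = "\<lambda>t. (1 + 1 * t) powr (1 + a) * t powr (- 1 - a) / (1 + a)
    + (1 + - 1 * t) powr (1 + a) * t powr (- 1 - a) / (1 + a) - 2 * (t powr (- 1 - a) / (1 + a))"
  have "has_bochner_integral lborel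
    (\<lambda>t. indicator (einterval 0 1) t * ((2 - (1 + t) powr a - (1 - t) powr a) / t powr (2 + a)))
    ((2 powr (1 + a) - 2) / (1 + a) - 0)"
  proof (rule FTC_open[where F = ?F])
    fix x assume x: "0 < ereal x" "ereal x < 1"
    show "DERIV ?F x :> (2 - (1 + x) powr a - (1 - x) powr a) / x powr (2 + a)"
    proof (rule DERIV_cong)
      show "DERIV ?F x :> - (1 * (1 + 1 * x) powr a / x powr (2 + a))
          + - (1 * (1 + - 1 * x) powr a / x powr (2 + a)) - 2 * - (1 / x powr (2 + a))"
        by (intro DERIV_diff DERIV_add DERIV_cmult DERIV_affine_powr_quotient DERIV_powr_quotient)
          (use x assms in auto)
    qed (use x in \<open>simp add: field_simps\<close>)
    show "isCont (\<lambda>t. (2 - (1 + t) powr a - (1 - t) powr a) / t powr (2 + a)) x"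
      using x by (auto intro!: continuous_intros)
    have "(1 + x) powr a + (1 - x) powr a \<le> 2 * 1 powr a"
      using x assms by (intro powr_sum_le) auto
    then show "0 \<le> (2 - (1 + x) powr a - (1 - x) powr a) / x powr (2 + a)" by simp
  next
    have "((\<lambda>t. ((1 + t) powr (1 + a) + (1 - t) powr (1 + a) - 2) * t powr (- 1 - a) / (1 + a)) \<longlongrightarrow> 0) (at_right 0)"
      using assms by real_asymp
    also have "(\<lambda>t. ((1 + t) powr (1 + a) + (1 - t) powr (1 + a) - 2) * t powr (- 1 - a) / (1 + a)) = ?F"
      by (simp add: fun_eq_iff add_divide_distrib diff_divide_distrib algebra_simps)
    finally show "((?F \<circ> real_of_ereal) \<longlongrightarrow> 0) (at_right 0)"
      unfolding ereal_tendsto_simps zero_ereal_def .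
    have "(?F \<longlongrightarrow> 2 powr (1 + a) * inverse (1 + a) - 2 * inverse (1 + a)) (at_left 1)"
      using assms by real_asymp
    then show "((?F \<circ> real_of_ereal) \<longlongrightarrow> (2 powr (1 + a) - 2) / (1 + a)) (at_left 1)"
      unfolding ereal_tendsto_simps one_ereal_def by (simp add: divide_inverse left_diff_distrib)
  qed auto
  then show ?thesis by (simp add: einterval_0_1)
qed

lemma outer_integral_plus:
  fixes a :: real
  assumes "0 < a" "a < 1"
  shows "has_bochner_integral lborel
    (\<lambda>t. indicator {1<..} t * ((1 + t) powr a / t powr (2 + a))) ((2 powr (1 + a) - 1) / (1 + a))"
proof -
  let ?F = "\<lambda>t. - ((1 + 1 * t) powr (1 + a) * t powr (- 1 - a) / (1 + a))"
  have "has_bochner_integral lborel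
    (\<lambda>t. indicator (einterval (ereal 1) \<infinity>) t * ((1 + t) powr a / t powr (2 + a)))
    (- (1 / (1 + a)) - (- (2 powr (1 + a) / (1 + a))))"
  proof (rule FTC_open[where F = ?F])
    fix x assume x: "ereal 1 < ereal x"
    show "DERIV ?F x :> (1 + x) powr a / x powr (2 + a)"
      using DERIV_minus[OF DERIV_affine_powr_quotient[of x 1 1 a]] x assms by simp
    show "isCont (\<lambda>t. (1 + t) powr a / t powr (2 + a)) x"
      using x by (auto intro!: continuous_intros)
  next
    have "(?F \<longlongrightarrow> - inverse (1 + a)) at_top"
      using assms by real_asymp
    then show "((?F \<circ> real_of_ereal) \<longlongrightarrow> - (1 / (1 + a))) (at_left \<infinity>)"
      unfolding ereal_tendsto_simps by (simp add: divide_inverse)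
    have "(?F \<longlongrightarrow> - (2 powr (1 + a) * inverse (1 + a))) (at_right 1)"
      using assms by real_asymp
    then show "((?F \<circ> real_of_ereal) \<longlongrightarrow> - (2 powr (1 + a) / (1 + a))) (at_right (ereal 1))"
      unfolding ereal_tendsto_simps by (simp add: divide_inverse)
  qed auto
  then show ?thesis by (simp add: einterval_inf diff_divide_distrib)
qed

lemma outer_integral_minus:
  fixes a :: real
  assumes "0 < a" "a < 1"
  shows "has_bochner_integral lborel
    (\<lambda>t. indicator {1<..} t * ((t - 1) powr a / t powr (2 + a))) (1 / (1 + a))"
proof -
  let ?F = "\<lambda>t. (- 1 + 1 * t) powr (1 + a) * t powr (- 1 - a) / (1 + a)"
  have "has_bochner_integral lborel
    (\<lambda>t. indicator (einterval (ereal 1) \<infinity>) t * ((t - 1) powr a / t powr (2 + a)))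
    (1 / (1 + a) - 0)"
  proof (rule FTC_open[where F = ?F])
    fix x assume x: "ereal 1 < ereal x"
    show "DERIV ?F x :> (x - 1) powr a / x powr (2 + a)"
      using DERIV_affine_powr_quotient[of x "-1" 1 a] x assms by simp
    show "isCont (\<lambda>t. (t - 1) powr a / t powr (2 + a)) x"
      using x by (auto intro!: continuous_intros)
  next
    show "((?F \<circ> real_of_ereal) \<longlongrightarrow> 1 / (1 + a)) (at_left \<infinity>)"
      unfolding ereal_tendsto_simps using assms by (real_asymp simp: divide_inverse)
    show "((?F \<circ> real_of_ereal) \<longlongrightarrow> 0) (at_right (ereal 1))"
      unfolding ereal_tendsto_simps using assms by real_asymp
  qed auto
  then show ?thesis by (simp add: einterval_inf)
qed

lemma hl_integral_pieces:
  assumes "has_bochner_integral lborel (\<lambda>t. indicator {0<..<1} t * f t) i"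
    and "has_bochner_integral lborel (\<lambda>t. indicator {1<..} t * g t) j"
    and "\<And>t. 0 < t \<Longrightarrow> t < 1 \<Longrightarrow> h t = f t" "\<And>t. 1 < t \<Longrightarrow> h t = g t"
    and [measurable]: "h \<in> borel_measurable borel"
  shows "hl_integral h (i + j)"
proof -
  have "has_bochner_integral lborel
      (\<lambda>t. indicator {0<..<1} t * f t + indicator {1<..} t * g t) (i + j)"
    using assms(1,2) by (rule has_bochner_integral_add)
  moreover have "(\<lambda>t. indicator {0<..<1} t * f t + indicator {1<..} t * g t) \<in> borel_measurable lborel"
    using calculation borel_measurable_has_bochner_integral by blast
  moreover have "AE t in lborel. indicator {0<..<1} t * f t + indicator {1<..} t * g t = indicator {0<..} t * h t"
    using AE_lborel_singleton[of "1::real"]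
  proof eventually_elim
    case (elim t)
    then show ?case
      using assms(3)[of t] assms(4)[of t] by (cases t "1::real" rule: linorder_cases) (auto split: split_indicator)
  qed
  ultimately show ?thesis
    unfolding hl_integral_def by (subst (asm) has_bochner_integral_cong_AE) auto
qed

text \<open>The numerator is the second difference of \<open>\<bar>t\<bar> powr a\<close> at 1,
  split at the step where the line meets the vertex. The piece inside (0,1) and the three pieces
  outside cancel exactly.\<close>

lemma hl_integral_abs_powr:
  fixes a :: real
  assumes "0 < a" "a < 1"
  shows "hl_integral (\<lambda>t. ((1 + t) powr a + \<bar>1 - t\<bar> powr a - 2) / t powr (2 + a)) 0"
proof -
  have 1: "has_bochner_integral lborel
      (\<lambda>t. indicator {0<..<1} t * (- ((2 - (1 + t) powr a - (1 - t) powr a) / t powr (2 + a))))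
      (- ((2 powr (1 + a) - 2) / (1 + a)))"
    using has_bochner_integral_minus[OF inner_integral[OF assms]] by simp
  have "has_bochner_integral lborel
      (\<lambda>t. indicator {1<..} t * ((1 + t) powr a / t powr (2 + a))
        + indicator {1<..} t * ((t - 1) powr a / t powr (2 + a))
        - 2 * (indicator {1<..} t * t powr (- 1 - (1 + a))))
      ((2 powr (1 + a) - 1) / (1 + a) + 1 / (1 + a) - 2 * (1 powr - (1 + a) / (1 + a)))"
    using assms by (intro has_bochner_integral_add has_bochner_integral_diff has_bochner_integral_mult_right
        outer_integral_plus outer_integral_minus power_tail_integral) auto
  then have 2: "has_bochner_integral lborel
      (\<lambda>t. indicator {1<..} t * ((1 + t) powr a / t powr (2 + a) + (t - 1) powr a / t powr (2 + a)
        - 2 * t powr (- 1 - (1 + a))))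
      ((2 powr (1 + a) - 1) / (1 + a) + 1 / (1 + a) - 2 / (1 + a))"
    by (simp add: algebra_simps)
  have "hl_integral (\<lambda>t. ((1 + t) powr a + \<bar>1 - t\<bar> powr a - 2) / t powr (2 + a))
    (- ((2 powr (1 + a) - 2) / (1 + a)) + ((2 powr (1 + a) - 1) / (1 + a) + 1 / (1 + a) - 2 / (1 + a)))"
  proof (rule hl_integral_pieces[OF 1 2])
    fix t :: real assume t: "1 < t"
    have "t powr (- 1 - (1 + a)) = 1 / t powr (2 + a)"
      using powr_minus_divide[of t "2 + a"] by (simp add: algebra_simps)
    then show "((1 + t) powr a + \<bar>1 - t\<bar> powr a - 2) / t powr (2 + a)
      = (1 + t) powr a / t powr (2 + a) + (t - 1) powr a / t powr (2 + a) - 2 * t powr (- 1 - (1 + a))"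
      using t by (simp add: add_divide_distrib diff_divide_distrib)
  qed (auto simp: minus_divide_left)
  then show ?thesis
    using assms by (simp add: diff_divide_distrib add_divide_distrib)
qed

text \<open>The half-line profile omits the branch beyond the vertex, which contributes
  \<open>1 / (1 + a)\<close> to the harmonic identity. What remains is strictly negative; the
  barrier gets its sign from this in steep directions.\<close>

lemma hl_integral_pos_part_powr:
  fixes a :: real
  assumes "0 < a" "a < 1"
  shows "hl_integral (\<lambda>t. ((1 + t) powr a + (max 0 (1 - t)) powr a - 2) / t powr (2 + a)) (- 1 / (1 + a))"
proof -
  have 0: "has_bochner_integral lborel (\<lambda>t. indicator {0<..<1} t * 0) (0::real)"
    by (simp add: has_bochner_integral_zero)
  have "hl_integral (\<lambda>t. (max 0 (t - 1)) powr a / t powr (2 + a)) (0 + 1 / (1 + a))"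
    by (rule hl_integral_pieces[OF 0 outer_integral_minus[OF assms]]) auto
  from hl_integral_diff[OF hl_integral_abs_powr[OF assms] this]
  have "hl_integral (\<lambda>t. ((1 + t) powr a + \<bar>1 - t\<bar> powr a - 2) / t powr (2 + a)
      - (max 0 (t - 1)) powr a / t powr (2 + a)) (- 1 / (1 + a))"
    by simp
  moreover have "((1 + t) powr a + \<bar>1 - t\<bar> powr a - 2) / t powr (2 + a) - (max 0 (t - 1)) powr a / t powr (2 + a)
    = ((1 + t) powr a + (max 0 (1 - t)) powr a - 2) / t powr (2 + a)" for t :: real
    by (auto simp: max_def diff_divide_distrib add_divide_distrib)
  ultimately show ?thesis
    by simp
qed

section \<open>Touching paraboloids and the cone comparison principle\<close>

lemma lsc_on_UNIV_D: "lsc_on UNIV u \<Longrightarrow> c < u x \<Longrightarrow> \<forall>\<^sub>F y in at x. c < u y"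
  by (auto simp: lsc_on_def)

lemma lsc_on_UNIV_open:
  assumes "lsc_on UNIV u"
  shows "open {x. c < u x}"
proof (subst open_subopen, intro ballI)
  fix x assume "x \<in> {x. c < u x}"
  then have "c < u x" by simp
  then obtain S where "open S" "x \<in> S" "\<And>y. y \<in> S \<Longrightarrow> y \<noteq> x \<Longrightarrow> c < u y"
    using lsc_on_UNIV_D[OF assms, of c x] by (auto simp: eventually_at_topological)
  then show "\<exists>T. open T \<and> x \<in> T \<and> T \<subseteq> {x. c < u x}"
    using \<open>c < u x\<close> by (intro exI[of _ S]) auto
qed

lemma lsc_on_UNIV_continuous: "continuous_on UNIV (u :: 'a::topological_space \<Rightarrow> real) \<Longrightarrow> lsc_on UNIV u"
  by (auto simp: lsc_on_def continuous_on_def intro: order_tendstoD)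

lemma lsc_on_UNIV_add:
  assumes "lsc_on UNIV u" "lsc_on UNIV v"
  shows "lsc_on UNIV (\<lambda>x. u x + v x)"
  unfolding lsc_on_def
proof (intro ballI allI impI)
  fix x c assume "c < u x + v x"
  define e where "e = (u x + v x - c) / 2"
  have "e > 0"
    using \<open>c < u x + v x\<close> by (simp add: e_def)
  then have "\<forall>\<^sub>F y in at x. u x - e < u y" "\<forall>\<^sub>F y in at x. v x - e < v y"
    using assms by (auto intro!: lsc_on_UNIV_D)
  then have "\<forall>\<^sub>F y in at x. c < u y + v y"
    by eventually_elim (simp add: e_def field_simps)
  then show "\<forall>\<^sub>F y in at x within UNIV. c < u y + v y" by simp
qed

lemma lsc_on_UNIV_min:
  assumes "lsc_on UNIV u" "lsc_on UNIV v"
  shows "lsc_on UNIV (\<lambda>x. min (u x) (v x))"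
  using assms by (auto simp: lsc_on_def eventually_conj_iff)

lemma lsc_on_UNIV_cmult:
  assumes "lsc_on UNIV u" "0 < k"
  shows "lsc_on UNIV (\<lambda>x. k * u x)"
  unfolding lsc_on_def
proof (intro ballI allI impI)
  fix x c assume "c < k * u x"
  then have "\<forall>\<^sub>F y in at x. c / k < u y"
    using assms by (intro lsc_on_UNIV_D) (auto simp: field_simps)
  then show "\<forall>\<^sub>F y in at x within UNIV. c < k * u y"
    using assms(2) by (auto simp: field_simps)
qed

lemma lsc_on_UNIV_attains_inf:
  assumes "compact S" "S \<noteq> {}" "lsc_on UNIV u"
  shows "\<exists>x\<in>S. \<forall>y\<in>S. u x \<le> u y"
proof (rule ccontr)
  assume "\<not> ?thesis"
  then have *: "\<exists>y\<in>S. u y < u x" if "x \<in> S" for x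
    using that by (meson not_le)
  then have "S \<subseteq> (\<Union>y\<in>S. {x. u y < u x})"
    by blast
  then obtain T where T: "T \<subseteq> S" "finite T" "S \<subseteq> (\<Union>y\<in>T. {x. u y < u x})"
    using compactE_image[OF assms(1), of S "\<lambda>y. {x. u y < u x}"] lsc_on_UNIV_open[OF assms(3)] by metis
  then have "T \<noteq> {}"
    using assms(2) by auto
  then obtain y where "y \<in> T" "\<And>z. z \<in> T \<Longrightarrow> u y \<le> u z"
    using T(2) by (metis arg_min_least arg_min_if_finite(1))
  then show False
    using T(1,3) by fastforce
qed

section \<open>Paraboloids touching from below\<close>

definition touch_below :: "real \<Rightarrow> ('a::real_inner \<Rightarrow> real) \<Rightarrow> 'a \<Rightarrow> bool" where
  "touch_below K u x \<longleftrightarrow> (\<exists>p. \<forall>z. u x + p \<bullet> (z - x) - K * (norm (z - x))\<^sup>2 \<le> u z)"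

lemma touch_below_second_diff:
  assumes "touch_below K u x"
  shows "- 2 * K * (norm y)\<^sup>2 \<le> second_diff u x y"
proof -
  obtain p where p: "\<And>z. u x + p \<bullet> (z - x) - K * (norm (z - x))\<^sup>2 \<le> u z"
    using assms by (auto simp: touch_below_def)
  show ?thesis
    using p[of "x + y"] p[of "x - y"] by (simp add: second_diff_def inner_diff_right)
qed

lemma touch_below_mono:
  assumes "touch_below K g x" "\<And>z. g z \<le> h z" "g x = h x"
  shows "touch_below K h x"
  using assms unfolding touch_below_def by (metis order_trans)

lemma touch_below_mono_const:
  assumes "touch_below K g x" "K \<le> K'"
  shows "touch_below K' g x"
proof -
  have "K * (norm (z - x))\<^sup>2 \<le> K' * (norm (z - x))\<^sup>2" for z
    using assms(2) by (intro mult_right_mono) auto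
  then show ?thesis
    using assms(1) unfolding touch_below_def by (metis diff_left_mono order_trans)
qed

text \<open>For bounded \<open>u\<close> a local contact becomes global by narrowing the paraboloid:
  outside the ball of radius \<open>r\<close>, \<open>2 * M / r\<^sup>2\<close> pays for the
  oscillation of \<open>u\<close> and \<open>norm p / r\<close> for the linear term.\<close>

lemma touch_below_local:
  assumes "\<And>z. \<bar>u z\<bar> \<le> M" "0 < r"
    and local: "\<And>z. norm (z - x) < r \<Longrightarrow> u x + p \<bullet> (z - x) - K * (norm (z - x))\<^sup>2 \<le> u z"
  shows "\<exists>K'. touch_below K' u x"
proof -
  define K' where "K' = \<bar>K\<bar> + 2 * M / r\<^sup>2 + norm p / r"
  have M: "0 \<le> M"
    using assms(1)[of x] by simp
  have "u x + p \<bullet> (z - x) - K' * (norm (z - x))\<^sup>2 \<le> u z" for z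
  proof (cases "norm (z - x) < r")
    case True
    have "K \<le> K'"
      using M assms(2) by (auto simp: K'_def intro!: add_increasing2)
    then have "K * (norm (z - x))\<^sup>2 \<le> K' * (norm (z - x))\<^sup>2"
      by (intro mult_right_mono) auto
    then show ?thesis
      using local[OF True] by linarith
  next
    case False
    define d where "d = norm (z - x)"
    have d: "r \<le> d" "0 < d" "0 \<le> d"
      using False assms(2) by (auto simp: d_def)
    have "2 * M * r\<^sup>2 \<le> 2 * M * d\<^sup>2"
      using d M assms(2) by (intro mult_left_mono power_mono) auto
    then have 1: "2 * M \<le> 2 * M / r\<^sup>2 * d\<^sup>2"
      using assms(2) by (simp add: field_simps)
    have "norm p * d * r \<le> norm p * d * d"
      using d by (intro mult_left_mono) auto
    then have 2: "norm p * d \<le> norm p / r * d\<^sup>2"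
      using assms(2) by (simp add: field_simps power2_eq_square)
    have "p \<bullet> (z - x) \<le> norm p * d"
      unfolding d_def by (rule norm_cauchy_schwarz)
    moreover have "0 \<le> \<bar>K\<bar> * d\<^sup>2"
      by simp
    moreover have "K' * d\<^sup>2 = \<bar>K\<bar> * d\<^sup>2 + 2 * M / r\<^sup>2 * d\<^sup>2 + norm p / r * d\<^sup>2"
      unfolding K'_def by (simp only: distrib_right)
    ultimately have "u x + p \<bullet> (z - x) - K' * d\<^sup>2 \<le> u x - 2 * M"
      using 1 2 by linarith
    then show ?thesis
      using assms(1)[of x] assms(1)[of z] unfolding d_def by linarith
  qed
  then show ?thesis
    by (auto simp: touch_below_def)
qed

section \<open>Difference quotients along lines and the fractional kernel\<close>

locale frac_order =
  fixes s :: real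
  assumes s_gt: "1/2 < s" and s_lt: "s < 1"
begin

definition dq :: "('a::real_vector \<Rightarrow> real) \<Rightarrow> 'a \<Rightarrow> 'a \<Rightarrow> real \<Rightarrow> real" where
  "dq u x \<xi> \<tau> = second_diff u x (\<tau> *\<^sub>R \<xi>) / \<tau> powr (1 + 2 * s)"

lemma dq_measurable [measurable]:
  fixes u :: "'a::euclidean_space \<Rightarrow> real"
  assumes [measurable]: "u \<in> borel_measurable borel"
  shows "dq u x \<xi> \<in> borel_measurable borel"
  unfolding dq_def[abs_def] second_diff_def by measurable

lemma hl_integral_dilate:
  assumes "hl_integral (\<lambda>t. h t / t powr (1 + 2 * s)) c" "0 < k"
  shows "hl_integral (\<lambda>t. h (k * t) / t powr (1 + 2 * s)) (k powr (2 * s) * c)"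
proof -
  have "hl_integral (\<lambda>t. k powr (1 + 2 * s) * (h (k * t) / (k * t) powr (1 + 2 * s))) (k powr (1 + 2 * s) * (c / k))"
    using assms by (intro hl_integral_cmult hl_integral_scale) auto
  also have "k powr (1 + 2 * s) * (c / k) = k powr (2 * s) * c"
    using assms by (simp add: powr_add)
  finally show ?thesis
    by (rule hl_integral_cong[THEN iffD1, rotated]) (use assms in \<open>auto simp: powr_mult\<close>)
qed

lemma hl_integral_radial_cone:
  assumes "0 < d"
  shows "hl_integral (\<lambda>t. (\<bar>d + t\<bar> powr (2 * s - 1) + \<bar>d - t\<bar> powr (2 * s - 1) - 2 * d powr (2 * s - 1))
    / t powr (1 + 2 * s)) 0"
proof -
  let ?a = "2 * s - 1"
  have "hl_integral (\<lambda>t. ((1 + t) powr ?a + \<bar>1 - t\<bar> powr ?a - 2) / t powr (1 + 2 * s)) 0"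
    using hl_integral_abs_powr[of ?a] s_gt s_lt by simp
  from hl_integral_cmult[OF hl_integral_dilate[OF this, of "1 / d"], of "d powr ?a"] assms
  have *: "hl_integral (\<lambda>t. d powr ?a * (((1 + 1 / d * t) powr ?a + \<bar>1 - 1 / d * t\<bar> powr ?a - 2) / t powr (1 + 2 * s))) 0"
    by simp
  show ?thesis
  proof (rule hl_integral_cong[THEN iffD1, OF _ *])
    fix t :: real assume t: "0 < t"
    have "d * (1 + 1 / d * t) = \<bar>d + t\<bar>"
      using assms t by (simp add: distrib_left)
    then have "d powr ?a * (1 + 1 / d * t) powr ?a = \<bar>d + t\<bar> powr ?a"
      by (metis powr_mult)
    moreover have "d * \<bar>1 - 1 / d * t\<bar> = \<bar>d - t\<bar>"
      using assms by (simp add: field_simps flip: abs_mult_pos')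
    then have "d powr ?a * \<bar>1 - 1 / d * t\<bar> powr ?a = \<bar>d - t\<bar> powr ?a"
      using assms by (metis powr_mult)
    ultimately show "d powr ?a * (((1 + 1 / d * t) powr ?a + \<bar>1 - 1 / d * t\<bar> powr ?a - 2) / t powr (1 + 2 * s))
      = (\<bar>d + t\<bar> powr ?a + \<bar>d - t\<bar> powr ?a - 2 * d powr ?a) / t powr (1 + 2 * s)"
      by (simp add: algebra_simps)
  qed
qed

lemma hl_integral_half_line:
  assumes "0 < A" "0 < k"
  shows "hl_integral (\<lambda>t. ((A + k * t) powr (2 * s - 1) + (max 0 (A - k * t)) powr (2 * s - 1) - 2 * A powr (2 * s - 1))
    / t powr (1 + 2 * s)) (- (k powr (2 * s) / (2 * s * A)))"
proof -
  let ?a = "2 * s - 1"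
  have "hl_integral (\<lambda>t. ((1 + t) powr ?a + (max 0 (1 - t)) powr ?a - 2) / t powr (1 + 2 * s)) (- 1 / (2 * s))"
    using hl_integral_pos_part_powr[of ?a] s_gt s_lt by simp
  from hl_integral_cmult[OF hl_integral_dilate[OF this, of "k / A"], of "A powr ?a"] assms
  have *: "hl_integral (\<lambda>t. A powr ?a * (((1 + k / A * t) powr ?a + (max 0 (1 - k / A * t)) powr ?a - 2) / t powr (1 + 2 * s)))
     (A powr ?a * ((k / A) powr (2 * s) * (- 1 / (2 * s))))"
    by simp
  have "A powr ?a * ((k / A) powr (2 * s) * (- 1 / (2 * s))) = - ((A powr ?a / A powr (2 * s)) * k powr (2 * s) / (2 * s))"
    using assms by (simp add: powr_divide)
  also have "A powr ?a / A powr (2 * s) = 1 / A"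
    using assms by (simp flip: powr_diff add: powr_minus_divide)
  finally have eq: "A powr ?a * ((k / A) powr (2 * s) * (- 1 / (2 * s))) = - (k powr (2 * s) / (2 * s * A))"
    by (simp add: mult.commute)
  show ?thesis
  proof (rule hl_integral_cong[THEN iffD1, OF _ *[unfolded eq]])
    fix t :: real assume t: "0 < t"
    have "A * (1 + k / A * t) = A + k * t"
      using assms t by (simp add: distrib_left)
    then have "A powr ?a * (1 + k / A * t) powr ?a = (A + k * t) powr ?a"
      by (metis powr_mult)
    moreover have "A * max 0 (1 - k / A * t) = max 0 (A - k * t)"
      using assms by (simp add: max_mult_distrib_left right_diff_distrib)
    then have "A powr ?a * (max 0 (1 - k / A * t)) powr ?a = (max 0 (A - k * t)) powr ?a"
      using assms by (metis powr_mult)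
    ultimately show "A powr ?a * (((1 + k / A * t) powr ?a + (max 0 (1 - k / A * t)) powr ?a - 2) / t powr (1 + 2 * s))
      = ((A + k * t) powr ?a + (max 0 (A - k * t)) powr ?a - 2 * A powr ?a) / t powr (1 + 2 * s)"
      by (simp add: algebra_simps)
  qed
qed

lemma hl_integral_tail:
  assumes "0 < r"
  shows "hl_integral (\<lambda>t. indicator {r<..} t / t powr (1 + 2 * s)) (r powr (- (2 * s)) / (2 * s))"
proof -
  have "has_bochner_integral lborel (\<lambda>t. indicator {r<..} t * t powr (- 1 - 2 * s)) (r powr (- (2 * s)) / (2 * s))"
    using assms s_gt by (intro power_tail_integral) auto
  also have "(\<lambda>t. indicator {r<..} t * t powr (- 1 - 2 * s)) = (\<lambda>t. indicator {0<..} t * (indicator {r<..} t / t powr (1 + 2 * s)))"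
    using assms powr_minus_divide[of _ "1 + 2 * s"] by (auto simp: fun_eq_iff split: split_indicator)
  finally show ?thesis
    by (simp add: hl_integral_def)
qed

lemma hl_integral_head:
  assumes "0 < r"
  shows "hl_integral (\<lambda>t. indicator {0<..<r} t * t\<^sup>2 / t powr (1 + 2 * s)) (r powr (2 - 2 * s) / (2 - 2 * s))"
proof -
  have "has_bochner_integral lborel (\<lambda>t. indicator {0<..<r} t * t powr (2 - 2 * s - 1)) (r powr (2 - 2 * s) / (2 - 2 * s))"
    using assms s_lt by (intro power_head_integral) auto
  also have "(\<lambda>t. indicator {0<..<r} t * t powr (2 - 2 * s - 1)) = (\<lambda>t. indicator {0<..} t * (indicator {0<..<r} t * t\<^sup>2 / t powr (1 + 2 * s)))"
  proof
    fix t :: real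
    have "t powr (2 - 2 * s - 1) = t\<^sup>2 / t powr (1 + 2 * s)" if "0 < t"
      using that powr_diff[of t 2 "1 + 2 * s"] by simp
    then show "indicator {0<..<r} t * t powr (2 - 2 * s - 1) = indicator {0<..} t * (indicator {0<..<r} t * t\<^sup>2 / t powr (1 + 2 * s))"
      by (auto split: split_indicator)
  qed
  finally show ?thesis
    by (simp add: hl_integral_def)
qed

lemma hl_integral_min_kernel:
  assumes "0 \<le> K" "0 \<le> M"
  obtains b where "hl_integral (\<lambda>t. min (K * t\<^sup>2) M / t powr (1 + 2 * s)) b"
proof -
  \<comment> \<open>Each bound in the minimum is integrable on its own side. The cut-offs (0,1) and
    (1/2, infinity) overlap so that every \<open>t\<close> is covered, including
    \<open>t = 1\<close>.\<close>
  define h where "h t = K * (indicator {0<..<1} t * t\<^sup>2 / t powr (1 + 2 * s)) + M * (indicator {1/2<..} t / t powr (1 + 2 * s))" for t :: real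
  have h: "hl_integral h (K * (1 powr (2 - 2 * s) / (2 - 2 * s)) + M * ((1/2) powr (- (2 * s)) / (2 * s)))"
    unfolding h_def[abs_def] by (intro hl_integral_add hl_integral_cmult hl_integral_head hl_integral_tail) auto
  have z: "hl_integral (\<lambda>t. 0) 0"
    by (simp add: hl_integral_def has_bochner_integral_zero)
  show ?thesis
  proof (rule hl_integral_sandwich[OF _ z h])
    fix t :: real assume "0 < t"
    show "0 \<le> min (K * t\<^sup>2) M / t powr (1 + 2 * s)"
      using assms by simp
    have "min (K * t\<^sup>2) M \<le> K * (indicator {0<..<1} t * t\<^sup>2) + M * indicator {1/2<..} t"
      using assms \<open>0 < t\<close> by (auto split: split_indicator intro: add_increasing2)
    then have "min (K * t\<^sup>2) M / t powr (1 + 2 * s) \<le> (K * (indicator {0<..<1} t * t\<^sup>2) + M * indicator {1/2<..} t) / t powr (1 + 2 * s)"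
      by (rule divide_right_mono) simp
    then show "min (K * t\<^sup>2) M / t powr (1 + 2 * s) \<le> h t"
      by (simp add: h_def add_divide_distrib)
  qed (use that in auto)
qed

lemma dq_lower:
  assumes "touch_below K u x" "\<And>z. \<bar>u z\<bar> \<le> M" "norm \<xi> = 1"
  shows "- (min (2 * \<bar>K\<bar> * t\<^sup>2) (4 * M) / t powr (1 + 2 * s)) \<le> dq u x \<xi> t"
proof -
  have "- 2 * K * (norm (t *\<^sub>R \<xi>))\<^sup>2 \<le> second_diff u x (t *\<^sub>R \<xi>)"
    using assms(1) by (rule touch_below_second_diff)
  then have "- (2 * K * t\<^sup>2) \<le> second_diff u x (t *\<^sub>R \<xi>)"
    using assms(3) by simp
  moreover have "2 * K * t\<^sup>2 \<le> 2 * \<bar>K\<bar> * t\<^sup>2"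
    by (intro mult_right_mono) auto
  ultimately have "- (2 * \<bar>K\<bar> * t\<^sup>2) \<le> second_diff u x (t *\<^sub>R \<xi>)"
    by linarith
  moreover have "- (4 * M) \<le> second_diff u x (t *\<^sub>R \<xi>)"
    using assms(2)[of "x + t *\<^sub>R \<xi>"] assms(2)[of "x - t *\<^sub>R \<xi>"] assms(2)[of x] by (simp add: second_diff_def)
  ultimately have "- min (2 * \<bar>K\<bar> * t\<^sup>2) (4 * M) \<le> second_diff u x (t *\<^sub>R \<xi>)"
    by linarith
  then have "- min (2 * \<bar>K\<bar> * t\<^sup>2) (4 * M) / t powr (1 + 2 * s) \<le> dq u x \<xi> t"
    unfolding dq_def by (rule divide_right_mono) simp
  then show ?thesis by simp
qed

text \<open>The touching paraboloid supplies the integrable minorant and \<open>G\<close> the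
  majorant, so a one-sided bound already yields integrability.\<close>

lemma hl_integral_dq_le:
  fixes u :: "'a::euclidean_space \<Rightarrow> real"
  assumes "u \<in> borel_measurable borel" "\<And>z. \<bar>u z\<bar> \<le> M" "touch_below K u x" "norm \<xi> = 1"
    and G: "hl_integral G c" "\<And>t. 0 < t \<Longrightarrow> dq u x \<xi> t \<le> G t"
  obtains j where "hl_integral (dq u x \<xi>) j" "j \<le> c"
proof -
  have "0 \<le> M"
    using assms(2)[of x] by simp
  then obtain b where "hl_integral (\<lambda>t. min (2 * \<bar>K\<bar> * t\<^sup>2) (4 * M) / t powr (1 + 2 * s)) b"
    using hl_integral_min_kernel[of "2 * \<bar>K\<bar>" "4 * M"] by (auto simp: mult.assoc)
  then have "hl_integral (\<lambda>t. - (min (2 * \<bar>K\<bar> * t\<^sup>2) (4 * M) / t powr (1 + 2 * s))) (- b)"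
    by (rule hl_integral_uminus)
  then show ?thesis
    using hl_integral_sandwich[OF dq_measurable[OF assms(1)] _ G(1)] dq_lower[OF assms(3,2,4)] G(2) that
    by blast
qed

text \<open>A paraboloid touching \<open>u\<close> from below bounds its second differences from below by an integrable
  kernel, so the inequality can be imposed on \<open>u\<close> itself instead of a test function.\<close>

definition super_at :: "('a::euclidean_space \<Rightarrow> real) \<Rightarrow> 'a \<Rightarrow> real \<Rightarrow> bool" where
  "super_at u x c \<longleftrightarrow> (\<forall>K. touch_below K u x \<longrightarrow>
     (\<forall>\<xi>. norm \<xi> = 1 \<longrightarrow> (\<exists>j\<le>c. hl_integral (dq u x \<xi>) j)))"

text \<open>The operator is a supremum over directions, so here a single direction matters instead
  of all. One reaching the bound is demanded outright; compactness of the sphere preserves this in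
  limits.\<close>

definition sub_at :: "('a::euclidean_space \<Rightarrow> real) \<Rightarrow> 'a \<Rightarrow> real \<Rightarrow> bool" where
  "sub_at u x c \<longleftrightarrow> (\<forall>K. touch_below K (\<lambda>z. - u z) x \<longrightarrow>
     (\<exists>\<xi>. norm \<xi> = 1 \<and> (\<exists>j\<ge>c. hl_integral (dq u x \<xi>) j)))"

text \<open>Lowering a function away from \<open>x\<close> lowers its second differences at
  \<open>x\<close>. Hence minima and attained infima of supersolutions inherit the inequality of the
  competitor that is active at the point.\<close>

lemma super_at_mono:
  fixes g h :: "'a::euclidean_space \<Rightarrow> real"
  assumes "super_at h x c" "\<And>z. g z \<le> h z" "g x = h x"
    and "g \<in> borel_measurable borel" "\<And>z. \<bar>g z\<bar> \<le> M"
  shows "super_at g x c"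
  unfolding super_at_def
proof (intro allI impI)
  fix K and \<xi> :: 'a assume K: "touch_below K g x" and \<xi>: "norm \<xi> = 1"
  then have "touch_below K h x"
    using touch_below_mono assms by metis
  then obtain j where j: "j \<le> c" "hl_integral (dq h x \<xi>) j"
    using assms(1) \<xi> by (auto simp: super_at_def)
  have "dq g x \<xi> t \<le> dq h x \<xi> t" for t
    unfolding dq_def second_diff_def using assms(2)[of "x + t *\<^sub>R \<xi>"] assms(2)[of "x - t *\<^sub>R \<xi>"] assms(3)
    by (intro divide_right_mono) auto
  then obtain j' where "hl_integral (dq g x \<xi>) j'" "j' \<le> j"
    using hl_integral_dq_le[OF assms(4,5) K \<xi> j(2)] by metis
  then show "\<exists>j\<le>c. hl_integral (dq g x \<xi>) j"
    using j(1) order_trans by metis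
qed

lemma super_at_weaken: "super_at u x c \<Longrightarrow> c \<le> c' \<Longrightarrow> super_at u x c'"
  unfolding super_at_def by (meson order_trans)

text \<open>The parameter \<open>l\<close> corresponds to \<open>\<mu> / C\<^sub>s\<close>, and \<open>f\<close> to a right-hand side \<open>- C\<^sub>s f\<close>.\<close>

definition supersol :: "'a::euclidean_space set \<Rightarrow> real \<Rightarrow> real \<Rightarrow> ('a \<Rightarrow> real) \<Rightarrow> bool" where
  "supersol \<Omega> l f u \<longleftrightarrow> u \<in> borel_measurable borel \<and> bounded (range u) \<and> lsc_on UNIV u \<and>
     (\<forall>x. 0 \<le> u x) \<and> (\<forall>x. x \<notin> \<Omega> \<longrightarrow> u x = 0) \<and> (\<forall>x\<in>\<Omega>. super_at u x (- (l * u x + f)))"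

lemma supersol_bound:
  assumes "supersol \<Omega> l f u"
  obtains M where "0 < M" "\<And>x. \<bar>u x\<bar> \<le> M" "\<And>x. u x \<le> M"
proof -
  obtain M where "0 < M" "\<And>x. \<bar>u x\<bar> \<le> M"
    using assms by (auto simp: supersol_def bounded_pos)
  then show ?thesis
    using that[of M] abs_le_D1 by metis
qed

text \<open>The cone is a concave power of the smooth function
  \<open>(norm (z - y))\<^sup>2\<close>. The tangent line of that power gives a paraboloid above the
  cone that touches it at a point off the vertex.\<close>

lemma norm_powr_le_tangent:
  fixes x y z :: "'a::euclidean_space"
  assumes "x \<noteq> y"
  defines "k \<equiv> (2 * s - 1) / 2 * ((norm (x - y))\<^sup>2) powr ((2 * s - 1) / 2 - 1)"
  shows "norm (z - y) powr (2 * s - 1) \<le> norm (x - y) powr (2 * s - 1)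
    + k * (2 * ((x - y) \<bullet> (z - x)) + (norm (z - x))\<^sup>2)"
proof -
  have sq: "(d\<^sup>2) powr ((2 * s - 1) / 2) = d powr (2 * s - 1)" if "0 \<le> d" for d :: real
  proof (cases "d = 0")
    case False
    then have "d\<^sup>2 = d powr 2"
      using that by simp
    moreover have "2 * ((2 * s - 1) / 2) = 2 * s - 1"
      by simp
    ultimately show ?thesis
      by (simp only: powr_powr)
  qed simp
  have "((norm (z - y))\<^sup>2) powr ((2 * s - 1) / 2) \<le> ((norm (x - y))\<^sup>2) powr ((2 * s - 1) / 2)
      + k * ((norm (z - y))\<^sup>2 - (norm (x - y))\<^sup>2)"
    unfolding k_def using assms(1) s_gt s_lt by (intro powr_le_tangent) auto
  also have "(norm (z - y))\<^sup>2 - (norm (x - y))\<^sup>2 = 2 * ((x - y) \<bullet> (z - x)) + (norm (z - x))\<^sup>2"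
    unfolding power2_norm_eq_inner by (simp add: algebra_simps inner_commute)
  finally show ?thesis
    by (simp add: sq)
qed

text \<open>If \<open>u\<close> dipped below the cone, the gap would be largest at a point of
  \<Omega> off the vertex. The paraboloid above the cone makes \<open>u\<close> touchable there, so
  its inequality applies in the radial direction; on that line the cone has integral 0, against
  strictness.\<close>

lemma cone_comparison:
  fixes \<Omega> :: "'a::euclidean_space set"
  assumes u: "supersol \<Omega> l f u" and "bounded \<Omega>" "y \<in> \<Omega>" "0 \<le> L"
    and out: "\<And>x. x \<notin> \<Omega> \<Longrightarrow> u y \<le> L * norm (x - y) powr (2 * s - 1)"
    and strict: "\<And>x. x \<in> \<Omega> \<Longrightarrow> 0 < l * u x + f"
  shows "u y - L * norm (x - y) powr (2 * s - 1) \<le> u x"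
proof (rule ccontr)
  let ?a = "2 * s - 1"
  define g where "g z = u z + (L * norm (z - y) powr ?a - u y)" for z
  assume "\<not> ?thesis"
  then have x: "g x < 0"
    by (simp add: g_def)
  have u0: "\<And>z. 0 \<le> u z" "\<And>z. z \<notin> \<Omega> \<Longrightarrow> u z = 0" and lsc: "lsc_on UNIV u"
    using u by (auto simp: supersol_def)
  have out': "0 \<le> g z" if "z \<notin> \<Omega>" for z
    using out[OF that] u0(1)[of z] by (simp add: g_def)
  have gy: "0 \<le> g y"
    using assms(4) by (simp add: g_def)
  have "lsc_on UNIV g"
    unfolding g_def[abs_def] using s_gt
    by (intro lsc_on_UNIV_add lsc lsc_on_UNIV_continuous continuous_intros continuous_on_powr') auto
  then obtain x0 where x0: "x0 \<in> closure \<Omega>" "\<And>z. z \<in> closure \<Omega> \<Longrightarrow> g x0 \<le> g z"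
    using lsc_on_UNIV_attains_inf[of "closure \<Omega>" g] assms(2,3) by (auto simp: compact_closure)
  have "x \<in> \<Omega>"
    using out'[of x] x by force
  then have gx0: "g x0 < 0"
    using x0(2)[of x] x closure_subset[of \<Omega>] by force
  then have "x0 \<in> \<Omega>" "x0 \<noteq> y"
    using out'[of x0] gy by force+
  have min: "g x0 \<le> g z" for z
    using x0(2)[of z] out'[of z] gx0 closure_subset[of \<Omega>] by (cases "z \<in> \<Omega>") auto
  define d where "d = norm (x0 - y)"
  have d: "0 < d"
    using \<open>x0 \<noteq> y\<close> by (simp add: d_def)
  define k where "k = (2 * s - 1) / 2 * ((norm (x0 - y))\<^sup>2) powr ((2 * s - 1) / 2 - 1)"
  have "u x0 + (- (L * k * 2) *\<^sub>R (x0 - y)) \<bullet> (z - x0) - L * k * (norm (z - x0))\<^sup>2 \<le> u z" for z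
  proof -
    have "L * norm (z - y) powr ?a \<le> L * (norm (x0 - y) powr ?a + k * (2 * ((x0 - y) \<bullet> (z - x0)) + (norm (z - x0))\<^sup>2))"
      using norm_powr_le_tangent[OF \<open>x0 \<noteq> y\<close>, of z, folded k_def] assms(4) by (intro mult_left_mono)
    then show ?thesis
      using min[of z] by (simp add: g_def algebra_simps)
  qed
  then have "touch_below (L * k) u x0"
    unfolding touch_below_def by blast
  moreover define \<xi> where "\<xi> = (x0 - y) /\<^sub>R d"
  have \<xi>: "norm \<xi> = 1" "d *\<^sub>R \<xi> = x0 - y"
    using d by (auto simp: \<xi>_def) (simp add: d_def)
  moreover have "super_at u x0 (- (l * u x0 + f))"
    using u \<open>x0 \<in> \<Omega>\<close> by (simp add: supersol_def)
  ultimately obtain j where j: "j \<le> - (l * u x0 + f)" "hl_integral (dq u x0 \<xi>) j"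
    unfolding super_at_def using \<xi>(1) by blast
  have "- L * 0 \<le> j"
  proof (rule hl_integral_mono[OF hl_integral_cmult[OF hl_integral_radial_cone[OF d]] j(2)])
    fix t :: real assume "0 < t"
    have "x0 + t *\<^sub>R \<xi> - y = (d + t) *\<^sub>R \<xi>" "x0 - t *\<^sub>R \<xi> - y = (d - t) *\<^sub>R \<xi>"
      using \<xi>(2) by (simp_all add: algebra_simps)
    then have "norm (x0 + t *\<^sub>R \<xi> - y) = \<bar>d + t\<bar>" "norm (x0 - t *\<^sub>R \<xi> - y) = \<bar>d - t\<bar>"
      using \<xi>(1) by simp_all
    then have "- L * (\<bar>d + t\<bar> powr ?a + \<bar>d - t\<bar> powr ?a - 2 * d powr ?a) \<le> second_diff u x0 (t *\<^sub>R \<xi>)"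
      using min[of "x0 + t *\<^sub>R \<xi>"] min[of "x0 - t *\<^sub>R \<xi>"] d_def
      by (simp add: g_def second_diff_def algebra_simps)
    then show "- L * ((\<bar>d + t\<bar> powr ?a + \<bar>d - t\<bar> powr ?a - 2 * d powr ?a) / t powr (1 + 2 * s)) \<le> dq u x0 \<xi> t"
      unfolding dq_def times_divide_eq_right by (rule divide_right_mono) simp
  qed
  then show False
    using j(1) strict[OF \<open>x0 \<in> \<Omega>\<close>] by simp
qed

end

section \<open>Stability and compactness\<close>

lemma uniform_limit_subseq:
  assumes "uniform_limit S U u sequentially" "strict_mono r"
  shows "uniform_limit S (\<lambda>n. U (r n)) u sequentially"
  using assms unfolding uniform_limit_sequentially_iff
  by (meson le_trans seq_suble)

lemma uniform_limit_neg:
  fixes U :: "nat \<Rightarrow> 'a \<Rightarrow> real"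
  shows "uniform_limit S U u sequentially \<Longrightarrow> uniform_limit S (\<lambda>n y. - U n y) (\<lambda>y. - u y) sequentially"
  unfolding uniform_limit_sequentially_iff by (simp add: dist_real_def abs_minus_commute)

lemma uniform_limit_diagonal:
  fixes U :: "nat \<Rightarrow> 'a::t2_space \<Rightarrow> real"
  assumes "uniform_limit UNIV U u sequentially" "continuous_on UNIV u" "z \<longlonglongrightarrow> x"
  shows "(\<lambda>n. U n (z n)) \<longlonglongrightarrow> u x"
proof -
  have "(\<lambda>n. U n (z n) - u (z n)) \<longlonglongrightarrow> 0"
  proof (rule LIMSEQ_I)
    fix e :: real assume "0 < e"
    then obtain N where "\<forall>n\<ge>N. \<forall>y. dist (U n y) (u y) < e"
      using assms(1) by (auto simp: uniform_limit_sequentially_iff)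
    then show "\<exists>N. \<forall>n\<ge>N. norm (U n (z n) - u (z n) - 0) < e"
      by (auto simp: dist_norm intro!: exI[of _ N])
  qed
  moreover have "(\<lambda>n. u (z n)) \<longlonglongrightarrow> u x"
    using assms(2,3) by (auto intro: continuous_on_tendsto_compose)
  ultimately show ?thesis
    using tendsto_add by fastforce
qed

lemma uniform_limit_bound:
  assumes "uniform_limit UNIV U u sequentially" "\<And>n z. \<bar>U n z :: real\<bar> \<le> M"
  shows "\<bar>u z\<bar> \<le> M"
proof -
  have "(\<lambda>n. U n z) \<longlonglongrightarrow> u z"
    using assms(1) by (intro tendsto_uniform_limitI[where S=UNIV]) auto
  then show ?thesis
    by (intro LIMSEQ_le_const2[OF tendsto_rabs]) (auto simp: assms(2))
qed

text \<open>Adding \<open>\<bar>z - x\<bar>\<^sup>2\<close> makes the contact strict, so that it survives a small uniform perturbation.\<close>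

lemma touch_below_perturb:
  fixes u v :: "'a::euclidean_space \<Rightarrow> real"
  assumes "continuous_on UNIV v" "touch_below K u x" "\<And>z. \<bar>v z - u z\<bar> \<le> 1/2"
  shows "\<exists>y. touch_below (\<bar>K\<bar> + 1) v y \<and> (\<forall>e. (\<forall>z. \<bar>v z - u z\<bar> \<le> e) \<longrightarrow> (norm (y - x))\<^sup>2 \<le> 2 * e)"
proof -
  have "touch_below \<bar>K\<bar> u x"
    using touch_below_mono_const[OF assms(2)] by simp
  then obtain p where p: "\<And>z. u x + p \<bullet> (z - x) - \<bar>K\<bar> * (norm (z - x))\<^sup>2 \<le> u z"
    by (auto simp: touch_below_def)
  define g where "g z = v z - p \<bullet> (z - x) + (\<bar>K\<bar> + 1) * (norm (z - x))\<^sup>2" for z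
  have low: "u x + (v z - u z) + (norm (z - x))\<^sup>2 \<le> g z" for z
    using p[of z] by (simp add: g_def algebra_simps)
  have "continuous_on (cball x 1) g"
    unfolding g_def by (intro continuous_intros continuous_on_subset[OF assms(1)]) auto
  then obtain y where y: "y \<in> cball x 1" "\<And>z. z \<in> cball x 1 \<Longrightarrow> g y \<le> g z"
    using continuous_attains_inf[of "cball x 1" g] by (auto simp: compact_cball)
  have gx: "g x = v x"
    by (simp add: g_def)
  \<comment> \<open>Outside the unit ball the extra \<open>(norm (z - x))\<^sup>2\<close> is at
    least 1 and outweighs the two errors of at most 1/2, so the minimum over the ball is
    global.\<close>
  have min: "g y \<le> g z" for z
  proof (cases "z \<in> cball x 1")
    case False
    then have "1 \<le> (norm (z - x))\<^sup>2"
      by (intro one_le_power) (simp add: dist_norm norm_minus_commute)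
    then have "v x \<le> g z"
      using low[of z] abs_le_D2[OF assms(3)[of z]] abs_le_D1[OF assms(3)[of x]] by linarith
    then show ?thesis
      using y(2)[of x] gx by simp
  qed (use y in auto)
  have "v y + (p - (2 * (\<bar>K\<bar> + 1)) *\<^sub>R (y - x)) \<bullet> (z - y) - (\<bar>K\<bar> + 1) * (norm (z - y))\<^sup>2 \<le> v z" for z
  proof -
    have "(norm (z - x))\<^sup>2 = (norm (z - y))\<^sup>2 + 2 * ((y - x) \<bullet> (z - y)) + (norm (y - x))\<^sup>2"
      unfolding power2_norm_eq_inner by (simp add: algebra_simps inner_commute)
    then have "(\<bar>K\<bar> + 1) * (norm (z - x))\<^sup>2 = (\<bar>K\<bar> + 1) * (norm (z - y))\<^sup>2
        + (2 * (\<bar>K\<bar> + 1)) * ((y - x) \<bullet> (z - y)) + (\<bar>K\<bar> + 1) * (norm (y - x))\<^sup>2"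
      by (simp only: distrib_left) simp
    moreover have "p \<bullet> (z - x) = p \<bullet> (z - y) + p \<bullet> (y - x)"
      by (simp add: inner_diff_right)
    moreover have "(p - (2 * (\<bar>K\<bar> + 1)) *\<^sub>R (y - x)) \<bullet> (z - y) = p \<bullet> (z - y) - (2 * (\<bar>K\<bar> + 1)) * ((y - x) \<bullet> (z - y))"
      by (simp add: inner_diff_left)
    ultimately show ?thesis
      using min[of z] unfolding g_def by linarith
  qed
  then have "touch_below (\<bar>K\<bar> + 1) v y"
    unfolding touch_below_def by blast
  moreover have "(norm (y - x))\<^sup>2 \<le> 2 * e" if "\<forall>z. \<bar>v z - u z\<bar> \<le> e" for e
    using low[of y] min[of x] gx abs_le_D2[OF that[rule_format, of y]] abs_le_D1[OF that[rule_format, of x]]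
    by linarith
  ultimately show ?thesis
    by blast
qed

lemma touch_below_sequence:
  fixes U :: "nat \<Rightarrow> 'a::euclidean_space \<Rightarrow> real"
  assumes "\<And>n. continuous_on UNIV (U n)" "uniform_limit UNIV U u sequentially" "touch_below K u x"
  obtains r K' z where "strict_mono (r :: nat \<Rightarrow> nat)" "z \<longlonglongrightarrow> x" "\<And>n. touch_below K' (U (r n)) (z n)"
proof -
  have conv: "\<exists>N. \<forall>n\<ge>N. \<forall>z. \<bar>U n z - u z\<bar> \<le> e" if "0 < e" for e
    using assms(2) that by (force simp: uniform_limit_sequentially_iff dist_real_def intro: less_imp_le)
  obtain N where N: "\<And>n z. n \<ge> N \<Longrightarrow> \<bar>U n z - u z\<bar> \<le> 1/2"
    using conv[of "1/2"] by auto
  have "\<forall>n. \<exists>y. touch_below (\<bar>K\<bar> + 1) (U (n + N)) y \<and>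
      (\<forall>e. (\<forall>z. \<bar>U (n + N) z - u z\<bar> \<le> e) \<longrightarrow> (norm (y - x))\<^sup>2 \<le> 2 * e)"
    using N assms by (intro allI touch_below_perturb) auto
  then obtain y where y: "\<And>n. touch_below (\<bar>K\<bar> + 1) (U (n + N)) (y n)"
      "\<And>n e. (\<forall>z. \<bar>U (n + N) z - u z\<bar> \<le> e) \<Longrightarrow> (norm (y n - x))\<^sup>2 \<le> 2 * e"
    by metis
  have "y \<longlonglongrightarrow> x"
  proof (rule LIMSEQ_I)
    fix e :: real assume "0 < e"
    then obtain N' where "\<And>n z. n \<ge> N' \<Longrightarrow> \<bar>U n z - u z\<bar> \<le> e\<^sup>2 / 4"
      using conv[of "e\<^sup>2 / 4"] by auto
    then have "(norm (y n - x))\<^sup>2 \<le> 2 * (e\<^sup>2 / 4)" if "n \<ge> N'" for n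
      using that by (intro y(2)) auto
    then have "(norm (y n - x))\<^sup>2 < e\<^sup>2" if "n \<ge> N'" for n
      using that[rule_format] \<open>0 < e\<close> zero_less_power[OF \<open>0 < e\<close>, of 2] \<open>\<And>n. N' \<le> n \<Longrightarrow> (norm (y n - x))\<^sup>2 \<le> 2 * (e\<^sup>2 / 4)\<close>[of n] by linarith
    then show "\<exists>N. \<forall>n\<ge>N. norm (y n - x) < e"
      using \<open>0 < e\<close> power_less_imp_less_base by (metis less_imp_le)
  qed
  moreover have "strict_mono (\<lambda>n. n + N)"
    by (simp add: strict_mono_def)
  ultimately show ?thesis
    using that y(1) by blast
qed

context frac_order
begin

text \<open>Contact with one common \<open>K\<close> bounds all quotients below by the same kernel,
  so Fatou applies although functions, base points and directions all vary. Upper bounds pass to the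
  limit, as supersolutions require.\<close>

lemma hl_integral_dq_limit:
  fixes U :: "nat \<Rightarrow> 'a::euclidean_space \<Rightarrow> real"
  assumes "\<And>n. U n \<in> borel_measurable borel" and M: "\<And>n z. \<bar>U n z\<bar> \<le> M"
    and lim: "uniform_limit UNIV U u sequentially" and cont: "continuous_on UNIV u"
    and z: "z \<longlonglongrightarrow> x" and \<xi>: "\<xi> \<longlonglongrightarrow> \<xi>'" "\<And>n. norm (\<xi> n) = 1"
    and touch: "\<And>n. touch_below K (U n) (z n)"
    and int: "\<And>n. hl_integral (dq (U n) (z n) (\<xi> n)) (j n)" and c: "\<And>n. j n \<le> c n" "c \<longlonglongrightarrow> c'"
  obtains i where "hl_integral (dq u x \<xi>') i" "i \<le> c'"
proof -
  have "0 \<le> M"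
    using M[of 0 0] by simp
  then obtain b where b: "hl_integral (\<lambda>t. min (2 * \<bar>K\<bar> * t\<^sup>2) (4 * M) / t powr (1 + 2 * s)) b"
    using hl_integral_min_kernel[of "2 * \<bar>K\<bar>" "4 * M"] by (auto simp: mult.assoc)
  have pt: "(\<lambda>n. dq (U n) (z n) (\<xi> n) t) \<longlonglongrightarrow> dq u x \<xi>' t" if "0 < t" for t
    unfolding dq_def second_diff_def using that
    by (intro tendsto_intros uniform_limit_diagonal[OF lim cont] z \<xi>(1)) auto
  show ?thesis
  proof (rule hl_integral_fatou[where f="\<lambda>n. dq (U n) (z n) (\<xi> n)" and g="dq u x \<xi>'" and j=j and c=c and c'=c'])
    show "dq (U n) (z n) (\<xi> n) \<in> borel_measurable borel" for n
      by (rule dq_measurable[OF assms(1)])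
    show "- (min (2 * \<bar>K\<bar> * t\<^sup>2) (4 * M) / t powr (1 + 2 * s)) \<le> dq (U n) (z n) (\<xi> n) t" for n t
      by (rule dq_lower[OF touch M \<xi>(2)])
  qed (fact b pt int c that)+
qed

lemma super_at_limit:
  fixes U :: "nat \<Rightarrow> 'a::euclidean_space \<Rightarrow> real"
  assumes cont: "\<And>n. continuous_on UNIV (U n)" and M: "\<And>n z. \<bar>U n z\<bar> \<le> M"
    and lim: "uniform_limit UNIV U u sequentially" and "open \<Omega>" "x \<in> \<Omega>"
    and super: "\<And>n z. z \<in> \<Omega> \<Longrightarrow> super_at (U n) z (- (l n * U n z + f n))"
    and "l \<longlonglongrightarrow> l'" "f \<longlonglongrightarrow> f'"
  shows "super_at u x (- (l' * u x + f'))"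
  unfolding super_at_def
proof (intro allI impI)
  fix K and \<xi> :: 'a assume "touch_below K u x" and \<xi>: "norm \<xi> = 1"
  obtain r z K' where r: "strict_mono (r :: nat \<Rightarrow> nat)" and z: "z \<longlonglongrightarrow> x"
    and touch: "\<And>n. touch_below K' (U (r n)) (z n)"
    by (rule touch_below_sequence[OF cont lim \<open>touch_below K u x\<close>]) (rule that; assumption)
  obtain N where N: "\<And>n. n \<ge> N \<Longrightarrow> z n \<in> \<Omega>"
    using topological_tendstoD[OF z \<open>open \<Omega>\<close> \<open>x \<in> \<Omega>\<close>] by (auto simp: eventually_sequentially)
  define q where "q n = r (n + N)" for n
  have q: "strict_mono q"
    using r by (simp add: q_def strict_mono_def)
  have limq: "uniform_limit UNIV (\<lambda>n. U (q n)) u sequentially"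
    using lim q by (rule uniform_limit_subseq)
  have zN: "(\<lambda>n. z (n + N)) \<longlonglongrightarrow> x"
    using z by (rule LIMSEQ_ignore_initial_segment)
  have contu: "continuous_on UNIV u"
    using lim cont by (intro uniform_limit_theorem[OF _ lim]) auto
  have "\<exists>j. j \<le> - (l (q n) * U (q n) (z (n + N)) + f (q n)) \<and> hl_integral (dq (U (q n)) (z (n + N)) \<xi>) j" for n
    using super[of "z (n + N)" "q n"] N[of "n + N"] touch[of "n + N"] \<xi> unfolding super_at_def q_def by auto
  then obtain j where j: "\<And>n. j n \<le> - (l (q n) * U (q n) (z (n + N)) + f (q n))"
    "\<And>n. hl_integral (dq (U (q n)) (z (n + N)) \<xi>) (j n)"
    by metis
  have clim: "(\<lambda>n. - (l (q n) * U (q n) (z (n + N)) + f (q n))) \<longlonglongrightarrow> - (l' * u x + f')"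
    using uniform_limit_diagonal[OF limq contu zN] LIMSEQ_subseq_LIMSEQ[OF assms(7) q] LIMSEQ_subseq_LIMSEQ[OF assms(8) q]
    by (intro tendsto_intros) (auto simp: o_def)
  have meas: "U (q n) \<in> borel_measurable borel" and touchq: "touch_below K' (U (q n)) (z (n + N))" for n
    using touch cont by (auto simp: q_def intro: borel_measurable_continuous_onI)
  show "\<exists>j\<le>- (l' * u x + f'). hl_integral (dq u x \<xi>) j"
    by (rule hl_integral_dq_limit[where U="\<lambda>n. U (q n)" and u=u and z="\<lambda>n. z (n + N)" and x=x and \<xi>="\<lambda>_. \<xi>"
        and \<xi>'=\<xi> and j=j and c="\<lambda>n. - (l (q n) * U (q n) (z (n + N)) + f (q n))"])
      (rule meas M limq contu zN \<xi> touchq j clim tendsto_const | intro exI conjI; assumption)+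
qed

lemma dq_uminus: "dq (\<lambda>z. - u z) x \<xi> t = - dq u x \<xi> t"
  by (simp add: dq_def second_diff_def divide_simps)

text \<open>The previous limit applied to \<open>- U n\<close>, along a subsequence on which the
  directions converge in the compact unit sphere.\<close>

lemma hl_integral_dq_upper_limit:
  fixes U :: "nat \<Rightarrow> 'a::euclidean_space \<Rightarrow> real"
  assumes "\<And>n. U n \<in> borel_measurable borel" and M: "\<And>n z. \<bar>U n z\<bar> \<le> M"
    and lim: "uniform_limit UNIV U u sequentially" and cont: "continuous_on UNIV u"
    and z: "z \<longlonglongrightarrow> x" and \<xi>: "\<And>n. norm (\<xi> n) = 1"
    and touch: "\<And>n. touch_below K (\<lambda>y. - U n y) (z n)"
    and int: "\<And>n. hl_integral (dq (U n) (z n) (\<xi> n)) (j n)" and c: "\<And>n. c n \<le> j n" "c \<longlonglongrightarrow> c'"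
  obtains \<xi>' i where "norm \<xi>' = 1" "hl_integral (dq u x \<xi>') i" "c' \<le> i"
proof -
  obtain \<xi>' q where \<xi>': "\<xi>' \<in> sphere 0 1" and q: "strict_mono (q :: nat \<Rightarrow> nat)" and lim\<xi>: "(\<lambda>n. \<xi> (q n)) \<longlonglongrightarrow> \<xi>'"
  proof (rule seq_compactE[OF compact_imp_seq_compact[OF compact_sphere[of 0 1]], of \<xi>])
    show "\<forall>n. \<xi> n \<in> sphere 0 1"
      using \<xi> by simp
  qed (rule that; simp add: o_def)
  have limq: "uniform_limit UNIV (\<lambda>n y. - U (q n) y) (\<lambda>y. - u y) sequentially"
    using uniform_limit_neg[OF uniform_limit_subseq[OF lim q]] .
  have zq: "(\<lambda>n. z (q n)) \<longlonglongrightarrow> x" and cq: "(\<lambda>n. - c (q n)) \<longlonglongrightarrow> - c'"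
    using LIMSEQ_subseq_LIMSEQ[OF z q] tendsto_minus[OF LIMSEQ_subseq_LIMSEQ[OF c(2) q]] by (auto simp: o_def)
  have intq: "hl_integral (dq (\<lambda>y. - U (q n) y) (z (q n)) (\<xi> (q n))) (- j (q n))" for n
    using hl_integral_uminus[OF int[of "q n"]] by (simp add: dq_uminus[abs_def])
  obtain i where "hl_integral (dq (\<lambda>y. - u y) x \<xi>') i" "i \<le> - c'"
  proof (rule hl_integral_dq_limit[where U="\<lambda>n y. - U (q n) y" and u="\<lambda>y. - u y" and z="\<lambda>n. z (q n)" and x=x
        and \<xi>="\<lambda>n. \<xi> (q n)" and \<xi>'=\<xi>' and j="\<lambda>n. - j (q n)" and c="\<lambda>n. - c (q n)" and c'="- c'"])
    show "(\<lambda>y. - U (q n) y) \<in> borel_measurable borel" for n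
      using assms(1) by simp
    show "\<bar>- U (q n) y\<bar> \<le> M" for n y
      using M by simp
    show "continuous_on UNIV (\<lambda>y. - u y)"
      by (intro continuous_intros cont)
    show "- j (q n) \<le> - c (q n)" for n
      using c(1) by simp
  qed (rule limq zq lim\<xi> \<xi> touch intq cq | rule that; assumption)+
  then show ?thesis
    using that[of \<xi>' "- i"] hl_integral_uminus[of "dq (\<lambda>y. - u y) x \<xi>'" i] \<xi>' by (simp add: dq_uminus[abs_def])
qed

lemma sub_at_limit:
  fixes U :: "nat \<Rightarrow> 'a::euclidean_space \<Rightarrow> real"
  assumes cont: "\<And>n. continuous_on UNIV (U n)" and M: "\<And>n z. \<bar>U n z\<bar> \<le> M"
    and lim: "uniform_limit UNIV U u sequentially" and "open \<Omega>" "x \<in> \<Omega>"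
    and sub: "\<And>n z. z \<in> \<Omega> \<Longrightarrow> sub_at (U n) z (- (l n * U n z + f n))"
    and "l \<longlonglongrightarrow> l'" "f \<longlonglongrightarrow> f'"
  shows "sub_at u x (- (l' * u x + f'))"
  unfolding sub_at_def
proof (intro allI impI)
  fix K assume K: "touch_below K (\<lambda>y. - u y) x"
  obtain r z K' where r: "strict_mono (r :: nat \<Rightarrow> nat)" and z: "z \<longlonglongrightarrow> x"
    and touch: "\<And>n. touch_below K' (\<lambda>y. - U (r n) y) (z n)"
    by (rule touch_below_sequence[OF continuous_on_minus[OF cont] uniform_limit_neg[OF lim] K]) (rule that; assumption)
  obtain N where N: "\<And>n. n \<ge> N \<Longrightarrow> z n \<in> \<Omega>"
    using topological_tendstoD[OF z \<open>open \<Omega>\<close> \<open>x \<in> \<Omega>\<close>] by (auto simp: eventually_sequentially)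
  define q where "q n = r (n + N)" for n
  have q: "strict_mono q"
    using r by (simp add: q_def strict_mono_def)
  have limq: "uniform_limit UNIV (\<lambda>n. U (q n)) u sequentially"
    using lim q by (rule uniform_limit_subseq)
  have zN: "(\<lambda>n. z (n + N)) \<longlonglongrightarrow> x"
    using z by (rule LIMSEQ_ignore_initial_segment)
  have contu: "continuous_on UNIV u"
    using lim cont by (intro uniform_limit_theorem[OF _ lim]) auto
  have "\<exists>\<xi> j. norm \<xi> = 1 \<and> - (l (q n) * U (q n) (z (n + N)) + f (q n)) \<le> j \<and> hl_integral (dq (U (q n)) (z (n + N)) \<xi>) j" for n
    using sub[of "z (n + N)" "q n"] N[of "n + N"] touch[of "n + N"] unfolding sub_at_def q_def by auto
  then obtain \<xi> j where j: "\<And>n. norm (\<xi> n) = 1" "\<And>n. - (l (q n) * U (q n) (z (n + N)) + f (q n)) \<le> j n"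
    "\<And>n. hl_integral (dq (U (q n)) (z (n + N)) (\<xi> n)) (j n)"
    by metis
  have clim: "(\<lambda>n. - (l (q n) * U (q n) (z (n + N)) + f (q n))) \<longlonglongrightarrow> - (l' * u x + f')"
    using uniform_limit_diagonal[OF limq contu zN] LIMSEQ_subseq_LIMSEQ[OF assms(7) q] LIMSEQ_subseq_LIMSEQ[OF assms(8) q]
    by (intro tendsto_intros) (auto simp: o_def)
  have meas: "U (q n) \<in> borel_measurable borel" and touchq: "touch_below K' (\<lambda>y. - U (q n) y) (z (n + N))" for n
    using touch cont by (auto simp: q_def intro: borel_measurable_continuous_onI)
  show "\<exists>\<xi>. norm \<xi> = 1 \<and> (\<exists>j\<ge>- (l' * u x + f'). hl_integral (dq u x \<xi>) j)"
    by (rule hl_integral_dq_upper_limit[where U="\<lambda>n. U (q n)" and u=u and z="\<lambda>n. z (n + N)" and x=x and \<xi>=\<xi>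
        and j=j and c="\<lambda>n. - (l (q n) * U (q n) (z (n + N)) + f (q n))"])
      (rule meas M limq contu zN j touchq clim | intro exI conjI; assumption)+
qed

section \<open>Compactness from uniform Hoelder bounds\<close>

lemma holder_imp_continuous:
  fixes u :: "'a::euclidean_space \<Rightarrow> real"
  assumes "\<And>x y. \<bar>u x - u y\<bar> \<le> L * norm (x - y) powr (2 * s - 1)"
  shows "continuous_on UNIV u"
  unfolding continuous_on_def
proof
  fix x :: 'a
  have "((\<lambda>y. norm (y - x)) \<longlongrightarrow> 0) (at x)"
    by (rule tendsto_norm_zero[OF LIM_zero[OF tendsto_ident_at]])
  then have "((\<lambda>y. norm (y - x) powr (2 * s - 1)) \<longlongrightarrow> 0 powr (2 * s - 1)) (at x)"
    using s_gt by (intro tendsto_powr') auto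
  then have "((\<lambda>y. L * norm (y - x) powr (2 * s - 1)) \<longlongrightarrow> 0) (at x)"
    using tendsto_mult_left[where c=L] s_gt by fastforce
  then have "((\<lambda>y. u y - u x) \<longlongrightarrow> 0) (at x)"
    by (rule Lim_null_comparison[rotated]) (simp add: assms)
  then show "(u \<longlongrightarrow> u x) (at x within UNIV)"
    by (simp add: LIM_zero_iff)
qed

text \<open>Arzela-Ascoli on \<open>closure \<Omega>\<close>. All functions vanish outside \<Omega>,
  so the limit extended by 0 is approached uniformly on the whole space, as the nonlocal tails
  require.\<close>

lemma holder_compactness:
  fixes U :: "nat \<Rightarrow> 'a::euclidean_space \<Rightarrow> real"
  assumes holder: "\<And>n x y. \<bar>U n x - U n y\<bar> \<le> L * norm (x - y) powr (2 * s - 1)"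
    and M: "\<And>n x. \<bar>U n x\<bar> \<le> M" and zero: "\<And>n x. x \<notin> \<Omega> \<Longrightarrow> U n x = 0" and "bounded \<Omega>"
  obtains r u where "strict_mono (r :: nat \<Rightarrow> nat)" "uniform_limit UNIV (\<lambda>n. U (r n)) u sequentially"
    "\<And>x y. \<bar>u x - u y\<bar> \<le> L * norm (x - y) powr (2 * s - 1)" "\<And>x. x \<notin> \<Omega> \<Longrightarrow> u x = 0"
proof -
  obtain g r where r: "strict_mono (r :: nat \<Rightarrow> nat)" and
    g: "\<And>e. 0 < e \<Longrightarrow> \<exists>N. \<forall>n x. n \<ge> N \<and> x \<in> closure \<Omega> \<longrightarrow> norm (U (r n) x - g x) < e"
  proof (rule Arzela_Ascoli[of "closure \<Omega>" U M])
    show "\<exists>d>0. \<forall>n y. y \<in> closure \<Omega> \<and> norm (x - y) < d \<longrightarrow> norm (U n x - U n y) < e" if "0 < e" for x e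
    proof -
      define d where "d = (e / (\<bar>L\<bar> + 1)) powr (1 / (2 * s - 1))"
      have "norm (U n x - U n y) < e" if "norm (x - y) < d" for n y
      proof -
        have "norm (x - y) powr (2 * s - 1) \<le> d powr (2 * s - 1)"
          using that s_gt by (intro powr_mono2) auto
        also have "\<dots> = e / (\<bar>L\<bar> + 1)"
          using \<open>0 < e\<close> s_gt by (simp add: d_def powr_powr)
        finally have e: "(\<bar>L\<bar> + 1) * norm (x - y) powr (2 * s - 1) \<le> e"
          by (simp add: pos_le_divide_eq mult.commute)
        have L: "L * norm (x - y) powr (2 * s - 1) \<le> \<bar>L\<bar> * norm (x - y) powr (2 * s - 1)"
          by (intro mult_right_mono) auto
        show ?thesis
        proof (cases "x = y")
          case False
          then have "0 < norm (x - y) powr (2 * s - 1)"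
            by simp
          then show ?thesis
            using holder[of n x y] e L by (simp only: distrib_right real_norm_def)
        qed (use \<open>0 < e\<close> in simp)
      qed
      moreover have "0 < d"
        using \<open>0 < e\<close> by (simp add: d_def)
      ultimately show ?thesis by blast
    qed
  qed (use M \<open>bounded \<Omega>\<close> in \<open>auto simp: compact_closure\<close>)
  define u where "u x = (if x \<in> closure \<Omega> then g x else 0)" for x
  have lim: "uniform_limit UNIV (\<lambda>n. U (r n)) u sequentially"
    unfolding uniform_limit_sequentially_iff
  proof (intro allI impI)
    fix e :: real assume "0 < e"
    then obtain N where N: "\<And>n x. n \<ge> N \<Longrightarrow> x \<in> closure \<Omega> \<Longrightarrow> norm (U (r n) x - g x) < e"
      using g by blast
    have "dist (U (r n) x) (u x) < e" if "n \<ge> N" for n x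
    proof (cases "x \<in> closure \<Omega>")
      case False
      then have "x \<notin> \<Omega>"
        using closure_subset by blast
      then show ?thesis
        using False zero \<open>0 < e\<close> by (simp add: u_def)
    qed (use N[OF that] in \<open>simp add: u_def dist_norm\<close>)
    then show "\<exists>N. \<forall>n\<ge>N. \<forall>x\<in>UNIV. dist (U (r n) x) (u x) < e"
      by blast
  qed
  have pt: "(\<lambda>n. U (r n) x) \<longlonglongrightarrow> u x" for x
    using lim by (intro tendsto_uniform_limitI[where S=UNIV]) auto
  show ?thesis
  proof (rule that[OF r lim])
    show "\<bar>u x - u y\<bar> \<le> L * norm (x - y) powr (2 * s - 1)" for x y
      by (rule LIMSEQ_le_const2[OF tendsto_rabs[OF tendsto_diff[OF pt pt]]]) (use holder in auto)
    show "u x = 0" if "x \<notin> \<Omega>" for x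
      using pt[of x] zero[OF that] LIMSEQ_unique[OF _ tendsto_const] by auto
  qed
qed

end

section \<open>The barrier of a uniformly convex domain\<close>

text \<open>Compactness of \<open>Y\<close> provides a farthest centre for every point, so that one
  ball can stand for the whole intersection.\<close>

locale ball_hull = frac_order +
  fixes \<Omega> Y :: "'a::euclidean_space set" and R :: real
  assumes R_pos: "0 < R" and Y_compact: "compact Y" and Y_nonempty: "Y \<noteq> {}"
    and open_\<Omega>: "open \<Omega>" and \<Omega>_nonempty: "\<Omega> \<noteq> {}"
    and \<Omega>_iff: "x \<in> \<Omega> \<longleftrightarrow> (\<forall>y\<in>Y. norm (x - y) < R)"
begin

lemma bounded_\<Omega>: "bounded \<Omega>"
proof -
  obtain y where "y \<in> Y"
    using Y_nonempty by blast
  then have "\<Omega> \<subseteq> ball y R"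
    using \<Omega>_iff by (auto simp: dist_norm norm_minus_commute)
  then show ?thesis
    using bounded_ball bounded_subset by blast
qed

definition far :: "'a \<Rightarrow> real" where
  "far x = (SUP y\<in>Y. norm (x - y))"

lemma far_attained: "\<exists>y\<in>Y. far x = norm (x - y)" and far_upper: "y \<in> Y \<Longrightarrow> norm (x - y) \<le> far x"
proof -
  have "continuous_on Y (\<lambda>y. norm (x - y))"
    by (intro continuous_intros)
  then obtain y where y: "y \<in> Y" "\<And>z. z \<in> Y \<Longrightarrow> norm (x - z) \<le> norm (x - y)"
    using continuous_attains_sup[OF Y_compact Y_nonempty] by blast
  then have "far x = norm (x - y)"
    unfolding far_def by (intro cSup_eq_maximum) auto
  with y show "\<exists>y\<in>Y. far x = norm (x - y)" "y' \<in> Y \<Longrightarrow> norm (x - y') \<le> far x" for y'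
    by auto
qed

lemma far_nonneg: "0 \<le> far x"
  using far_attained[of x] by auto

lemma far_lipschitz: "far x \<le> norm (x - z) + far z"
proof -
  obtain y where y: "y \<in> Y" "far x = norm (x - y)"
    using far_attained by blast
  then show ?thesis
    using norm_triangle_ineq[of "x - z" "z - y"] far_upper[OF y(1), of z] by simp
qed

lemma continuous_on_far: "continuous_on UNIV far"
  unfolding continuous_on_iff
proof (intro ballI allI impI)
  fix x :: 'a and e' :: real assume "0 < e'"
  have "dist (far z) (far x) \<le> dist z x" for z
    using far_lipschitz[of x z] far_lipschitz[of z x] by (simp add: dist_real_def dist_norm norm_minus_commute)
  then show "\<exists>d>0. \<forall>z\<in>UNIV. dist z x < d \<longrightarrow> dist (far z) (far x) < e'"
    using \<open>0 < e'\<close> le_less_trans by blast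
qed

lemma far_less_iff: "far x < R \<longleftrightarrow> x \<in> \<Omega>"
  using far_attained[of x] far_upper[of _ x] by (auto simp: \<Omega>_iff intro: le_less_trans)

definition ball_barrier :: "'a \<Rightarrow> 'a \<Rightarrow> real" where
  "ball_barrier y x = (max 0 (R\<^sup>2 - (norm (x - y))\<^sup>2)) powr (2 * s - 1)"

text \<open>The pointwise minimum of \<open>ball_barrier y\<close> over \<open>y \<in> Y\<close>:
  the farthest centre gives the smallest value.\<close>

definition barrier :: "'a \<Rightarrow> real" where
  "barrier x = (max 0 (R\<^sup>2 - (far x)\<^sup>2)) powr (2 * s - 1)"

lemma barrier_le_ball_barrier: "y \<in> Y \<Longrightarrow> barrier x \<le> ball_barrier y x"
  unfolding barrier_def ball_barrier_def using s_gt far_upper[of y x]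
  by (intro powr_mono2 max.mono) (auto intro!: power_mono)

lemma barrier_attained: "\<exists>y\<in>Y. barrier x = ball_barrier y x"
  using far_attained[of x] by (auto simp: barrier_def ball_barrier_def)

lemma barrier_nonneg: "0 \<le> barrier x"
  by (simp add: barrier_def)

lemma barrier_bound: "barrier x \<le> (R\<^sup>2) powr (2 * s - 1)"
  unfolding barrier_def using s_gt by (intro powr_mono2) auto

lemma barrier_pos: "x \<in> \<Omega> \<Longrightarrow> 0 < barrier x"
  using far_nonneg[of x] by (auto simp: barrier_def max_def far_less_iff[symmetric] power_strict_mono not_le)

lemma barrier_zero: "x \<notin> \<Omega> \<Longrightarrow> barrier x = 0"
  using R_pos by (auto simp: barrier_def max_def far_less_iff[symmetric] not_less power_mono)

lemma continuous_on_barrier: "continuous_on UNIV barrier"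
  unfolding barrier_def[abs_def] using s_gt
  by (intro continuous_on_powr' continuous_intros continuous_on_far) auto

text \<open>\<open>R\<^sup>2 - (far y)\<^sup>2\<close> factors into \<open>R - far y\<close>, which
  is at most the distance to any exterior point since \<open>far\<close> is 1-Lipschitz, and
  \<open>R + far y\<close>, which is at most \<open>2 * R\<close>.\<close>

lemma barrier_boundary:
  assumes "x \<notin> \<Omega>"
  shows "barrier y \<le> (2 * R) powr (2 * s - 1) * norm (x - y) powr (2 * s - 1)"
proof (cases "y \<in> \<Omega>")
  case True
  have "R \<le> far x" "far y < R"
    using assms True by (auto simp: far_less_iff[symmetric])
  moreover have "far x \<le> norm (x - y) + far y"
    by (rule far_lipschitz)
  ultimately have "(R - far y) * (R + far y) \<le> norm (x - y) * (2 * R)"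
    using far_nonneg[of y] by (intro mult_mono) auto
  then have "max 0 (R\<^sup>2 - (far y)\<^sup>2) \<le> 2 * R * norm (x - y)"
    using R_pos by (simp add: power2_eq_square algebra_simps)
  then have "barrier y \<le> (2 * R * norm (x - y)) powr (2 * s - 1)"
    unfolding barrier_def using s_gt by (intro powr_mono2) auto
  then show ?thesis
    by (simp add: powr_mult)
qed (simp add: barrier_zero)

text \<open>In flat directions the tail beyond \<open>3 * sqrt A\<close> contributes
  \<open>- 3 powr (- (2 * s)) / s * A powr (s - 1)\<close>. As \<open>A \<le> R\<^sup>2\<close> and
  \<open>s - 1 < 0\<close>, replacing \<open>A\<close> by \<open>R\<^sup>2\<close> gives a constant
  valid at every point.\<close>

definition gain :: real where
  "gain = 3 powr (- (2 * s)) / s * (R\<^sup>2) powr (s - 1)"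

lemma gain_pos: "0 < gain"
  using R_pos s_gt by (simp add: gain_def)

text \<open>With \<open>A = R\<^sup>2 - \<bar>x - y\<bar>\<^sup>2\<close> and \<open>b = (x - y) \<bullet> \<xi>\<close> the second difference at \<open>x\<close> involves
  \<open>A \<plusminus> 2 b \<tau> - \<tau>\<^sup>2\<close>. For \<open>b\<^sup>2 \<le> A\<close> it is nonpositive by concavity and equals \<open>- 2 A\<^sup>2\<^sup>s\<^sup>-\<^sup>1\<close> for large
  \<open>\<tau>\<close>; for \<open>b\<^sup>2 > A\<close> dropping \<open>\<tau>\<^sup>2\<close> leaves the half-line profile.\<close>

lemma ball_barrier_majorant:
  assumes "norm (x - y) < R" "norm \<xi> = 1"
  obtains G c where "hl_integral G c" "c \<le> - gain" "\<And>t. 0 < t \<Longrightarrow> dq (ball_barrier y) x \<xi> t \<le> G t"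
proof -
  let ?a = "2 * s - 1"
  have a: "0 < ?a" "?a < 1"
    using s_gt s_lt by auto
  define A where "A = R\<^sup>2 - (norm (x - y))\<^sup>2"
  define b where "b = \<bar>(x - y) \<bullet> \<xi>\<bar>"
  have A: "0 < A" "A \<le> R\<^sup>2"
    using assms(1) by (auto simp: A_def intro!: power_strict_mono)
  have b: "0 \<le> b"
    by (simp add: b_def)
  have sq: "(norm (x + t *\<^sub>R \<xi> - y))\<^sup>2 = (norm (x - y))\<^sup>2 + 2 * ((x - y) \<bullet> \<xi>) * t + t\<^sup>2" for t
  proof -
    have "x + t *\<^sub>R \<xi> - y = (x - y) + t *\<^sub>R \<xi>"
      by simp
    moreover have "\<xi> \<bullet> \<xi> = 1"
      using assms(2) by (simp add: norm_eq_1)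
    ultimately show ?thesis
      by (simp only: power2_norm_eq_inner inner_add inner_scaleR_left inner_scaleR_right inner_commute[of \<xi> "x - y"])
        (simp add: power2_eq_square distrib_left mult.commute)
  qed
  have "second_diff (ball_barrier y) x (t *\<^sub>R \<xi>) =
      (max 0 (A - 2 * ((x - y) \<bullet> \<xi>) * t - t\<^sup>2)) powr ?a + (max 0 (A + 2 * ((x - y) \<bullet> \<xi>) * t - t\<^sup>2)) powr ?a - 2 * A powr ?a" for t :: real
  proof -
    have "R\<^sup>2 - (norm (x + t *\<^sub>R \<xi> - y))\<^sup>2 = A - 2 * ((x - y) \<bullet> \<xi>) * t - t\<^sup>2"
      "R\<^sup>2 - (norm (x - t *\<^sub>R \<xi> - y))\<^sup>2 = A + 2 * ((x - y) \<bullet> \<xi>) * t - t\<^sup>2"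
      using sq[of t] sq[of "- t"] by (simp_all add: A_def)
    moreover have "max 0 A = A"
      using A by simp
    ultimately show ?thesis
      by (simp only: second_diff_def ball_barrier_def A_def[symmetric])
  qed
  then have sd: "second_diff (ball_barrier y) x (t *\<^sub>R \<xi>) =
      (max 0 (A + 2 * b * t - t\<^sup>2)) powr ?a + (max 0 (A - 2 * b * t - t\<^sup>2)) powr ?a - 2 * A powr ?a" for t
    unfolding b_def by (cases "0 \<le> (x - y) \<bullet> \<xi>") simp_all
  have As: "(R\<^sup>2) powr (s - 1) \<le> A powr (s - 1)"
    using A s_lt by (intro powr_mono2') auto
  show ?thesis
  proof (cases "b\<^sup>2 \<le> A")
    case True
    \<comment> \<open>For \<open>b \<le> sqrt A\<close> and \<open>t > 3 * sqrt A\<close> one has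
      \<open>A + 2 * b * t - t\<^sup>2 \<le> A - sqrt A * t < 0\<close>, so both translates have
      left the ball.\<close>
    define r where "r = 3 * sqrt A"
    have r: "0 < r"
      using A by (simp add: r_def)
    have br: "b \<le> sqrt A"
      using True by (simp add: real_le_rsqrt)
    define G where "G t = - (2 * A powr ?a) * (indicator {r<..} t / t powr (1 + 2 * s))" for t :: real
    have G: "hl_integral G (- (2 * A powr ?a) * (r powr (- (2 * s)) / (2 * s)))"
      unfolding G_def by (intro hl_integral_cmult hl_integral_tail r)
    have "r powr (- (2 * s)) = 3 powr (- (2 * s)) * (sqrt A) powr (- (2 * s))"
      using A by (simp add: r_def powr_mult)
    also have "(sqrt A) powr (- (2 * s)) = A powr (- s)"
      using A by (simp add: powr_half_sqrt[symmetric] powr_powr)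
    finally have "- (2 * A powr ?a) * (r powr (- (2 * s)) / (2 * s)) = - (3 powr (- (2 * s)) / s * (A powr ?a * A powr (- s)))"
      by simp
    also have "A powr ?a * A powr (- s) = A powr (s - 1)"
      by (simp flip: powr_add)
    also have "- (3 powr (- (2 * s)) / s * A powr (s - 1)) \<le> - gain"
      unfolding gain_def using As s_gt by (simp add: mult_left_mono divide_right_mono)
    finally have c: "- (2 * A powr ?a) * (r powr (- (2 * s)) / (2 * s)) \<le> - gain" .
    have "dq (ball_barrier y) x \<xi> t \<le> G t" if t: "0 < t" for t
    proof -
      have bt: "2 * b * t \<le> 2 * sqrt A * t"
        using br t by (intro mult_right_mono) auto
      have "second_diff (ball_barrier y) x (t *\<^sub>R \<xi>) \<le> - (2 * A powr ?a) * indicator {r<..} t"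
      proof (cases "r < t")
        case True
        have "(3 * sqrt A) * t \<le> t * t"
          using True t by (intro mult_right_mono) (auto simp: r_def)
        moreover have "sqrt A * (3 * sqrt A) < sqrt A * t"
          using True A by (intro mult_strict_left_mono) (auto simp: r_def)
        moreover have "sqrt A * (3 * sqrt A) = 3 * A"
          using A by (simp add: mult.left_commute[of "sqrt A"])
        ultimately have "A + 2 * b * t - t\<^sup>2 \<le> 0"
          using bt A unfolding power2_eq_square by linarith
        moreover from this have "A - 2 * b * t - t\<^sup>2 \<le> 0"
          using b t mult_nonneg_nonneg[of b t] by linarith
        ultimately show ?thesis
          using True by (simp add: sd max_def)
      next
        case False
        \<comment> \<open>Truncation could spoil concavity when only the second argument is cut off;
          then the first is at most \<open>A + b\<^sup>2 \<le> 2 * A\<close>, which is where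
          flatness of the direction enters.\<close>
        have "(max 0 (A + 2 * b * t - t\<^sup>2)) powr ?a + (max 0 (A - 2 * b * t - t\<^sup>2)) powr ?a \<le> 2 * A powr ?a"
        proof (rule powr_sum_le[OF a])
          have "2 * b * t - t\<^sup>2 \<le> b\<^sup>2"
            using zero_le_power2[of "b - t"] by (simp add: power2_diff)
          then have p0: "A + 2 * b * t - t\<^sup>2 \<le> 2 * A"
            using \<open>b\<^sup>2 \<le> A\<close> by simp
          have p1: "0 \<le> 2 * b * t" and p2: "0 \<le> t\<^sup>2"
            using b t by auto
          show "max 0 (A + 2 * b * t - t\<^sup>2) + max 0 (A - 2 * b * t - t\<^sup>2) \<le> 2 * A"
            using p0 p1 p2 A(1) by linarith
        qed (use A in auto)
        then show ?thesis
          using False by (simp add: sd)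
      qed
      then have "dq (ball_barrier y) x \<xi> t \<le> (- (2 * A powr ?a) * indicator {r<..} t) / t powr (1 + 2 * s)"
        unfolding dq_def by (rule divide_right_mono) simp
      then show ?thesis
        by (simp add: G_def)
    qed
    then show ?thesis
      by (rule that[OF G c])
  next
    case False
    then have b: "0 < b"
      using b A by (cases "b = 0") auto
    \<comment> \<open>The half-line value for slope \<open>2 * b\<close>. From
      \<open>b\<^sup>2 > A\<close> and \<open>2 powr (2 * s) \<ge> 2\<close> its modulus is at least
      \<open>A powr (s - 1) / s\<close>.\<close>
    have "- ((2 * b) powr (2 * s) / (2 * s * A)) \<le> - gain"
    proof -
      have "A powr s \<le> (b\<^sup>2) powr s"
        using False A s_gt by (intro powr_mono2) auto
      also have "(b\<^sup>2) powr s = b powr (2 * s)"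
        using b by (simp add: powr_powr flip: powr_numeral)
      finally have "2 * A powr s \<le> 2 powr (2 * s) * b powr (2 * s)"
        using s_gt powr_mono[of 1 "2 * s" 2] by (intro mult_mono) auto
      then have "2 * A powr s / (2 * s * A) \<le> (2 * b) powr (2 * s) / (2 * s * A)"
        using A s_gt b by (intro divide_right_mono) (auto simp: powr_mult)
      also have "2 * A powr s / (2 * s * A) = A powr (s - 1) / s"
        using A by (simp add: powr_diff)
      finally have 1: "A powr (s - 1) / s \<le> (2 * b) powr (2 * s) / (2 * s * A)" .
      have "3 powr (- (2 * s)) \<le> (1::real)"
        using s_gt powr_mono[of "- (2 * s)" 0 3] by simp
      then have "3 powr (- (2 * s)) / s * (R\<^sup>2) powr (s - 1) \<le> 1 / s * A powr (s - 1)"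
        using As s_gt by (intro mult_mono divide_right_mono) auto
      then show ?thesis
        using 1 by (simp add: gain_def)
    qed
    moreover have "dq (ball_barrier y) x \<xi> t \<le>
      ((A + 2 * b * t) powr ?a + (max 0 (A - 2 * b * t)) powr ?a - 2 * A powr ?a) / t powr (1 + 2 * s)" if "0 < t" for t
    proof -
      have "(max 0 (A + 2 * b * t - t\<^sup>2)) powr ?a \<le> (A + 2 * b * t) powr ?a"
        using a A b that by (intro powr_mono2 max.boundedI) auto
      moreover have "(max 0 (A - 2 * b * t - t\<^sup>2)) powr ?a \<le> (max 0 (A - 2 * b * t)) powr ?a"
        using a by (intro powr_mono2 max.mono) auto
      ultimately show ?thesis
        unfolding dq_def sd by (intro divide_right_mono) auto
    qed
    ultimately show ?thesis
      using that hl_integral_half_line[of A "2 * b"] A(1) b by (simp add: mult.assoc)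
  qed
qed

end

context frac_order
begin

section \<open>Positivity, truncation by the barrier and Hoelder bounds\<close>

lemma super_at_zero: "super_at (\<lambda>_. 0) x 0"
proof -
  have "hl_integral (\<lambda>t. 0) 0"
    by (simp add: hl_integral_def has_bochner_integral_zero)
  then show ?thesis
    by (auto simp: super_at_def dq_def[abs_def] second_diff_def)
qed

lemma hl_integral_nonneg:
  assumes "hl_integral f j" "\<And>t. 0 < t \<Longrightarrow> 0 \<le> f t"
  shows "0 \<le> j"
proof (rule hl_integral_mono)
  show "hl_integral (\<lambda>t. 0) 0"
    by (simp add: hl_integral_def has_bochner_integral_zero)
qed (use assms in auto)

text \<open>At an interior zero the constant 0 touches from below and all second differences are
  nonnegative, so no directional integral can be as low as \<open>- f\<close>.\<close>

lemma supersol_pos: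
  fixes u :: "'a::euclidean_space \<Rightarrow> real"
  assumes "supersol \<Omega> l f u" "0 < f" "x \<in> \<Omega>"
  shows "0 < u x"
proof (rule ccontr)
  assume "\<not> ?thesis"
  then have ux: "u x = 0"
    using assms(1) by (auto simp: supersol_def intro: antisym)
  have nonneg: "0 \<le> u z" for z
    using assms(1) by (auto simp: supersol_def)
  have "touch_below 0 u x"
    unfolding touch_below_def using nonneg ux by (intro exI[of _ 0]) simp
  moreover obtain \<xi> :: 'a where "norm \<xi> = 1"
    using vector_choose_size zero_le_one by blast
  moreover have "super_at u x (- (l * u x + f))"
    using assms by (simp add: supersol_def)
  ultimately obtain j where "j \<le> - (l * u x + f)" "hl_integral (dq u x \<xi>) j"
    unfolding super_at_def by blast
  moreover from this(2) have "0 \<le> j"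
    by (rule hl_integral_nonneg) (use nonneg ux in \<open>simp add: dq_def second_diff_def\<close>)
  ultimately show False
    using ux assms(2) by simp
qed

end

context ball_hull
begin

text \<open>Within this distance of \<open>x\<close> the truncation at 0 is inactive, so the concave
  tangent bound applies. A paraboloid above the barrier is what allows the barrier to be subtracted
  from a function touched from below.\<close>

lemma ball_barrier_touch:
  assumes "norm (x - y) < R"
  obtains k where "\<And>z. norm (z - x) < R - norm (x - y) \<Longrightarrow>
    ball_barrier y z \<le> ball_barrier y x - k * (2 * ((x - y) \<bullet> (z - x)) + (norm (z - x))\<^sup>2)"
proof -
  define A where "A = R\<^sup>2 - (norm (x - y))\<^sup>2"
  have A: "0 < A"
    using assms by (auto simp: A_def intro!: power_strict_mono)
  have "ball_barrier y z \<le> ball_barrier y x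
      - ((2 * s - 1) * A powr (2 * s - 1 - 1)) * (2 * ((x - y) \<bullet> (z - x)) + (norm (z - x))\<^sup>2)"
    if z: "norm (z - x) < R - norm (x - y)" for z
  proof -
    have "norm (z - y) \<le> norm (z - x) + norm (x - y)"
      using norm_triangle_ineq[of "z - x" "x - y"] by simp
    then have "norm (z - y) \<le> R"
      using z by simp
    then have q: "0 \<le> R\<^sup>2 - (norm (z - y))\<^sup>2"
      by (simp add: power_mono)
    have "(norm (z - y))\<^sup>2 = (norm (x - y))\<^sup>2 + 2 * ((x - y) \<bullet> (z - x)) + (norm (z - x))\<^sup>2"
      unfolding power2_norm_eq_inner by (simp add: algebra_simps inner_commute)
    moreover define B where "B = 2 * ((x - y) \<bullet> (z - x)) + (norm (z - x))\<^sup>2"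
    ultimately have "R\<^sup>2 - (norm (z - y))\<^sup>2 = A - B"
      by (simp add: A_def)
    then have "ball_barrier y z = (A - B) powr (2 * s - 1)" "0 \<le> A - B"
      using q by (simp_all add: ball_barrier_def)
    moreover have "ball_barrier y x = A powr (2 * s - 1)"
      using A by (simp add: ball_barrier_def A_def[symmetric])
    ultimately show ?thesis
      using powr_le_tangent[of "2 * s - 1" "A - B" A] A s_gt s_lt unfolding B_def[symmetric] by simp
  qed
  then show ?thesis
    by (rule that)
qed

text \<open>Near \<open>x\<close> the barrier is replaced by the ball barrier of a farthest centre,
  which lies above it and agrees at \<open>x\<close>. Subtracting the upper paraboloid of the latter
  turns a contact for \<open>g\<close> into one for \<open>h\<close>; then the bounds add up in each
  direction.\<close>

lemma super_at_add_barrier: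
  assumes x: "x \<in> \<Omega>" and k: "0 \<le> k" and h: "super_at h x c" "\<And>z. \<bar>h z\<bar> \<le> M'"
    and g: "g \<in> borel_measurable borel" "\<And>z. \<bar>g z\<bar> \<le> M"
    and le: "\<And>z. g z \<le> h z + k * barrier z" and eq: "g x = h x + k * barrier x"
  shows "super_at g x (c - k * gain)"
  unfolding super_at_def
proof (intro allI impI)
  fix K and \<xi> :: 'a assume K: "touch_below K g x" and \<xi>: "norm \<xi> = 1"
  obtain y where y: "y \<in> Y" "barrier x = ball_barrier y x"
    using barrier_attained by blast
  have r: "norm (x - y) < R"
    using x y \<Omega>_iff by blast
  have le': "g z \<le> h z + k * ball_barrier y z" for z
    using le[of z] mult_left_mono[OF barrier_le_ball_barrier[OF y(1), of z] k] by linarith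
  obtain \<kappa> where \<kappa>: "\<And>z. norm (z - x) < R - norm (x - y) \<Longrightarrow>
    ball_barrier y z \<le> ball_barrier y x - \<kappa> * (2 * ((x - y) \<bullet> (z - x)) + (norm (z - x))\<^sup>2)"
    using ball_barrier_touch[OF r] by blast
  obtain p where p: "\<And>z. g x + p \<bullet> (z - x) - K * (norm (z - x))\<^sup>2 \<le> g z"
    using K by (auto simp: touch_below_def)
  have h_low: "h x + (p + (2 * k * \<kappa>) *\<^sub>R (x - y)) \<bullet> (z - x) - (K - k * \<kappa>) * (norm (z - x))\<^sup>2 \<le> h z"
    if "norm (z - x) < R - norm (x - y)" for z
  proof -
    have "k * ball_barrier y z \<le> k * (ball_barrier y x - \<kappa> * (2 * ((x - y) \<bullet> (z - x)) + (norm (z - x))\<^sup>2))"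
      using \<kappa>[OF that] k by (rule mult_left_mono)
    moreover have "k * (ball_barrier y x - \<kappa> * (2 * ((x - y) \<bullet> (z - x)) + (norm (z - x))\<^sup>2))
      = k * ball_barrier y x - (2 * k * \<kappa>) * ((x - y) \<bullet> (z - x)) - k * \<kappa> * (norm (z - x))\<^sup>2"
      by (simp add: right_diff_distrib distrib_left)
    moreover have "(p + (2 * k * \<kappa>) *\<^sub>R (x - y)) \<bullet> (z - x) = p \<bullet> (z - x) + (2 * k * \<kappa>) * ((x - y) \<bullet> (z - x))"
      by (simp add: inner_add_left)
    moreover have "(K - k * \<kappa>) * (norm (z - x))\<^sup>2 = K * (norm (z - x))\<^sup>2 - k * \<kappa> * (norm (z - x))\<^sup>2"
      by (simp add: left_diff_distrib)
    moreover have "g x = h x + k * ball_barrier y x"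
      using eq y(2) by simp
    ultimately show ?thesis
      using p[of z] le'[of z] by linarith
  qed
  have "0 < R - norm (x - y)"
    using r by simp
  then obtain K' where "touch_below K' h x"
    using touch_below_local[OF h(2) _ h_low] by blast
  then obtain j where j: "j \<le> c" "hl_integral (dq h x \<xi>) j"
    using h(1) \<xi> by (auto simp: super_at_def)
  obtain G c' where G: "hl_integral G c'" "c' \<le> - gain" "\<And>t. 0 < t \<Longrightarrow> dq (ball_barrier y) x \<xi> t \<le> G t"
    using ball_barrier_majorant[OF r \<xi>] by blast
  have "hl_integral (\<lambda>t. dq h x \<xi> t + k * G t) (j + k * c')"
    by (intro hl_integral_add hl_integral_cmult j G)
  moreover have "dq g x \<xi> t \<le> dq h x \<xi> t + k * G t" if "0 < t" for t
  proof -
    have "second_diff g x (t *\<^sub>R \<xi>) \<le> second_diff h x (t *\<^sub>R \<xi>) + k * second_diff (ball_barrier y) x (t *\<^sub>R \<xi>)"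
      using le'[of "x + t *\<^sub>R \<xi>"] le'[of "x - t *\<^sub>R \<xi>"] eq y(2) by (simp add: second_diff_def algebra_simps)
    then have "dq g x \<xi> t \<le> (second_diff h x (t *\<^sub>R \<xi>) + k * second_diff (ball_barrier y) x (t *\<^sub>R \<xi>)) / t powr (1 + 2 * s)"
      unfolding dq_def by (rule divide_right_mono) simp
    also have "\<dots> = dq h x \<xi> t + k * dq (ball_barrier y) x \<xi> t"
      by (simp add: dq_def add_divide_distrib)
    also have "\<dots> \<le> dq h x \<xi> t + k * G t"
      using G(3)[OF that] k by (intro add_left_mono mult_left_mono)
    finally show ?thesis .
  qed
  ultimately obtain j' where j': "hl_integral (dq g x \<xi>) j'" "j' \<le> j + k * c'"
    by (rule hl_integral_dq_le[OF g K \<xi>])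
  have "k * c' \<le> - (k * gain)"
    using mult_left_mono[OF G(2) k] by simp
  then show "\<exists>j\<le>c - k * gain. hl_integral (dq g x \<xi>) j"
    using j' j(1) by (intro exI[of _ j']) linarith
qed

lemma barrier_measurable [measurable]: "barrier \<in> borel_measurable borel"
  by (intro borel_measurable_continuous_onI continuous_on_barrier)

text \<open>Where the barrier is active, \<open>k * gain\<close> exceeds anything the equation can
  demand at heights up to \<open>M\<close>; elsewhere \<open>u\<close> was only lowered at other
  points. An upper bound \<open>M\<close> thus becomes boundary decay.\<close>

lemma supersol_min_barrier:
  assumes u: "supersol \<Omega> l f u" and "0 \<le> l" "\<And>x. u x \<le> M" "l * M + f \<le> k * gain" "0 < k"
  shows "supersol \<Omega> l f (\<lambda>x. min (u x) (k * barrier x))"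
proof -
  let ?g = "\<lambda>x. min (u x) (k * barrier x)"
  obtain M' where M': "\<And>x. \<bar>u x\<bar> \<le> M'"
    using supersol_bound[OF u] by blast
  have nonneg: "0 \<le> u x" for x
    using u by (auto simp: supersol_def)
  have bd: "\<bar>?g x\<bar> \<le> M'" for x
    using M'[of x] nonneg[of x] barrier_nonneg[of x] assms(5) by auto
  have [measurable]: "u \<in> borel_measurable borel"
    using u by (auto simp: supersol_def)
  have meas: "?g \<in> borel_measurable borel"
    by measurable
  have "super_at ?g x (- (l * ?g x + f))" if x: "x \<in> \<Omega>" for x
  proof (cases "u x \<le> k * barrier x")
    case True
    have "super_at ?g x (- (l * u x + f))"
      by (rule super_at_mono[of u]) (use u x True meas bd in \<open>auto simp: supersol_def\<close>)
    then show ?thesis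
      using True by (simp add: min_def)
  next
    case False
    have "super_at ?g x (0 - k * gain)"
      by (rule super_at_add_barrier[OF x _ super_at_zero[of x], where M'=0]) (use False meas bd assms(5) in \<open>auto\<close>)
    moreover have "l * ?g x \<le> l * M"
      using assms(2) assms(3)[of x] by (intro mult_left_mono) auto
    ultimately show ?thesis
      using assms(4) by (elim super_at_weaken) linarith
  qed
  moreover have "lsc_on UNIV (\<lambda>x. k * barrier x)"
    by (intro lsc_on_UNIV_continuous continuous_intros continuous_on_barrier)
  then have "lsc_on UNIV ?g"
    using u by (intro lsc_on_UNIV_min) (auto simp: supersol_def)
  moreover have "bounded (range ?g)"
    using bd by (auto simp: bounded_iff)
  ultimately show ?thesis
    using u meas nonneg barrier_nonneg assms(5) unfolding supersol_def
    by (auto simp: barrier_zero)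
qed

text \<open>The boundary decay of \<open>barrier\<close> makes the cone of this slope admissible in
  the comparison for every vertex in \<Omega>; at vertices outside, \<open>u\<close> vanishes and
  nonnegativity suffices.\<close>

lemma supersol_holder:
  assumes u: "supersol \<Omega> l f u" and strict: "\<And>x. x \<in> \<Omega> \<Longrightarrow> 0 < l * u x + f"
    and k: "0 \<le> k" "\<And>x. u x \<le> k * barrier x"
  shows "\<bar>u x - u y\<bar> \<le> k * (2 * R) powr (2 * s - 1) * norm (x - y) powr (2 * s - 1)"
proof -
  let ?L = "k * (2 * R) powr (2 * s - 1)"
  have "u y - ?L * norm (x - y) powr (2 * s - 1) \<le> u x" for x y
  proof (cases "y \<in> \<Omega>")
    case True
    show ?thesis
    proof (rule cone_comparison[OF u bounded_\<Omega> True _ _ strict])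
      show "u y \<le> ?L * norm (x - y) powr (2 * s - 1)" if "x \<notin> \<Omega>" for x
        using k(2)[of y] mult_left_mono[OF barrier_boundary[OF that, of y] k(1)] by (simp add: mult.assoc)
    qed (use k R_pos in auto)
  next
    case False
    then have "u y = 0" "0 \<le> u x"
      using u by (auto simp: supersol_def)
    moreover have "0 \<le> ?L * norm (x - y) powr (2 * s - 1)"
      using k(1) by simp
    ultimately show ?thesis
      by linarith
  qed
  from this[of x y] this[of y x] show ?thesis
    by (simp add: norm_minus_commute abs_le_iff)
qed

end

section \<open>Perron's method\<close>

context ball_hull
begin

lemma supersol_limit:
  fixes U :: "nat \<Rightarrow> 'a \<Rightarrow> real"
  assumes U: "\<And>n. supersol \<Omega> (l n) (f n) (U n)" and cont: "\<And>n. continuous_on UNIV (U n)"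
    and M: "\<And>n x. U n x \<le> M" and lim: "uniform_limit UNIV U u sequentially"
    and "l \<longlonglongrightarrow> l'" "f \<longlonglongrightarrow> f'"
  shows "supersol \<Omega> l' f' u"
proof -
  have nonneg: "0 \<le> U n x" for n x
    using U by (auto simp: supersol_def)
  have M': "\<bar>U n x\<bar> \<le> M" for n x
    using M[of n x] nonneg[of n x] by simp
  have pt: "(\<lambda>n. U n x) \<longlonglongrightarrow> u x" for x
    by (rule tendsto_uniform_limitI[OF lim]) simp
  have contu: "continuous_on UNIV u"
    by (rule uniform_limit_theorem[OF _ lim]) (use cont in auto)
  have "super_at u x (- (l' * u x + f'))" if "x \<in> \<Omega>" for x
    by (rule super_at_limit[OF cont M' lim open_\<Omega> that _ assms(5,6)]) (use U in \<open>simp add: supersol_def\<close>)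
  moreover have "0 \<le> u x" for x
    by (rule LIMSEQ_le_const[OF pt]) (use nonneg in auto)
  moreover have "u x = 0" if "x \<notin> \<Omega>" for x
  proof -
    have "(\<lambda>n. U n x) = (\<lambda>n. 0)"
      using U that by (auto simp: supersol_def)
    then show ?thesis
      using pt[of x] LIMSEQ_unique tendsto_const by metis
  qed
  moreover have "bounded (range u)"
    unfolding bounded_iff using uniform_limit_bound[OF lim M'] by auto
  ultimately show ?thesis
    using contu by (simp add: supersol_def borel_measurable_continuous_onI lsc_on_UNIV_continuous)
qed

text \<open>Perron's method from above: the infimum of all supersolutions that lie below a fixed multiple of the
  barrier is attained pointwise, by compactness. If the subsolution inequality failed at \<open>x\<close>, then
  lowering the infimum near \<open>x\<close> to the touching paraboloid minus \<open>1/n\<close> would give smaller supersolutions.\<close>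

lemma perron_minimal:
  assumes v0: "supersol \<Omega> l 1 v0" and l: "0 \<le> l" and M: "0 < M" "\<And>x. v0 x \<le> M"
  defines "k \<equiv> (l * M + 1) / gain"
  defines "S \<equiv> {v. supersol \<Omega> l 1 v \<and> (\<forall>x. v x \<le> M) \<and> (\<forall>x. v x \<le> k * barrier x)}"
  obtains u where "u \<in> S" "\<And>v x. v \<in> S \<Longrightarrow> u x \<le> v x"
    "\<And>x y. \<bar>u x - u y\<bar> \<le> k * (2 * R) powr (2 * s - 1) * norm (x - y) powr (2 * s - 1)"
proof -
  let ?L = "k * (2 * R) powr (2 * s - 1)"
  have k: "0 < k"
    unfolding k_def using l M(1) gain_pos by (intro divide_pos_pos add_nonneg_pos) auto
  have kgain: "l * M + 1 \<le> k * gain"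
    using gain_pos by (simp add: k_def)
  have S: "supersol \<Omega> l 1 v" "v x \<le> M" "v x \<le> k * barrier x" "0 \<le> v x" if "v \<in> S" for v x
    using that by (auto simp: S_def supersol_def)
  have holder: "\<bar>v x - v y\<bar> \<le> ?L * norm (x - y) powr (2 * s - 1)" if "v \<in> S" for v x y
  proof (rule supersol_holder[OF S(1)[OF that]])
    show "0 < l * v x + 1" for x
      using l S(4)[OF that] by (intro add_nonneg_pos mult_nonneg_nonneg) auto
  qed (use k S(3)[OF that] in auto)
  have "supersol \<Omega> l 1 (\<lambda>x. min (v0 x) (k * barrier x))"
    using supersol_min_barrier[OF v0 l M(2) kgain k] .
  \<comment> \<open>Truncating \<open>v0\<close> provides a member of \<open>S\<close>;
    \<open>k\<close> is the smallest factor for which truncation at height \<open>M\<close> is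
    allowed.\<close>
  then have ne: "S \<noteq> {}"
    using M(2) by (auto simp: S_def min_le_iff_disj intro!: exI[of _ "\<lambda>x. min (v0 x) (k * barrier x)"])
  define u where "u x = (INF v\<in>S. v x)" for x
  have bdd: "bdd_below ((\<lambda>v. v x) ` S)" for x
    using S(4) by (intro bdd_belowI[of _ 0]) auto
  have le: "u x \<le> v x" if "v \<in> S" for v x
    unfolding u_def using bdd that by (rule cINF_lower)
  have uholder: "\<bar>u x - u y\<bar> \<le> ?L * norm (x - y) powr (2 * s - 1)" for x y
  proof -
    have "u x - ?L * norm (x - y) powr (2 * s - 1) \<le> u y" for x y
      unfolding u_def[of y] using ne
    proof (rule cINF_greatest)
      fix v assume "v \<in> S"
      then show "u x - ?L * norm (x - y) powr (2 * s - 1) \<le> v y"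
        using le[of v x] holder[of v x y] by linarith
    qed
    from this[of x y] this[of y x] show ?thesis
      by (simp add: norm_minus_commute abs_le_iff)
  qed
  have attained: "\<exists>v\<in>S. v x = u x" for x
  proof -
    have "\<exists>v\<in>S. v x < u x + 1 / real (Suc n)" for n
      using cINF_less_iff[OF ne bdd, of x "u x + 1 / real (Suc n)"] by (simp add: u_def)
    then obtain V where V: "\<And>n. V n \<in> S" "\<And>n. V n x < u x + 1 / real (Suc n)"
      by metis
    obtain r w where r: "strict_mono (r :: nat \<Rightarrow> nat)" and w: "uniform_limit UNIV (\<lambda>n. V (r n)) w sequentially"
    proof (rule holder_compactness[of V ?L M \<Omega>])
      show "\<bar>V n x\<bar> \<le> M" for n x
        using S(2,4)[OF V(1)[of n], of x] by simp
      show "V n x = 0" if "x \<notin> \<Omega>" for n x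
        using S(1)[OF V(1)[of n]] that by (simp add: supersol_def)
    qed (use holder[OF V(1)] bounded_\<Omega> in auto)
    have pt: "(\<lambda>n. V (r n) y) \<longlonglongrightarrow> w y" for y
      by (rule tendsto_uniform_limitI[OF w]) simp
    have "supersol \<Omega> l 1 w"
    proof (rule supersol_limit[OF _ _ _ w])
      show "continuous_on UNIV (V (r n))" for n
        by (rule holder_imp_continuous[OF holder[OF V(1)]])
    qed (use S(1,2)[OF V(1)] in \<open>auto\<close>)
    moreover have "w y \<le> M" "w y \<le> k * barrier y" for y
      by (rule LIMSEQ_le_const2[OF pt], use S(2,3)[OF V(1)] in auto)+
    ultimately have "w \<in> S"
      by (simp add: S_def)
    moreover have "w x \<le> u x"
    proof (rule LIMSEQ_le[OF pt])
      have "(\<lambda>n. u x + 1 / real (Suc n)) \<longlonglongrightarrow> u x + 0"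
        by (intro tendsto_intros LIMSEQ_Suc[OF lim_1_over_n])
      from LIMSEQ_subseq_LIMSEQ[OF this r] show "(\<lambda>n. u x + 1 / real (Suc (r n))) \<longlonglongrightarrow> u x"
        by (simp add: o_def)
      show "\<exists>N. \<forall>n\<ge>N. V (r n) x \<le> u x + 1 / real (Suc (r n))"
        using V(2) by (auto intro: less_imp_le)
    qed
    ultimately show ?thesis
      using le[of w x] by (intro bexI[of _ w]) auto
  qed
  have cont: "continuous_on UNIV u"
    by (rule holder_imp_continuous[OF uholder])
  have u0: "0 \<le> u x" "u x \<le> M" "u x \<le> k * barrier x" for x
    using attained[of x] S by (metis, metis, metis)
  have bd: "\<bar>u x\<bar> \<le> M" for x
    using u0[of x] by simp
  \<comment> \<open>A member of \<open>S\<close> attaining the infimum at \<open>x\<close> lies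
    above it and agrees there, so its inequality is inherited.\<close>
  have "super_at u x (- (l * u x + 1))" if x: "x \<in> \<Omega>" for x
  proof -
    obtain v where v: "v \<in> S" "v x = u x"
      using attained by blast
    have "super_at v x (- (l * u x + 1))"
      using S(1)[OF v(1)] x v(2) by (auto simp: supersol_def)
    then show ?thesis
      by (rule super_at_mono[OF _ le[OF v(1)]]) (use v(2) cont bd in \<open>auto intro: borel_measurable_continuous_onI\<close>)
  qed
  moreover have "u x = 0" if "x \<notin> \<Omega>" for x
    using u0(1)[of x] u0(3)[of x] barrier_zero[OF that] by simp
  moreover have "bounded (range u)"
    unfolding bounded_iff using bd by auto
  ultimately have "supersol \<Omega> l 1 u"
    using cont u0 by (simp add: supersol_def borel_measurable_continuous_onI lsc_on_UNIV_continuous)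
  then have "u \<in> S"
    using u0 by (simp add: S_def)
  then show ?thesis
    using that le uholder by blast
qed

text \<open>By minimality \<open>W n\<close> violates the supersolution inequality at a point near
  \<open>x\<close>, on its paraboloid part. There paraboloids touch it from both sides, so the
  offending directional integral exists and is large; a limit of these directions serves at
  \<open>x\<close>.\<close>

lemma minimal_imp_sub_at:
  assumes u: "supersol \<Omega> l 1 u" and cont: "continuous_on UNIV u" and x: "x \<in> \<Omega>"
    and minimal: "\<And>v. supersol \<Omega> l 1 v \<Longrightarrow> (\<And>z. v z \<le> u z) \<Longrightarrow> u x \<le> v x"
  shows "sub_at u x (- (l * u x + 1))"
  unfolding sub_at_def
proof (intro allI impI)
  fix K assume "touch_below K (\<lambda>z. - u z) x"
  then obtain p where p: "\<And>z. - u x + p \<bullet> (z - x) - K * (norm (z - x))\<^sup>2 \<le> - u z"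
    by (auto simp: touch_below_def)
  \<comment> \<open>The extra 1 in \<open>K + 1\<close> separates \<open>P\<close> from
    \<open>u\<close> by \<open>(norm (z - x))\<^sup>2\<close>, so \<open>P - e n\<close> drops below
    \<open>u\<close> only within distance \<open>sqrt (e n)\<close> of \<open>x\<close>.\<close>
  define P where "P z = u x - p \<bullet> (z - x) + (K + 1) * (norm (z - x))\<^sup>2" for z
  have P: "u z + (norm (z - x))\<^sup>2 \<le> P z" for z
    using p[of z] by (simp add: P_def algebra_simps)
  define e where "e n = 1 / real (Suc n)" for n
  have e: "0 < e n" for n
    by (simp add: e_def)
  have e0: "e \<longlonglongrightarrow> 0"
    unfolding e_def by (rule LIMSEQ_Suc[OF lim_1_over_n])
  define W where "W n z = min (u z) (P z - e n)" for n z
  have W_le: "W n z \<le> u z" for n z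
    by (simp add: W_def)
  have W_ge: "u z - e n \<le> W n z" for n z
    using P[of z] e[of n] zero_le_power2[of "norm (z - x)"] unfolding W_def by linarith
  have W_less: "(norm (z - x))\<^sup>2 < e n" "W n z = P z - e n" if "W n z < u z" for n z
    using that P[of z] unfolding W_def by linarith+
  have contP: "continuous_on UNIV P"
    unfolding P_def by (intro continuous_intros)
  have contW: "continuous_on UNIV (W n)" for n
    unfolding W_def by (intro continuous_intros cont contP)
  have nonneg: "0 \<le> u z" and zero: "z \<notin> \<Omega> \<Longrightarrow> u z = 0" for z
    using u by (auto simp: supersol_def)
  have ux: "0 < u x"
    by (rule supersol_pos[OF u _ x]) simp
  obtain r where r: "0 < r" "ball x r \<subseteq> \<Omega>"
    using open_\<Omega> x open_contains_ball by blast
  obtain r' where r': "0 < r'" "\<And>z. dist z x < r' \<Longrightarrow> dist (u z) (u x) < u x / 2"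
    using cont[unfolded continuous_on_iff, rule_format, of x "u x / 2"] ux by auto
  have "\<forall>\<^sub>F n in sequentially. e n < min (u x / 2) ((min r r')\<^sup>2)"
    by (rule order_tendstoD(2)[OF e0]) (use ux r(1) r'(1) in \<open>simp add: min_def\<close>)
  then obtain N where "\<forall>n\<ge>N. e n < min (u x / 2) ((min r r')\<^sup>2)"
    unfolding eventually_sequentially by blast
  then have N: "e n < u x / 2 \<and> e n < (min r r')\<^sup>2" if "n \<ge> N" for n
    using that by (simp only: min_less_iff_conj)
  \<comment> \<open>The two smallness conditions on \<open>e n\<close> keep the modification inside
    \<Omega>, preserving the zero exterior values, and where \<open>u\<close> exceeds
    \<open>u x / 2\<close>, preserving positivity.\<close>
  have near: "z \<in> \<Omega>" "0 < W n z" if "n \<ge> N" "W n z < u z" for n z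
  proof -
    have "(norm (z - x))\<^sup>2 < (min r r')\<^sup>2"
      using W_less(1)[OF that(2)] N[OF that(1)] by linarith
    then have d: "norm (z - x) < min r r'"
      by (rule power_less_imp_less_base) (use r(1) r'(1) in simp)
    then show "z \<in> \<Omega>"
      using r(2) by (auto simp: dist_norm norm_minus_commute)
    have "u x / 2 < u z"
      using r'(2)[of z] d unfolding dist_norm real_norm_def by linarith
    then show "0 < W n z"
      using W_ge[of z n] N[OF that(1)] by linarith
  qed
  obtain M where M: "0 < M" "\<And>z. u z \<le> M"
    using supersol_bound[OF u] by metis
  have W0: "0 \<le> W n z" and Wz: "z \<notin> \<Omega> \<Longrightarrow> W n z = 0" if "n \<ge> N" for n z
    using near[OF that, of z] W_le[of n z] nonneg[of z] zero[of z] by (cases "W n z < u z"; force)+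
  have WM: "\<bar>W n z\<bar> \<le> M" if "n \<ge> N" for n z
    using W0[OF that, of z] W_le[of n z] M(2)[of z] by simp
  have Wmeas: "W n \<in> borel_measurable borel" for n
    by (intro borel_measurable_continuous_onI contW)
  have "\<exists>z \<xi> j. (norm (z - x))\<^sup>2 < e n \<and> touch_below (K + 1) (\<lambda>y. - W n y) z \<and> norm \<xi> = 1 \<and>
      - (l * W n z + 1) \<le> j \<and> hl_integral (dq (W n) z \<xi>) j" if n: "n \<ge> N" for n
  proof -
    have "W n x < u x"
      using e[of n] by (simp add: W_def P_def)
    then have "\<not> supersol \<Omega> l 1 (W n)"
      using minimal[of "W n"] W_le by force
    moreover have "bounded (range (W n))"
      unfolding bounded_iff using WM[OF n] by auto
    ultimately obtain z where z: "z \<in> \<Omega>" "\<not> super_at (W n) z (- (l * W n z + 1))"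
      using Wmeas W0[OF n] Wz[OF n] contW by (auto simp: supersol_def lsc_on_UNIV_continuous)
    \<comment> \<open>Where \<open>W n\<close> agrees with \<open>u\<close> it inherits the
      inequality of \<open>u\<close>, so the violation lies on the lowered part.\<close>
    have "W n z < u z"
    proof (rule ccontr)
      assume "\<not> ?thesis"
      then have eq: "W n z = u z"
        using W_le[of n z] by simp
      have "super_at (W n) z (- (l * u z + 1))"
        by (rule super_at_mono[of u, OF _ W_le eq Wmeas WM[OF n]]) (use u z(1) in \<open>simp add: supersol_def\<close>)
      then show False
        using z(2) eq by simp
    qed
    note less = W_less[OF this]
    have touch: "touch_below (K + 1) (\<lambda>y. - W n y) z"
      unfolding touch_below_def
    proof (intro exI allI)
      fix y
      have "(norm (y - x))\<^sup>2 = (norm (y - z))\<^sup>2 + 2 * ((z - x) \<bullet> (y - z)) + (norm (z - x))\<^sup>2"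
        unfolding power2_norm_eq_inner by (simp add: algebra_simps inner_commute)
      then have "(K + 1) * (norm (y - x))\<^sup>2 = (K + 1) * (norm (y - z))\<^sup>2
          + (K + 1) * (2 * ((z - x) \<bullet> (y - z))) + (K + 1) * (norm (z - x))\<^sup>2"
        by (simp only: distrib_left)
      moreover have "p \<bullet> (y - x) = p \<bullet> (y - z) + p \<bullet> (z - x)"
        by (simp add: inner_diff_right)
      moreover have "(p - (2 * (K + 1)) *\<^sub>R (z - x)) \<bullet> (y - z) = p \<bullet> (y - z) - (K + 1) * (2 * ((z - x) \<bullet> (y - z)))"
        by (simp only: inner_diff_left[of p] inner_scaleR_left mult_ac)
      moreover have "W n y \<le> P y - e n"
        by (simp add: W_def)
      ultimately show "- W n z + (p - (2 * (K + 1)) *\<^sub>R (z - x)) \<bullet> (y - z) - (K + 1) * (norm (y - z))\<^sup>2 \<le> - W n y"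
        using less(2) unfolding P_def by linarith
    qed
    obtain K' \<xi> where K': "touch_below K' (W n) z" and \<xi>: "norm \<xi> = 1"
      and no: "\<And>j. hl_integral (dq (W n) z \<xi>) j \<Longrightarrow> \<not> j \<le> - (l * W n z + 1)"
      using z(2) unfolding super_at_def by blast
    define B where "B t = min (2 * \<bar>K + 1\<bar> * t\<^sup>2) (4 * M) / t powr (1 + 2 * s)" for t
    obtain b where b: "hl_integral B b"
      unfolding B_def using hl_integral_min_kernel[of "2 * \<bar>K + 1\<bar>" "4 * M"] M(1) by auto
    \<comment> \<open>Failure of \<open>super_at\<close> could also mean that an integral does not
      exist. The paraboloid from above excludes this by an integrable majorant, so the integral
      exists and exceeds the bound.\<close>
    have "dq (W n) z \<xi> t \<le> B t" for t
      using dq_lower[OF touch _ \<xi>, of M t] WM[OF n] by (simp add: dq_uminus B_def)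
    then obtain j where "hl_integral (dq (W n) z \<xi>) j"
      using hl_integral_dq_le[OF Wmeas WM[OF n] K' \<xi> b] by metis
    then show ?thesis
      using no less(1) touch \<xi> by (metis linear)
  qed
  then have "\<forall>n. \<exists>z \<xi> j. (norm (z - x))\<^sup>2 < e (n + N) \<and> touch_below (K + 1) (\<lambda>y. - W (n + N) y) z \<and> norm \<xi> = 1 \<and>
      - (l * W (n + N) z + 1) \<le> j \<and> hl_integral (dq (W (n + N)) z \<xi>) j"
    by simp
  then obtain z \<xi> j where z: "\<And>n. (norm (z n - x))\<^sup>2 < e (n + N)"
    and touch: "\<And>n. touch_below (K + 1) (\<lambda>y. - W (n + N) y) (z n)" and \<xi>: "\<And>n. norm (\<xi> n) = 1"
    and j: "\<And>n. - (l * W (n + N) (z n) + 1) \<le> j n" "\<And>n. hl_integral (dq (W (n + N)) (z n) (\<xi> n)) (j n)"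
    unfolding choice_iff by blast
  have eN: "(\<lambda>n. e (n + N)) \<longlonglongrightarrow> 0"
    using e0 by (rule LIMSEQ_ignore_initial_segment)
  have "(\<lambda>n. (norm (z n - x))\<^sup>2) \<longlonglongrightarrow> 0"
    by (rule tendsto_sandwich[OF _ _ tendsto_const eN]) (use z in \<open>auto intro!: always_eventually less_imp_le\<close>)
  from tendsto_real_sqrt[OF this] have "(\<lambda>n. norm (z n - x)) \<longlonglongrightarrow> 0"
    by simp
  then have zx: "z \<longlonglongrightarrow> x"
    by (simp add: tendsto_norm_zero_iff LIM_zero_iff)
  have lim: "uniform_limit UNIV (\<lambda>n. W (n + N)) u sequentially"
    unfolding uniform_limit_sequentially_iff
  proof (intro allI impI)
    fix d :: real assume "0 < d"
    then obtain N' where N': "\<And>n. n \<ge> N' \<Longrightarrow> e (n + N) < d"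
      using order_tendstoD(2)[OF eN, of d] by (auto simp: eventually_sequentially)
    have "dist (W (n + N) y) (u y) < d" if "n \<ge> N'" for n y
      using N'[OF that] W_le[of "n + N" y] W_ge[of y "n + N"] by (simp add: dist_real_def)
    then show "\<exists>N'. \<forall>n\<ge>N'. \<forall>y\<in>UNIV. dist (W (n + N) y) (u y) < d"
      by blast
  qed
  have clim: "(\<lambda>n. - (l * W (n + N) (z n) + 1)) \<longlonglongrightarrow> - (l * u x + 1)"
    by (intro tendsto_intros uniform_limit_diagonal[OF lim cont zx])
  have WMN: "\<bar>W (n + N) y\<bar> \<le> M" for n y
    by (rule WM) simp
  show "\<exists>\<xi>. norm \<xi> = 1 \<and> (\<exists>j\<ge>- (l * u x + 1). hl_integral (dq u x \<xi>) j)"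
    by (rule hl_integral_dq_upper_limit[OF Wmeas WMN lim cont zx \<xi> touch j(2,1) clim]) blast
qed

text \<open>The last estimate repeats the truncation with any upper bound of the solution itself in
  place of the bound for \<open>v0\<close>; minimality forces \<open>u\<close> under that barrier.
  In this form the estimate can be normalized.\<close>

lemma perron_solution:
  assumes v0: "supersol \<Omega> l 1 v0" and l: "0 \<le> l"
  obtains u where "supersol \<Omega> l 1 u" "\<And>x. x \<in> \<Omega> \<Longrightarrow> sub_at u x (- (l * u x + 1))" "continuous_on UNIV u"
    "\<And>M x. 0 < M \<Longrightarrow> (\<And>z. u z \<le> M) \<Longrightarrow> u x \<le> (l * M + 1) / gain * barrier x"
proof -
  obtain M where M: "0 < M" "\<And>x. v0 x \<le> M"
    using supersol_bound[OF v0] by metis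
  let ?k = "(l * M + 1) / gain"
  let ?S = "{v. supersol \<Omega> l 1 v \<and> (\<forall>x. v x \<le> M) \<and> (\<forall>x. v x \<le> ?k * barrier x)}"
  obtain u where u: "u \<in> ?S" and min: "\<And>v x. v \<in> ?S \<Longrightarrow> u x \<le> v x"
    and holder: "\<And>x y. \<bar>u x - u y\<bar> \<le> ?k * (2 * R) powr (2 * s - 1) * norm (x - y) powr (2 * s - 1)"
    using perron_minimal[OF v0 l M] by blast
  \<comment> \<open>The two bounds defining \<open>?S\<close> pass to anything below
    \<open>u\<close>, so \<open>u\<close> is minimal among all supersolutions below it.\<close>
  have minimal: "u x \<le> v x" if "supersol \<Omega> l 1 v" "\<And>z. v z \<le> u z" for v x
    using u that by (intro min) (auto intro: order_trans)
  have cont: "continuous_on UNIV u"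
    by (rule holder_imp_continuous[OF holder])
  show ?thesis
  proof (rule that)
    show "sub_at u x (- (l * u x + 1))" if "x \<in> \<Omega>" for x
    proof (rule minimal_imp_sub_at)
      show "u x \<le> v x" if "supersol \<Omega> l 1 v" "\<And>z. v z \<le> u z" for v
        using that by (rule minimal)
    qed (use u cont that in auto)
    show "u x \<le> (l * M' + 1) / gain * barrier x" if M': "0 < M'" "\<And>z. u z \<le> M'" for M' x
    proof -
      have "0 < (l * M' + 1) / gain"
        using l M'(1) gain_pos by (intro divide_pos_pos add_nonneg_pos) auto
      then have "supersol \<Omega> l 1 (\<lambda>x. min (u x) ((l * M' + 1) / gain * barrier x))"
        using gain_pos u by (intro supersol_min_barrier[OF _ l M'(2)]) auto
      then have "u x \<le> min (u x) ((l * M' + 1) / gain * barrier x)"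
        by (rule minimal) simp
      then show ?thesis
        by simp
    qed
  qed (use u cont in auto)
qed

end

section \<open>The eigenvalue\<close>

context frac_order
begin

section \<open>Homogeneity\<close>

lemma dq_cmult: "dq (\<lambda>z. k * u z) x \<xi> = (\<lambda>t. k * dq u x \<xi> t)"
  by (simp add: fun_eq_iff dq_def second_diff_def algebra_simps)

lemma touch_below_cmult:
  assumes "touch_below K (\<lambda>z. k * u z) x" "0 < k"
  shows "touch_below (K / k) u x"
proof -
  obtain p where p: "\<And>z. k * u x + p \<bullet> (z - x) - K * (norm (z - x))\<^sup>2 \<le> k * u z"
    using assms(1) by (auto simp: touch_below_def)
  have "u x + (p /\<^sub>R k) \<bullet> (z - x) - K / k * (norm (z - x))\<^sup>2 \<le> u z" for z
  proof -
    have "k * (u x + (p /\<^sub>R k) \<bullet> (z - x) - K / k * (norm (z - x))\<^sup>2)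
        = k * u x + p \<bullet> (z - x) - K * (norm (z - x))\<^sup>2"
      using assms(2) by (simp add: distrib_left right_diff_distrib flip: mult.assoc)
    then show ?thesis
      using p[of z] assms(2) by (metis mult_le_cancel_left_pos)
  qed
  then show ?thesis
    unfolding touch_below_def by blast
qed

lemma super_at_cmult:
  assumes "super_at u x c" "0 < k"
  shows "super_at (\<lambda>z. k * u z) x (k * c)"
  unfolding super_at_def
proof (intro allI impI)
  fix K and \<xi> :: 'a assume "touch_below K (\<lambda>z. k * u z) x" and \<xi>: "norm \<xi> = 1"
  then obtain j where "j \<le> c" "hl_integral (dq u x \<xi>) j"
    using assms touch_below_cmult unfolding super_at_def by blast
  then show "\<exists>j\<le>k * c. hl_integral (dq (\<lambda>z. k * u z) x \<xi>) j"
    using assms(2) by (intro exI[of _ "k * j"]) (simp add: dq_cmult hl_integral_cmult)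
qed

lemma sub_at_cmult:
  assumes "sub_at u x c" "0 < k"
  shows "sub_at (\<lambda>z. k * u z) x (k * c)"
  unfolding sub_at_def
proof (intro allI impI)
  fix K assume "touch_below K (\<lambda>z. - (k * u z)) x"
  then have "touch_below K (\<lambda>z. k * (- u z)) x"
    by simp
  then obtain \<xi> j where "norm \<xi> = 1" "c \<le> j" "hl_integral (dq u x \<xi>) j"
    using assms touch_below_cmult[of K k "\<lambda>z. - u z" x] unfolding sub_at_def by blast
  then show "\<exists>\<xi>. norm \<xi> = 1 \<and> (\<exists>j\<ge>k * c. hl_integral (dq (\<lambda>z. k * u z) x \<xi>) j)"
    using assms(2) by (intro exI[of _ \<xi>] conjI exI[of _ "k * j"]) (simp_all add: dq_cmult hl_integral_cmult)
qed

lemma supersol_cmult: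
  assumes "supersol \<Omega> l f u" "0 < k"
  shows "supersol \<Omega> l (k * f) (\<lambda>x. k * u x)"
proof -
  have "super_at (\<lambda>x. k * u x) x (- (l * (k * u x) + k * f))" if "x \<in> \<Omega>" for x
    using super_at_cmult[of u x "- (l * u x + f)" k] assms that by (simp add: supersol_def algebra_simps)
  moreover have "bounded (range (\<lambda>x. k * u x))"
    using assms(1) bounded_scaling[of "range u" k] by (simp add: supersol_def image_image)
  ultimately show ?thesis
    using assms unfolding supersol_def by (auto intro: lsc_on_UNIV_cmult)
qed

end

context ball_hull
begin

definition positive_supersol :: "real \<Rightarrow> ('a \<Rightarrow> real) \<Rightarrow> bool" where
  "positive_supersol l v \<longleftrightarrow> supersol \<Omega> l 0 v \<and> (\<forall>x\<in>\<Omega>. 0 < v x)"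

text \<open>The barrier serves: its directional integrals are at most \<open>- gain\<close>, and
  division by its upper bound \<open>S\<close> turns this constant into a multiple of the
  barrier.\<close>

lemma positive_supersol_exists: "\<exists>l>0. \<exists>v. positive_supersol l v"
proof -
  define S where "S = (R\<^sup>2) powr (2 * s - 1)"
  have S: "0 < S"
    using R_pos by (simp add: S_def)
  have bd: "\<bar>barrier x\<bar> \<le> S" for x
    using barrier_nonneg barrier_bound by (simp add: S_def)
  have "super_at barrier x (- (gain / S * barrier x + 0))" if "x \<in> \<Omega>" for x
  proof -
    have "super_at barrier x (0 - 1 * gain)"
      by (rule super_at_add_barrier[OF that _ super_at_zero[of x], where M'=0]) (use bd in auto)
    moreover have "gain / S * barrier x \<le> gain / S * S"
      using gain_pos S bd[of x] by (intro mult_left_mono) auto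
    ultimately show ?thesis
      using S by (elim super_at_weaken) simp
  qed
  moreover have "bounded (range barrier)"
    unfolding bounded_iff using bd by auto
  ultimately have "positive_supersol (gain / S) barrier"
    using barrier_nonneg barrier_zero barrier_pos lsc_on_UNIV_continuous[OF continuous_on_barrier]
    by (simp add: positive_supersol_def supersol_def)
  then show ?thesis
    using gain_pos S by (intro exI[of _ "gain / S"]) auto
qed

text \<open>Cone comparison gives a Harnack-type lower bound on a small ball; a paraboloid centred there then
  touches at a point where the supersolution is at least half its central value.\<close>

lemma positive_supersol_bounded: "\<exists>b. \<forall>l v. positive_supersol l v \<longrightarrow> l \<le> b"
proof -
  obtain x0 r where x0: "x0 \<in> \<Omega>" and r: "0 < r" "cball x0 r \<subseteq> \<Omega>"
    using open_\<Omega> \<Omega>_nonempty open_contains_cball by blast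
  let ?a = "2 * s - 1"
  have a: "0 < ?a"
    using s_gt by simp
  \<comment> \<open>Chosen so that \<open>r' powr ?a = r powr ?a / 2\<close>: the cone of height
    \<open>m\<close> at \<open>x0\<close> that vanishes at distance \<open>r\<close> still has
    height \<open>m / 2\<close> at distance \<open>r'\<close>.\<close>
  define r' where "r' = r * (1/2) powr (1 / ?a)"
  have r': "0 < r'" "r' \<le> r"
    using r(1) a powr_mono2[of "1 / ?a" "1/2" 1] by (auto simp: r'_def mult_left_le)
  obtain b where b: "hl_integral (\<lambda>t. min (2 / r'\<^sup>2 * t\<^sup>2) 2 / t powr (1 + 2 * s)) b"
    using hl_integral_min_kernel[of "2 / r'\<^sup>2" 2] by auto
  have "l \<le> max 0 (2 * b)" if "positive_supersol l v" for l v
  proof (cases "0 < l")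
    case True
    have v: "supersol \<Omega> l 0 v" and pos: "\<And>x. x \<in> \<Omega> \<Longrightarrow> 0 < v x"
      using that by (auto simp: positive_supersol_def)
    have nonneg: "\<And>x. 0 \<le> v x" and lsc: "lsc_on UNIV v"
      using v by (auto simp: supersol_def)
    define m where "m = v x0"
    have m: "0 < m"
      using pos[OF x0] by (simp add: m_def)
    have half: "m / 2 \<le> v x" if x: "norm (x - x0) \<le> r'" for x
    proof -
      have "v x0 - m / r powr ?a * norm (x - x0) powr ?a \<le> v x"
      proof (rule cone_comparison[OF v bounded_\<Omega> x0])
        fix y assume "y \<notin> \<Omega>"
        then have "r \<le> norm (y - x0)"
          using r(2) by (force simp: dist_norm norm_minus_commute)
        then have "r powr ?a \<le> norm (y - x0) powr ?a"
          using r(1) a by (intro powr_mono2) auto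
        then show "v x0 \<le> m / r powr ?a * norm (y - x0) powr ?a"
          using m r(1) by (simp add: m_def[symmetric] field_simps)
      qed (use m True pos in auto)
      moreover have "norm (x - x0) powr ?a \<le> r' powr ?a"
        using x a by (intro powr_mono2) auto
      then have "m / r powr ?a * norm (x - x0) powr ?a \<le> m / r powr ?a * r' powr ?a"
        using m by (intro mult_left_mono) auto
      moreover have "r' powr ?a = r powr ?a / 2"
        using r(1) a by (simp add: r'_def powr_mult powr_powr)
      ultimately show ?thesis
        using r(1) by (simp add: m_def)
    qed
    \<comment> \<open>The paraboloid of height \<open>m\<close> at \<open>x0\<close> vanishes at
      distance \<open>r'\<close>, beyond which \<open>v \<ge> 0\<close>; the minimum of
      \<open>g\<close> over the ball is therefore global.\<close>
    define k where "k = m / r'\<^sup>2"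
    have k: "0 < k" "k * r'\<^sup>2 = m"
      using m r' by (auto simp: k_def)
    define g where "g z = v z + k * (norm (z - x0))\<^sup>2" for z
    have "lsc_on UNIV g"
      unfolding g_def[abs_def] by (intro lsc_on_UNIV_add lsc lsc_on_UNIV_continuous continuous_intros)
    then obtain z where z: "z \<in> cball x0 r'" "\<forall>y\<in>cball x0 r'. g z \<le> g y"
      using lsc_on_UNIV_attains_inf[of "cball x0 r'" g] r'(1) by (auto simp: compact_cball)
    have gx0: "g x0 = m"
      by (simp add: g_def m_def)
    have gz: "g z \<le> m"
      using z(2) gx0 r'(1) by force
    have min: "g z \<le> g y" for y
    proof (cases "y \<in> cball x0 r'")
      case False
      then have "r'\<^sup>2 \<le> (norm (y - x0))\<^sup>2"
        using r'(1) by (intro power_mono) (auto simp: dist_norm norm_minus_commute)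
      then have "k * r'\<^sup>2 \<le> k * (norm (y - x0))\<^sup>2"
        using k(1) by (intro mult_left_mono) auto
      then show ?thesis
        using gz k(2) nonneg[of y] by (simp add: g_def)
    qed (use z in auto)
    have "norm (z - x0) \<le> r'"
      using z(1) by (simp add: dist_norm norm_minus_commute)
    then have vz: "m / 2 \<le> v z" and "z \<in> \<Omega>"
      using half r' r(2) by (auto simp: dist_norm norm_minus_commute)
    have "0 \<le> k * (norm (z - x0))\<^sup>2"
      using k(1) by simp
    then have vz': "v z \<le> m"
      using gz by (simp add: g_def)
    have touch: "touch_below k v z"
      unfolding touch_below_def
    proof (intro exI allI)
      fix y
      have "(norm (y - x0))\<^sup>2 = (norm (y - z))\<^sup>2 + 2 * ((z - x0) \<bullet> (y - z)) + (norm (z - x0))\<^sup>2"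
        unfolding power2_norm_eq_inner by (simp add: algebra_simps inner_commute)
      then have "k * (norm (y - x0))\<^sup>2 = k * (norm (y - z))\<^sup>2 + k * (2 * ((z - x0) \<bullet> (y - z))) + k * (norm (z - x0))\<^sup>2"
        by (simp only: distrib_left)
      moreover have "(- (2 * k) *\<^sub>R (z - x0)) \<bullet> (y - z) = - (k * (2 * ((z - x0) \<bullet> (y - z))))"
        by (simp only: inner_scaleR_left mult_ac minus_mult_left)
      ultimately show "v z + (- (2 * k) *\<^sub>R (z - x0)) \<bullet> (y - z) - k * (norm (y - z))\<^sup>2 \<le> v y"
        using min[of y] unfolding g_def by linarith
    qed
    obtain \<xi> :: 'a where \<xi>: "norm \<xi> = 1"
      using vector_choose_size zero_le_one by blast
    have "super_at v z (- (l * v z + 0))"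
      using v \<open>z \<in> \<Omega>\<close> by (simp add: supersol_def)
    then obtain j where j: "j \<le> - (l * v z + 0)" "hl_integral (dq v z \<xi>) j"
      using touch \<xi> unfolding super_at_def by blast
    \<comment> \<open>Both lower bounds on the second difference scale with \<open>m\<close>, so
      \<open>b\<close> is the same for all \<open>v\<close>, and \<open>m\<close> cancels at the
      end.\<close>
    have "- m * b \<le> j"
    proof (rule hl_integral_mono[OF hl_integral_cmult[OF b] j(2)])
      fix t :: real assume "0 < t"
      have "- (2 * k * t\<^sup>2) \<le> second_diff v z (t *\<^sub>R \<xi>)"
        using touch_below_second_diff[OF touch, of "t *\<^sub>R \<xi>"] \<xi> by simp
      moreover have "2 * k * t\<^sup>2 = m * (2 / r'\<^sup>2 * t\<^sup>2)"
        by (simp add: k_def)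
      moreover have "- (2 * m) \<le> second_diff v z (t *\<^sub>R \<xi>)"
        using nonneg[of "z + t *\<^sub>R \<xi>"] nonneg[of "z - t *\<^sub>R \<xi>"] vz' by (simp add: second_diff_def)
      ultimately have "- m * min (2 / r'\<^sup>2 * t\<^sup>2) 2 \<le> second_diff v z (t *\<^sub>R \<xi>)"
        by (simp add: min_def)
      then show "- m * (min (2 / r'\<^sup>2 * t\<^sup>2) 2 / t powr (1 + 2 * s)) \<le> dq v z \<xi> t"
        unfolding dq_def times_divide_eq_right by (rule divide_right_mono) simp
    qed
    moreover have "l * (m / 2) \<le> l * v z"
      using vz True by (intro mult_left_mono) auto
    ultimately have "l * (m / 2) \<le> m * b"
      using j(1) by linarith
    then show ?thesis
      using m by (simp add: field_simps)
  qed simp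
  then show ?thesis
    by blast
qed

text \<open>The gap between \<open>l\<close> and \<open>l0\<close> is traded for a right-hand side.
  Adding \<open>\<eta> * barrier\<close> yields the surplus
  \<open>(l - l0) * v x + \<eta> * gain\<close>, which must absorb
  \<open>l0 * \<eta> * barrier x\<close>: near the boundary the barrier is small, and away from it
  \<open>v\<close> has a positive minimum.\<close>

lemma supersol_below_eigenvalue:
  assumes v: "positive_supersol l v" and l0: "0 \<le> l0" "l0 < l"
  shows "\<exists>w. supersol \<Omega> l0 1 w"
proof -
  have sv: "supersol \<Omega> l 0 v" and pos: "\<And>x. x \<in> \<Omega> \<Longrightarrow> 0 < v x"
    using v by (auto simp: positive_supersol_def)
  have nonneg: "\<And>x. 0 \<le> v x" and lsc: "lsc_on UNIV v" and [measurable]: "v \<in> borel_measurable borel"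
    and zero: "\<And>x. x \<notin> \<Omega> \<Longrightarrow> v x = 0"
    using sv by (auto simp: supersol_def)
  obtain M where M: "0 < M" "\<And>x. \<bar>v x\<bar> \<le> M"
    using supersol_bound[OF sv] by metis
  define S where "S = (R\<^sup>2) powr (2 * s - 1)"
  have S: "0 < S" "\<And>x. barrier x \<le> S"
    using R_pos barrier_bound by (auto simp: S_def)
  \<comment> \<open>Where \<open>barrier x < \<epsilon>\<close>, the term
    \<open>l0 * barrier x\<close> costs at most half of \<open>gain\<close>; the other half becomes
    the right-hand side.\<close>
  define \<epsilon> where "\<epsilon> = gain / (2 * (l0 + 1))"
  have \<epsilon>: "0 < \<epsilon>" "l0 * \<epsilon> \<le> gain / 2"
    using gain_pos l0(1) by (auto simp: \<epsilon>_def field_simps)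
  define C where "C = {x. \<epsilon> \<le> barrier x}"
  have "C \<subseteq> \<Omega>"
    using barrier_zero \<epsilon>(1) by (force simp: C_def)
  moreover have "closed C"
    unfolding C_def by (intro closed_Collect_le continuous_intros continuous_on_barrier)
  ultimately have C: "compact C" "C \<subseteq> \<Omega>"
    using bounded_\<Omega> bounded_subset compact_eq_bounded_closed by blast+
  obtain m where m: "0 < m" "\<And>x. x \<in> C \<Longrightarrow> m \<le> v x"
  proof (cases "C = {}")
    case False
    then obtain z where "z \<in> C" "\<forall>y\<in>C. v z \<le> v y"
      using lsc_on_UNIV_attains_inf[OF C(1) _ lsc] by blast
    then show ?thesis
      using that[of "v z"] pos C(2) by blast
  qed (use that[of 1] in auto)
  \<comment> \<open>So small that on \<open>C\<close> the gap \<open>(l - l0) * m\<close> pays for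
    \<open>l0 * \<eta> * S\<close>; the added 1 covers \<open>l0 = 0\<close>.\<close>
  define \<eta> where "\<eta> = (l - l0) * m / (l0 * S + 1)"
  have d: "0 < l0 * S + 1"
    using l0(1) S(1) by (intro add_nonneg_pos) auto
  have \<eta>: "0 < \<eta>" "\<eta> * (l0 * S) \<le> (l - l0) * m"
  proof -
    show "0 < \<eta>"
      using l0 m(1) d by (simp add: \<eta>_def)
    then have "\<eta> * (l0 * S) \<le> \<eta> * (l0 * S + 1)"
      by (intro mult_left_mono) auto
    also have "\<dots> = (l - l0) * m"
      using d by (simp add: \<eta>_def)
    finally show "\<eta> * (l0 * S) \<le> (l - l0) * m" .
  qed
  define w where "w x = v x + \<eta> * barrier x" for x
  have w0: "0 \<le> w x" for x
    using nonneg[of x] barrier_nonneg[of x] \<eta>(1) by (simp add: w_def)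
  have wM: "\<bar>w x\<bar> \<le> M + \<eta> * S" for x
    using w0[of x] abs_le_D1[OF M(2)[of x]] mult_left_mono[OF S(2)[of x] less_imp_le[OF \<eta>(1)]]
    by (simp add: w_def abs_of_nonneg)
  have wmeas: "w \<in> borel_measurable borel"
    unfolding w_def by measurable
  have "super_at w x (- (l0 * w x + \<eta> * gain / 2))" if x: "x \<in> \<Omega>" for x
  proof -
    have "super_at v x (- (l * v x + 0))"
      using sv x by (simp add: supersol_def)
    then have "super_at w x (- (l * v x + 0) - \<eta> * gain)"
      by (rule super_at_add_barrier[OF x _ _ M(2) wmeas wM, rotated]) (use \<eta>(1) in \<open>auto simp: w_def\<close>)
    moreover have "l0 * (\<eta> * barrier x) \<le> (l - l0) * v x + \<eta> * gain / 2"
    proof (cases "x \<in> C")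
      case True
      have "\<eta> * (l0 * barrier x) \<le> \<eta> * (l0 * S)"
        using \<eta>(1) l0(1) S(2)[of x] by (intro mult_left_mono) auto
      also have "\<dots> \<le> (l - l0) * m"
        by (rule \<eta>(2))
      also have "\<dots> \<le> (l - l0) * v x"
        using m(2)[OF True] l0(2) by (intro mult_left_mono) auto
      finally have "\<eta> * (l0 * barrier x) \<le> (l - l0) * v x" .
      moreover have "0 \<le> \<eta> * gain"
        using \<eta>(1) gain_pos by simp
      ultimately show ?thesis
        by (simp only: mult.left_commute[of l0])
    next
      case False
      then have "l0 * barrier x \<le> l0 * \<epsilon>"
        using l0(1) by (intro mult_left_mono) (auto simp: C_def)
      then have "\<eta> * (l0 * barrier x) \<le> \<eta> * (gain / 2)"
        using \<epsilon>(2) \<eta>(1) by (intro mult_left_mono) auto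
      moreover have "0 \<le> (l - l0) * v x"
        using l0(2) nonneg[of x] by simp
      ultimately show ?thesis
        by (simp add: mult.left_commute[of l0])
    qed
    ultimately show ?thesis
      by (elim super_at_weaken) (simp add: w_def algebra_simps)
  qed
  moreover have "lsc_on UNIV w"
    unfolding w_def[abs_def]
    by (intro lsc_on_UNIV_add lsc lsc_on_UNIV_continuous continuous_intros continuous_on_barrier)
  moreover have "bounded (range w)"
    unfolding bounded_iff using wM by auto
  ultimately have "supersol \<Omega> l0 (\<eta> * gain / 2) w"
    using wmeas w0 zero barrier_zero unfolding supersol_def by (simp add: w_def)
  from supersol_cmult[OF this, of "1 / (\<eta> * gain / 2)"] show ?thesis
    using \<eta>(1) gain_pos by auto
qed

end

context frac_order
begin

text \<open>Towards \<open>y\<close> the second difference is nonnegative, and at least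
  \<open>u y / 2\<close> on an interval of steps just beyond the distance to \<open>y\<close>. Since
  the direction is free, one positive value is seen from every zero.\<close>

lemma dq_integral_pos:
  fixes u :: "'a::euclidean_space \<Rightarrow> real"
  assumes cont: "continuous_on UNIV u" and nonneg: "\<And>z. 0 \<le> u z" and "u x = 0" "0 < u y"
  obtains \<xi> where "norm \<xi> = 1" "\<And>j. hl_integral (dq u x \<xi>) j \<Longrightarrow> 0 < j"
proof -
  define r where "r = norm (y - x)"
  have r: "0 < r"
    using assms(3,4) by (auto simp: r_def)
  define \<xi> where "\<xi> = (y - x) /\<^sub>R r"
  have \<xi>: "norm \<xi> = 1" "r *\<^sub>R \<xi> = y - x"
    using r by (auto simp: \<xi>_def) (simp add: r_def)
  define c where "c = u y / 2"
  have c: "0 < c"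
    using assms(4) by (simp add: c_def)
  obtain d where d: "0 < d" "\<And>z. dist z y < d \<Longrightarrow> dist (u z) (u y) < c"
    using cont[unfolded continuous_on_iff, rule_format, of y c] c by auto
  define r' where "r' = r + d / 2"
  have r': "r < r'" "0 < r'"
    using r d(1) by (auto simp: r'_def)
  have low: "c * (indicator {r<..} t / t powr (1 + 2 * s) - indicator {r'<..} t / t powr (1 + 2 * s)) \<le> dq u x \<xi> t"
    if "0 < t" for t
  proof -
    have 0: "0 \<le> second_diff u x (t *\<^sub>R \<xi>)"
      using nonneg[of "x + t *\<^sub>R \<xi>"] nonneg[of "x - t *\<^sub>R \<xi>"] assms(3) by (simp add: second_diff_def)
    have "c \<le> second_diff u x (t *\<^sub>R \<xi>)" if t: "r < t" "t \<le> r'"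
    proof -
      have "x + t *\<^sub>R \<xi> - y = (t - r) *\<^sub>R \<xi>"
        using \<xi>(2) by (simp add: algebra_simps)
      then have "dist (x + t *\<^sub>R \<xi>) y < d"
        using t \<xi>(1) d(1) by (simp add: dist_norm r'_def)
      then have "dist (u (x + t *\<^sub>R \<xi>)) (u y) < c"
        by (rule d(2))
      then have "c \<le> u (x + t *\<^sub>R \<xi>)"
        unfolding dist_real_def c_def by linarith
      then show ?thesis
        using nonneg[of "x - t *\<^sub>R \<xi>"] assms(3) by (simp add: second_diff_def)
    qed
    then have "c * (indicator {r<..} t - indicator {r'<..} t) \<le> second_diff u x (t *\<^sub>R \<xi>)"
      using 0 r' by (auto split: split_indicator)
    then have "c * (indicator {r<..} t - indicator {r'<..} t) / t powr (1 + 2 * s) \<le> dq u x \<xi> t"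
      unfolding dq_def by (rule divide_right_mono) simp
    then show ?thesis
      by (simp add: diff_divide_distrib right_diff_distrib)
  qed
  have "r' powr (- (2 * s)) < r powr (- (2 * s))"
    using r r' s_gt by (intro powr_less_mono2_neg) auto
  then have p: "0 < c * (r powr (- (2 * s)) / (2 * s) - r' powr (- (2 * s)) / (2 * s))"
    using c s_gt by (simp add: divide_strict_right_mono)
  show ?thesis
  proof (rule that[OF \<xi>(1)])
    fix j assume "hl_integral (dq u x \<xi>) j"
    then show "0 < j"
      using p hl_integral_mono[OF hl_integral_cmult[OF hl_integral_diff[OF hl_integral_tail[OF r] hl_integral_tail[OF r'(2)]]] _ low]
      by fastforce
  qed
qed

text \<open>At a zero in \<Omega> the constant 0 touches from below, so every directional integral
  is at most 0; the direction towards \<open>y\<close> violates this. It covers the right-hand side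
  0, out of reach of \<open>supersol_pos\<close>.\<close>

lemma supersol_strong_minimum:
  fixes u :: "'a::euclidean_space \<Rightarrow> real"
  assumes u: "supersol \<Omega> l 0 u" and cont: "continuous_on UNIV u" and y: "0 < u y" and x: "x \<in> \<Omega>"
  shows "0 < u x"
proof (rule ccontr)
  assume not_pos: "\<not> ?thesis"
  have nonneg: "0 \<le> u z" for z
    using u by (auto simp: supersol_def)
  then have ux: "u x = 0"
    using not_pos by (auto intro: antisym)
  obtain \<xi> where \<xi>: "norm \<xi> = 1" "\<And>j. hl_integral (dq u x \<xi>) j \<Longrightarrow> 0 < j"
    using dq_integral_pos[OF cont nonneg ux y] by blast
  have "touch_below 0 u x"
    unfolding touch_below_def using nonneg ux by (intro exI[of _ 0]) simp
  moreover have "super_at u x (- (l * u x + 0))"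
    using u x by (simp add: supersol_def)
  ultimately obtain j where "j \<le> - (l * u x + 0)" "hl_integral (dq u x \<xi>) j"
    unfolding super_at_def using \<xi>(1) by blast
  with \<xi>(2)[of j] ux show False
    by simp
qed

end

context ball_hull
begin

text \<open>With maximum 1 the right-hand side becomes \<open>m\<close>, the reciprocal of the old
  maximum, and \<open>u x \<le> 1\<close> gives \<open>l0 * u x + m \<ge> (l0 + m) * u x\<close>.
  The solution thus competes for the eigenvalue at level \<open>l0 + m\<close>, which caps
  \<open>m\<close> by the gap.\<close>

lemma normalized_solution:
  assumes l0: "0 \<le> l0" "supersol \<Omega> l0 1 w"
  obtains m u where "0 < m" "positive_supersol (l0 + m) u"
    "supersol \<Omega> l0 m u" "\<And>x. x \<in> \<Omega> \<Longrightarrow> sub_at u x (- (l0 * u x + m))"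
    "continuous_on UNIV u" "\<And>x. u x \<le> 1" "\<exists>x. u x = 1" "\<And>x. u x \<le> (l0 + m) / gain * barrier x"
proof -
  obtain u where u: "supersol \<Omega> l0 1 u" and sub: "\<And>x. x \<in> \<Omega> \<Longrightarrow> sub_at u x (- (l0 * u x + 1))"
    and cont: "continuous_on UNIV u"
    and bar: "\<And>M x. 0 < M \<Longrightarrow> (\<And>z. u z \<le> M) \<Longrightarrow> u x \<le> (l0 * M + 1) / gain * barrier x"
    using perron_solution[OF l0(2,1)] by blast
  have pos: "0 < u x" if "x \<in> \<Omega>" for x
    using supersol_pos[OF u _ that] by simp
  have nonneg: "0 \<le> u x" and zero: "x \<notin> \<Omega> \<Longrightarrow> u x = 0" for x
    using u by (auto simp: supersol_def)
  have "compact (closure \<Omega>)" "closure \<Omega> \<noteq> {}"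
    using bounded_\<Omega> \<Omega>_nonempty by (auto simp: compact_closure)
  then obtain z where z: "z \<in> closure \<Omega>" "\<forall>y\<in>closure \<Omega>. u y \<le> u z"
    using continuous_attains_sup continuous_on_subset[OF cont] by (metis subset_UNIV)
  define M where "M = u z"
  have le: "u y \<le> M" for y
    using z(2) closure_subset[of \<Omega>] zero[of y] nonneg[of z] by (cases "y \<in> \<Omega>") (auto simp: M_def)
  obtain x0 where "x0 \<in> \<Omega>"
    using \<Omega>_nonempty by blast
  then have M: "0 < M"
    using pos[of x0] le[of x0] by simp
  define m where "m = 1 / M"
  have m: "0 < m" "m * M = 1"
    using M by (auto simp: m_def)
  let ?v = "\<lambda>x. m * u x"
  have sv: "supersol \<Omega> l0 m ?v"
    using supersol_cmult[OF u m(1)] by simp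
  have v1: "?v x \<le> 1" for x
    using mult_left_mono[OF le[of x], of m] m by simp
  have "super_at ?v x (- ((l0 + m) * ?v x + 0))" if "x \<in> \<Omega>" for x
  proof (rule super_at_weaken)
    show "super_at ?v x (- (l0 * ?v x + m))"
      using sv that by (simp add: supersol_def)
    show "- (l0 * ?v x + m) \<le> - ((l0 + m) * ?v x + 0)"
      using mult_left_mono[OF v1[of x], of m] m(1) by (simp add: distrib_right)
  qed
  then have "positive_supersol (l0 + m) ?v"
    using sv pos m(1) by (simp add: positive_supersol_def supersol_def)
  moreover have "sub_at ?v x (- (l0 * ?v x + m))" if "x \<in> \<Omega>" for x
    using sub_at_cmult[OF sub[OF that] m(1)] by (simp add: algebra_simps)
  moreover have "continuous_on UNIV ?v"
    by (intro continuous_intros cont)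
  moreover have "\<exists>x. ?v x = 1"
    using m(2) by (intro exI[of _ z]) (simp add: M_def)
  moreover have "?v x \<le> (l0 + m) / gain * barrier x" for x
  proof -
    have "?v x \<le> m * ((l0 * M + 1) / gain * barrier x)"
      using bar[OF M le, of x] m(1) by (intro mult_left_mono) auto
    also have "\<dots> = (l0 * (m * M) + m) / gain * barrier x"
      by (simp add: algebra_simps)
    finally show ?thesis
      using m(2) by simp
  qed
  ultimately show ?thesis
    using that[of m ?v] m(1) sv v1 by blast
qed

text \<open>The principal eigenvalue divided by \<open>frac_const s\<close>. Competitors here vanish
  outside \<Omega>; cutting them off there only lowers second differences at points of \<Omega>, so
  the supremum is unchanged.\<close>

definition eigenvalue :: real where
  "eigenvalue = Sup {l. \<exists>v. positive_supersol l v}"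

lemma eigenvalue_upper: "positive_supersol l v \<Longrightarrow> l \<le> eigenvalue"
  and eigenvalue_pos: "0 < eigenvalue"
  and eigenvalue_approx: "c < eigenvalue \<Longrightarrow> \<exists>l>c. \<exists>v. positive_supersol l v"
proof -
  have bdd: "bdd_above {l. \<exists>v. positive_supersol l v}"
    using positive_supersol_bounded by (auto simp: bdd_above_def)
  obtain l0 v0 where l0: "0 < l0" "positive_supersol l0 v0"
    using positive_supersol_exists by blast
  then have ne: "{l. \<exists>v. positive_supersol l v} \<noteq> {}"
    by blast
  show upper: "l \<le> eigenvalue" if "positive_supersol l v" for l v
    unfolding eigenvalue_def using that by (intro cSup_upper bdd) blast
  show "0 < eigenvalue"
    using upper[OF l0(2)] l0(1) by simp
  show "\<exists>l>c. \<exists>v. positive_supersol l v" if "c < eigenvalue"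
    using less_cSupD[OF ne that[unfolded eigenvalue_def]] by blast
qed

text \<open>Were the normalizing factors \<open>m n\<close> bounded away from \<open>0\<close>, the solutions \<open>u n\<close> would be positive
  supersolutions beyond the eigenvalue; so they vanish in the limit and with them the right-hand side.\<close>

theorem eigenfunction_exists:
  obtains u L where "supersol \<Omega> eigenvalue 0 u" "\<And>x. x \<in> \<Omega> \<Longrightarrow> sub_at u x (- (eigenvalue * u x))"
    "\<And>x y. \<bar>u x - u y\<bar> \<le> L * norm (x - y) powr (2 * s - 1)" "\<And>x. x \<in> \<Omega> \<Longrightarrow> 0 < u x"
proof -
  define l where "l n = eigenvalue - eigenvalue / real (Suc n)" for n
  have l: "0 \<le> l n" "l n < eigenvalue" for n
    using eigenvalue_pos by (auto simp: l_def field_simps)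
  have "(\<lambda>n. eigenvalue - eigenvalue * (1 / real (Suc n))) \<longlonglongrightarrow> eigenvalue - eigenvalue * 0"
    by (intro tendsto_intros LIMSEQ_Suc[OF lim_1_over_n])
  then have llim: "l \<longlonglongrightarrow> eigenvalue"
    by (simp add: l_def[abs_def])
  have "\<exists>m u. 0 < m \<and> positive_supersol (l n + m) u \<and> supersol \<Omega> (l n) m u \<and>
      (\<forall>x\<in>\<Omega>. sub_at u x (- (l n * u x + m))) \<and> continuous_on UNIV u \<and> (\<forall>x. u x \<le> 1) \<and>
      (\<exists>x. u x = 1) \<and> (\<forall>x. u x \<le> (l n + m) / gain * barrier x)" for n
  proof -
    obtain l' v where "l n < l'" "positive_supersol l' v"
      using eigenvalue_approx[OF l(2)] by blast
    then obtain w where "supersol \<Omega> (l n) 1 w"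
      using supersol_below_eigenvalue[OF _ l(1)] by blast
    then show ?thesis
      by (rule normalized_solution[OF l(1)]) blast
  qed
  then obtain m U where m: "\<And>n. 0 < m n" and ps: "\<And>n. positive_supersol (l n + m n) (U n)"
    and sup: "\<And>n. supersol \<Omega> (l n) (m n) (U n)"
    and sub: "\<And>n x. x \<in> \<Omega> \<Longrightarrow> sub_at (U n) x (- (l n * U n x + m n))"
    and cont: "\<And>n. continuous_on UNIV (U n)" and U1: "\<And>n x. U n x \<le> 1" and top: "\<And>n. \<exists>x. U n x = 1"
    and bar: "\<And>n x. U n x \<le> (l n + m n) / gain * barrier x"
    by metis
  have lm: "l n + m n \<le> eigenvalue" for n
    by (rule eigenvalue_upper[OF ps])
  have mlim: "m \<longlonglongrightarrow> 0"
  proof (rule tendsto_sandwich[OF _ _ tendsto_const])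
    show "(\<lambda>n. eigenvalue - l n) \<longlonglongrightarrow> 0"
      using tendsto_diff[OF tendsto_const llim, of eigenvalue] by simp
  qed (use m lm in \<open>auto intro!: always_eventually simp: less_imp_le algebra_simps\<close>)
  have nonneg: "0 \<le> U n x" and zero: "x \<notin> \<Omega> \<Longrightarrow> U n x = 0" for n x
    using sup[of n] by (auto simp: supersol_def)
  have abs1: "\<bar>U n x\<bar> \<le> 1" for n x
    using nonneg[of n x] U1[of n x] by simp
  \<comment> \<open>\<open>l n + m n \<le> eigenvalue\<close> bounds all barrier factors at once, so
    the Hoelder constant is uniform although the maxima before normalization blow up.\<close>
  define k where "k = eigenvalue / gain"
  have k: "0 \<le> k"
    using eigenvalue_pos gain_pos by (simp add: k_def)
  have bark: "U n x \<le> k * barrier x" for n x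
  proof -
    have "(l n + m n) / gain * barrier x \<le> k * barrier x"
      unfolding k_def using lm[of n] gain_pos barrier_nonneg by (intro mult_right_mono divide_right_mono) auto
    then show ?thesis
      using bar[of n x] by linarith
  qed
  let ?L = "k * (2 * R) powr (2 * s - 1)"
  have holder: "\<bar>U n x - U n y\<bar> \<le> ?L * norm (x - y) powr (2 * s - 1)" for n x y
  proof (rule supersol_holder[OF sup[of n] _ k bark])
    show "0 < l n * U n x + m n" for x
      using l(1)[of n] nonneg[of n x] m[of n] by (intro add_nonneg_pos mult_nonneg_nonneg)
  qed
  obtain r u where r: "strict_mono (r :: nat \<Rightarrow> nat)" and lim: "uniform_limit UNIV (\<lambda>n. U (r n)) u sequentially"
    and uholder: "\<And>x y. \<bar>u x - u y\<bar> \<le> ?L * norm (x - y) powr (2 * s - 1)"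
    by (rule holder_compactness[where U=U, OF holder abs1 zero bounded_\<Omega>]) (assumption, (rule that; assumption))
  have lr: "(\<lambda>n. l (r n)) \<longlonglongrightarrow> eigenvalue" and mr: "(\<lambda>n. m (r n)) \<longlonglongrightarrow> 0"
    using LIMSEQ_subseq_LIMSEQ[OF llim r] LIMSEQ_subseq_LIMSEQ[OF mlim r] by (auto simp: o_def)
  have contu: "continuous_on UNIV u"
    by (rule holder_imp_continuous[OF uholder])
  have su: "supersol \<Omega> eigenvalue 0 u"
    by (rule supersol_limit[OF sup cont U1 lim lr mr])
  have subu: "sub_at u x (- (eigenvalue * u x))" if "x \<in> \<Omega>" for x
    using sub_at_limit[OF cont abs1 lim open_\<Omega> that sub lr mr] by simp
  \<comment> \<open>Uniform convergence keeps the limit above 1/2 where some \<open>U (r N)\<close>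
    equals 1; one positive value is enough for the strong minimum principle.\<close>
  obtain N where N: "\<And>x. dist (U (r N) x) (u x) < 1/2"
    using lim[unfolded uniform_limit_sequentially_iff, rule_format, of "1/2"] by auto
  obtain y where "U (r N) y = 1"
    using top[of "r N"] by blast
  then have "0 < u y"
    using N[of y] unfolding dist_real_def by linarith
  then have upos: "0 < u x" if "x \<in> \<Omega>" for x
    by (rule supersol_strong_minimum[OF su contu _ that])
  show ?thesis
    by (rule that[OF su]) (fact subu uholder upos)+
qed

end

section \<open>Correspondence with viscosity solutions\<close>

lemma linear_functional_inner:
  fixes D :: "'a::euclidean_space \<Rightarrow>\<^sub>L real"
  obtains p where "\<And>v. blinfun_apply D v = p \<bullet> v"
proof -
  have "blinfun_apply D v = (\<Sum>b\<in>Basis. blinfun_apply D b *\<^sub>R b) \<bullet> v" for v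
  proof -
    have "blinfun_apply D v = blinfun_apply D (\<Sum>b\<in>Basis. (v \<bullet> b) *\<^sub>R b)"
      by (simp add: euclidean_representation)
    also have "\<dots> = (\<Sum>b\<in>Basis. (v \<bullet> b) * blinfun_apply D b)"
      by (simp add: blinfun.sum_right blinfun.scaleR_right)
    finally show ?thesis
      by (simp add: inner_sum_left inner_commute[of v] mult.commute)
  qed
  then show ?thesis
    by (rule that)
qed

text \<open>Differentiability of \<open>D\<close> at \<open>x\<close> bounds
  \<open>norm (D z - D x)\<close> linearly in \<open>norm (z - x)\<close>; the mean value inequality
  for \<phi> minus its linear part then gives the quadratic remainder.\<close>

lemma C2_on_first_order_bound:
  fixes \<phi> :: "'a::euclidean_space \<Rightarrow> real"
  assumes "C2_on (ball x \<rho>) \<phi>" "0 < \<rho>"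
  obtains p K r where "0 < r" "r \<le> \<rho>"
    "\<And>z. norm (z - x) < r \<Longrightarrow> \<bar>\<phi> z - \<phi> x - p \<bullet> (z - x)\<bar> \<le> K * (norm (z - x))\<^sup>2"
proof -
  obtain D :: "'a \<Rightarrow> 'a \<Rightarrow>\<^sub>L real" and H :: "'a \<Rightarrow> 'a \<Rightarrow>\<^sub>L 'a \<Rightarrow>\<^sub>L real"
    where D: "\<And>z. z \<in> ball x \<rho> \<Longrightarrow> (\<phi> has_derivative blinfun_apply (D z)) (at z)"
    and H: "\<And>z. z \<in> ball x \<rho> \<Longrightarrow> (D has_derivative blinfun_apply (H z)) (at z)"
    using assms(1) unfolding C2_on_def by blast
  have "(D has_derivative blinfun_apply (H x)) (at x)"
    using H assms(2) by simp
  then obtain d where d: "0 < d"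
    "\<And>z. norm (z - x) < d \<Longrightarrow> norm (D z - D x - blinfun_apply (H x) (z - x)) \<le> 1 * norm (z - x)"
    unfolding has_derivative_at_alt by (metis zero_less_one)
  define K where "K = 1 + norm (H x)"
  have lip: "norm (D z - D x) \<le> K * norm (z - x)" if "norm (z - x) < d" for z
  proof -
    have "norm (D z - D x) \<le> norm (D z - D x - blinfun_apply (H x) (z - x)) + norm (blinfun_apply (H x) (z - x))"
      using norm_triangle_ineq[of "D z - D x - blinfun_apply (H x) (z - x)" "blinfun_apply (H x) (z - x)"] by simp
    also have "\<dots> \<le> norm (z - x) + norm (H x) * norm (z - x)"
      using d(2)[OF that] norm_blinfun[of "H x" "z - x"] by linarith
    finally show ?thesis
      by (simp add: K_def distrib_right)
  qed
  obtain p where p: "\<And>v. blinfun_apply (D x) v = p \<bullet> v"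
    using linear_functional_inner by blast
  have "\<bar>\<phi> z - \<phi> x - p \<bullet> (z - x)\<bar> \<le> K * (norm (z - x))\<^sup>2" if z: "norm (z - x) < min d \<rho>" for z
  proof -
    let ?S = "cball x (norm (z - x))"
    have "norm ((\<phi> z - blinfun_apply (D x) z) - (\<phi> x - blinfun_apply (D x) x)) \<le> (K * norm (z - x)) * norm (z - x)"
    proof (rule differentiable_bound[where S="?S" and f'="\<lambda>w. blinfun_apply (D w - D x)"])
      fix w assume "w \<in> ?S"
      then have w: "norm (w - x) \<le> norm (z - x)"
        by (simp add: dist_norm norm_minus_commute)
      have "(\<phi> has_derivative blinfun_apply (D w)) (at w within ?S)"
        by (rule has_derivative_at_withinI[OF D]) (use w z in \<open>simp add: dist_norm norm_minus_commute\<close>)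
      then show "((\<lambda>y. \<phi> y - blinfun_apply (D x) y) has_derivative blinfun_apply (D w - D x)) (at w within ?S)"
        using has_derivative_diff[OF _ bounded_linear_imp_has_derivative[OF blinfun.bounded_linear_right]]
        by (simp add: minus_blinfun.rep_eq)
      have "norm (D w - D x) \<le> K * norm (w - x)"
        using lip[of w] w z by simp
      also have "\<dots> \<le> K * norm (z - x)"
        using w by (intro mult_left_mono) (simp_all add: K_def)
      finally show "onorm (blinfun_apply (D w - D x)) \<le> K * norm (z - x)"
        by (simp add: norm_blinfun.rep_eq)
    qed (auto simp: dist_norm norm_minus_commute)
    moreover have "(\<phi> z - blinfun_apply (D x) z) - (\<phi> x - blinfun_apply (D x) x) = \<phi> z - \<phi> x - p \<bullet> (z - x)"
      by (simp add: p inner_diff_right)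
    ultimately show ?thesis
      by (simp add: power2_eq_square mult.assoc)
  qed
  then show ?thesis
    using that[of "min d \<rho>"] d(1) assms(2) by auto
qed

lemma C2_on_paraboloid: "C2_on S (\<lambda>z::'a::euclidean_space. c + p \<bullet> (z - x) - K * (norm (z - x))\<^sup>2)"
proof -
  define D where "D z = blinfun_inner_right (p - (2 * K) *\<^sub>R (z - x))" for z
  define h where "h v = blinfun_inner_right (- (2 * K) *\<^sub>R v)" for v :: 'a
  have h: "bounded_linear h"
    unfolding h_def by (intro bounded_linear_compose[OF bounded_linear_blinfun_inner_right] bounded_linear_scaleR_right)
  have "((\<lambda>z. c + p \<bullet> (z - x) - K * (norm (z - x))\<^sup>2) has_derivative blinfun_apply (D z)) (at z)" for z
    unfolding power2_norm_eq_inner D_def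
    by (auto intro!: derivative_eq_intros simp: fun_eq_iff inner_diff_left inner_commute algebra_simps)
  moreover have "(D has_derivative blinfun_apply (Blinfun h)) (at z)" for z
  proof -
    have "((\<lambda>z. p - (2 * K) *\<^sub>R (z - x)) has_derivative (\<lambda>v. - (2 * K) *\<^sub>R v)) (at z)"
      by (auto intro!: derivative_eq_intros)
    then show ?thesis
      unfolding D_def[abs_def] bounded_linear_Blinfun_apply[OF h] h_def
      by (rule bounded_linear.has_derivative[OF bounded_linear_blinfun_inner_right])
  qed
  ultimately show ?thesis
    unfolding C2_on_def by (intro exI[of _ D] exI[of _ "\<lambda>_. Blinfun h"]) auto
qed

lemma touch_below_if_C2_on:
  fixes u :: "'a::euclidean_space \<Rightarrow> real"
  assumes "C2_on (ball x \<rho>) \<phi>" "0 < \<rho>" "\<And>y. y \<in> ball x \<rho> \<Longrightarrow> u x - \<phi> x \<le> u y - \<phi> y" "\<And>z. \<bar>u z\<bar> \<le> M"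
  shows "\<exists>K. touch_below K u x"
proof -
  obtain p K r where r: "0 < r" "r \<le> \<rho>"
    and K: "\<And>z. norm (z - x) < r \<Longrightarrow> \<bar>\<phi> z - \<phi> x - p \<bullet> (z - x)\<bar> \<le> K * (norm (z - x))\<^sup>2"
    using C2_on_first_order_bound[OF assms(1,2)] by metis
  have "u x + p \<bullet> (z - x) - K * (norm (z - x))\<^sup>2 \<le> u z" if "norm (z - x) < r" for z
    using assms(3)[of z] K[OF that] that r(2) unfolding abs_le_iff by (simp add: dist_norm norm_minus_commute)
  then show ?thesis
    by (rule touch_below_local[OF assms(4) r(1)])
qed

lemma C2_on_uminus: "C2_on S \<phi> \<Longrightarrow> C2_on S (\<lambda>z. - \<phi> z)"
  unfolding C2_on_def
proof (elim exE conjE)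
  fix D H
  assume D: "\<forall>x\<in>S. (\<phi> has_derivative blinfun_apply (D x)) (at x)"
    and H: "\<forall>x\<in>S. (D has_derivative blinfun_apply (H x)) (at x)" and cont: "continuous_on S H"
  show "\<exists>D H. (\<forall>x\<in>S. ((\<lambda>z. - \<phi> z) has_derivative blinfun_apply (D x)) (at x)) \<and>
      (\<forall>x\<in>S. (D has_derivative blinfun_apply (H x)) (at x)) \<and> continuous_on S H"
  proof (intro exI conjI ballI)
    show "((\<lambda>z. - \<phi> z) has_derivative blinfun_apply (- D x)) (at x)" if "x \<in> S" for x
      using has_derivative_minus[OF D[rule_format, OF that]] by (simp add: uminus_blinfun.rep_eq)
    show "((\<lambda>z. - D z) has_derivative blinfun_apply (- H x)) (at x)" if "x \<in> S" for x
      using has_derivative_minus[OF H[rule_format, OF that]] by (simp add: uminus_blinfun.rep_eq)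
    show "continuous_on S (\<lambda>z. - H z)"
      by (intro continuous_intros cont)
  qed
qed

section \<open>Extended integrals versus finite ones\<close>

lemma ext_integral_mono:
  assumes "\<And>t. t \<in> A \<Longrightarrow> f t \<le> g t"
  shows "ext_integral A f \<le> ext_integral A g"
  unfolding ext_integral_def using assms
  by (intro ereal_minus_mono) (auto intro!: nn_integral_mono ennreal_leI simp: less_eq_ennreal.rep_eq[symmetric] split: split_indicator)

lemma ext_integral_hl:
  assumes "hl_integral (\<lambda>t. indicator A t * f t) j" "A \<subseteq> {0<..}"
  shows "ext_integral A f = ereal j"
proof -
  have eq: "indicator {0<..} t * (indicator A t * f t) = indicator A t * f t" for t
    using assms(2) by (auto split: split_indicator)
  have "has_bochner_integral lborel (\<lambda>t. indicator A t * f t) j"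
    using assms(1) unfolding hl_integral_def eq .
  then have "set_integrable lborel A f" "(LINT t:A|lborel. f t) = j"
    by (auto simp: set_integrable_def set_lebesgue_integral_def has_bochner_integral_iff)
  then show ?thesis
    using ext_integral_eq_LINT by metis
qed

lemma hl_integral_restrict:
  assumes "hl_integral f j" "A \<in> sets borel"
  obtains i where "hl_integral (\<lambda>t. indicator A t * f t) i"
proof -
  have "integrable lborel (\<lambda>t. indicator A t * (indicator {0<..} t * f t))"
    using assms integrable_mult_indicator[of A lborel "\<lambda>t. indicator {0<..} t * f t"]
    by (auto simp: hl_integral_def has_bochner_integral_iff)
  then show ?thesis
    using that by (auto simp: hl_integral_def has_bochner_integral_iff mult.left_commute)
qed

lemma ext_integral_split:
  assumes f: "hl_integral f j" and "0 < \<rho>"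
  shows "ext_integral {0<..<\<rho>} f + ext_integral {\<rho><..} f = ereal j"
proof -
  obtain i k where i: "hl_integral (\<lambda>t. indicator {0<..<\<rho>} t * f t) i" and k: "hl_integral (\<lambda>t. indicator {\<rho><..} t * f t) k"
    using hl_integral_restrict[OF f] by (metis greaterThanLessThan_borel greaterThan_borel)
  have sum: "hl_integral (\<lambda>t. indicator {0<..<\<rho>} t * f t + indicator {\<rho><..} t * f t) (i + k)"
    by (rule hl_integral_add[OF i k])
  have "AE t in lborel. indicator {0<..} t * (indicator {0<..<\<rho>} t * f t + indicator {\<rho><..} t * f t) = indicator {0<..} t * f t"
    using AE_lborel_singleton[of \<rho>]
  proof eventually_elim
    case (elim t)
    then show ?case
      using assms(2) by (cases t \<rho> rule: linorder_cases) (auto split: split_indicator)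
  qed
  then have "integral\<^sup>L lborel (\<lambda>t. indicator {0<..} t * (indicator {0<..<\<rho>} t * f t + indicator {\<rho><..} t * f t))
      = integral\<^sup>L lborel (\<lambda>t. indicator {0<..} t * f t)"
    by (intro integral_cong_AE borel_measurable_has_bochner_integral[OF sum[unfolded hl_integral_def]]
        borel_measurable_has_bochner_integral[OF f[unfolded hl_integral_def]])
  moreover have sub: "{0<..<\<rho>} \<subseteq> {0<..}" "{\<rho><..} \<subseteq> {0<..}"
    using assms(2) by auto
  ultimately have "i + k = j"
    using sum f by (simp add: hl_integral_def has_bochner_integral_iff)
  then show ?thesis
    using ext_integral_hl[OF i] ext_integral_hl[OF k] sub by simp
qed

context frac_order
begin

text \<open>Assumption \<open>cut\<close> is the viscosity inequality with the touching paraboloid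
  used up to radius \<rho>. As \<rho> tends to 0, the spliced integrands eventually equal the true
  one at each \<open>t\<close> and share an integrable minorant, so Fatou gives both existence and
  the bound.\<close>

lemma hl_integral_dq_of_cutoffs:
  fixes w :: "'a::euclidean_space \<Rightarrow> real"
  assumes w: "w \<in> borel_measurable borel" "\<And>z. \<bar>w z\<bar> \<le> M" and touch: "touch_below K w x" and \<xi>: "norm \<xi> = 1"
    and cut: "\<And>\<rho> j i. 0 < \<rho> \<Longrightarrow>
      hl_integral (\<lambda>t. indicator {0<..<\<rho>} t * ((- 2 * K) * t\<^sup>2 / t powr (1 + 2 * s))) i \<Longrightarrow>
      hl_integral (\<lambda>t. indicator {\<rho><..} t * dq w x \<xi> t) j \<Longrightarrow> i + j \<le> c"
  obtains k where "hl_integral (dq w x \<xi>) k" "k \<le> c"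
proof -
  have M: "0 \<le> M"
    using w(2)[of x] by simp
  define B where "B t = min (2 * \<bar>K\<bar> * t\<^sup>2) (4 * M) / t powr (1 + 2 * s)" for t
  \<comment> \<open>One minorant for all paraboloid parts: the radius 2 exceeds every
    \<open>\<rho> n\<close>.\<close>
  define H where "H t = 2 * \<bar>K\<bar> * (indicator {0<..<2} t * t\<^sup>2 / t powr (1 + 2 * s))" for t :: real
  obtain b where b: "hl_integral B b"
    unfolding B_def using hl_integral_min_kernel[of "2 * \<bar>K\<bar>" "4 * M"] M by auto
  have H: "hl_integral H (2 * \<bar>K\<bar> * (2 powr (2 - 2 * s) / (2 - 2 * s)))"
    unfolding H_def by (intro hl_integral_cmult hl_integral_head) simp
  have B0: "0 \<le> B t" and H0: "0 \<le> H t" for t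
    using M by (simp_all add: B_def H_def)
  have dqB: "- B t \<le> dq w x \<xi> t" for t
    unfolding B_def by (rule dq_lower[OF touch w(2) \<xi>])
  define \<rho> where "\<rho> n = 1 / real (Suc n)" for n
  have \<rho>: "0 < \<rho> n" "\<rho> n < 2" for n
    by (auto simp: \<rho>_def field_simps)
  define f1 where "f1 n t = indicator {0<..<\<rho> n} t * ((- 2 * K) * t\<^sup>2 / t powr (1 + 2 * s))" for n t
  define f2 where "f2 n t = indicator {\<rho> n<..} t * dq w x \<xi> t" for n t
  have f1: "hl_integral (f1 n) ((- 2 * K) * (\<rho> n powr (2 - 2 * s) / (2 - 2 * s)))" for n
  proof -
    have "f1 n = (\<lambda>t. (- 2 * K) * (indicator {0<..<\<rho> n} t * t\<^sup>2 / t powr (1 + 2 * s)))"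
      by (simp add: f1_def fun_eq_iff)
    then show ?thesis
      using hl_integral_cmult[OF hl_integral_head[OF \<rho>(1)[of n]], of "- 2 * K"] by simp
  qed
  have meas2: "f2 n \<in> borel_measurable borel" for n
    unfolding f2_def using dq_measurable[OF w(1)] by (intro borel_measurable_times) auto
  have meas1: "f1 n \<in> borel_measurable borel" for n
    unfolding f1_def by measurable
  have "\<exists>j. hl_integral (f2 n) j" for n
  proof (rule hl_integral_sandwich[OF meas2])
    show "hl_integral (\<lambda>t. - (4 * M * (indicator {\<rho> n<..} t / t powr (1 + 2 * s)))) (- (4 * M * (\<rho> n powr (- (2 * s)) / (2 * s))))"
      and "hl_integral (\<lambda>t. 4 * M * (indicator {\<rho> n<..} t / t powr (1 + 2 * s))) (4 * M * (\<rho> n powr (- (2 * s)) / (2 * s)))"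
      by (intro hl_integral_uminus hl_integral_cmult hl_integral_tail \<rho>)+
    have sd: "\<bar>second_diff w x (t *\<^sub>R \<xi>)\<bar> \<le> 4 * M" for t
      using w(2)[of "x + t *\<^sub>R \<xi>"] w(2)[of "x - t *\<^sub>R \<xi>"] w(2)[of x] unfolding second_diff_def by linarith
    have "\<bar>f2 n t\<bar> \<le> 4 * M * (indicator {\<rho> n<..} t / t powr (1 + 2 * s))" for t
      using sd[of t] by (auto simp: f2_def dq_def abs_mult divide_right_mono split: split_indicator)
    then show "- (4 * M * (indicator {\<rho> n<..} t / t powr (1 + 2 * s))) \<le> f2 n t"
      and "f2 n t \<le> 4 * M * (indicator {\<rho> n<..} t / t powr (1 + 2 * s))" for t
      unfolding abs_le_iff by (metis minus_le_iff, blast)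
  qed blast
  then obtain j where j: "\<And>n. hl_integral (f2 n) (j n)"
    by metis
  let ?i = "\<lambda>n. (- 2 * K) * (\<rho> n powr (2 - 2 * s) / (2 - 2 * s))"
  have le: "?i n + j n \<le> c" for n
    by (rule cut[OF \<rho>(1)[of n] f1[unfolded f1_def] j[unfolded f2_def]])
  have lim: "(\<lambda>n. f1 n t + f2 n t) \<longlonglongrightarrow> dq w x \<xi> t" if "0 < t" for t
  proof (rule tendsto_eventually)
    have "\<rho> \<longlonglongrightarrow> 0"
      unfolding \<rho>_def by (rule LIMSEQ_Suc[OF lim_1_over_n])
    then have "\<forall>\<^sub>F n in sequentially. \<rho> n < t"
      using that by (rule order_tendstoD(2))
    then show "\<forall>\<^sub>F n in sequentially. f1 n t + f2 n t = dq w x \<xi> t"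
      by eventually_elim (simp add: f1_def f2_def)
  qed
  have low: "- (B t + H t) \<le> f1 n t + f2 n t" if "0 < t" for n t
  proof -
    have "- H t \<le> f1 n t"
    proof (cases "t < \<rho> n")
      case True
      have "2 * K * t\<^sup>2 / t powr (1 + 2 * s) \<le> 2 * \<bar>K\<bar> * t\<^sup>2 / t powr (1 + 2 * s)"
        by (intro divide_right_mono mult_right_mono) auto
      then show ?thesis
        using True that \<rho>(2)[of n] by (simp add: f1_def H_def)
    qed (use H0[of t] in \<open>simp add: f1_def\<close>)
    moreover have "- B t \<le> f2 n t"
      using dqB[of t] B0[of t] by (auto simp: f2_def split: split_indicator)
    ultimately show ?thesis
      by linarith
  qed
  show ?thesis
  proof (rule hl_integral_fatou[where f="\<lambda>n t. f1 n t + f2 n t" and j="\<lambda>n. ?i n + j n" and c="\<lambda>_. c"])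
    show "(\<lambda>t. f1 n t + f2 n t) \<in> borel_measurable borel" for n
      using meas1 meas2 by (rule borel_measurable_add)
    show "hl_integral (\<lambda>t. B t + H t) (b + 2 * \<bar>K\<bar> * (2 powr (2 - 2 * s) / (2 - 2 * s)))"
      by (rule hl_integral_add[OF b H])
    show "hl_integral (\<lambda>t. f1 n t + f2 n t) (?i n + j n)" for n
      by (rule hl_integral_add[OF f1 j])
    show "(\<lambda>_. c) \<longlonglongrightarrow> c"
      by (rule tendsto_const)
  qed (fact low lim le that)+
qed

text \<open>A paraboloid touching \<open>w\<close> from below also touches \<open>v\<close>, hence
  is an admissible test function, while the tails of \<open>w\<close> lie below those of
  \<open>v\<close>. Allowing \<open>w \<noteq> v\<close> admits the truncation of \<open>v\<close>
  to 0 outside the domain.\<close>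

lemma super_at_if_viscosity_supersol:
  fixes v :: "'a::euclidean_space \<Rightarrow> real"
  assumes v: "viscosity_supersol s \<Omega> \<mu> v" and x: "x \<in> \<Omega>"
    and w: "w \<in> borel_measurable borel" "\<And>z. \<bar>w z\<bar> \<le> M" "\<And>z. w z \<le> v z" "w x = v x"
  shows "super_at w x (- (\<mu> / frac_const s * w x))"
  unfolding super_at_def
proof (intro allI impI)
  fix K and \<xi> :: 'a assume touch: "touch_below K w x" and \<xi>: "norm \<xi> = 1"
  have C: "0 < frac_const s"
    using frac_const_pos s_gt s_lt by auto
  obtain p where p: "\<And>z. w x + p \<bullet> (z - x) - K * (norm (z - x))\<^sup>2 \<le> w z"
    using touch by (auto simp: touch_below_def)
  define P where "P z = w x + p \<bullet> (z - x) - K * (norm (z - x))\<^sup>2" for z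
  have sdP: "second_diff P x (t *\<^sub>R \<xi>) = - 2 * K * t\<^sup>2" for t
    using \<xi> by (simp add: second_diff_def P_def)
  have "i + j \<le> - (\<mu> / frac_const s * w x)" if \<rho>: "0 < \<rho>"
    and i: "hl_integral (\<lambda>t. indicator {0<..<\<rho>} t * ((- 2 * K) * t\<^sup>2 / t powr (1 + 2 * s))) i"
    and j: "hl_integral (\<lambda>t. indicator {\<rho><..} t * dq w x \<xi> t) j" for \<rho> i j
  proof -
    have "C2_on (ball x \<rho>) P" "\<forall>y\<in>ball x \<rho>. v x - P x \<le> v y - P y"
      using C2_on_paraboloid[of "ball x \<rho>" "w x" p x K] p w(3,4)
      by (auto simp: P_def[abs_def] intro: order_trans)
    then have "I1_plus s \<rho> P v x + ereal (\<mu> * v x) \<le> 0"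
      using v x \<rho> by (auto simp: viscosity_supersol_def)
    moreover have "ereal (frac_const s) * ereal (i + j) \<le> I1_plus s \<rho> P v x"
    proof -
      have sub: "{0<..<\<rho>} \<subseteq> {0<..}" "{\<rho><..} \<subseteq> {0<..}"
        using \<rho> by auto
      have "ereal i = ext_integral {0<..<\<rho>} (\<lambda>\<tau>. second_diff P x (\<tau> *\<^sub>R \<xi>) / \<tau> powr (1 + 2 * s))"
        using ext_integral_hl[OF i] sub(1) by (simp add: sdP)
      moreover have "ereal j = ext_integral {\<rho><..} (dq w x \<xi>)"
        using ext_integral_hl[OF j] sub(2) by simp
      moreover have "ext_integral {\<rho><..} (dq w x \<xi>) \<le> ext_integral {\<rho><..} (\<lambda>\<tau>. second_diff v x (\<tau> *\<^sub>R \<xi>) / \<tau> powr (1 + 2 * s))"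
        unfolding dq_def[abs_def] second_diff_def using w(3,4)
        by (intro ext_integral_mono divide_right_mono diff_mono add_mono) auto
      ultimately have "ereal i + ereal j \<le> ext_integral {0<..<\<rho>} (\<lambda>\<tau>. second_diff P x (\<tau> *\<^sub>R \<xi>) / \<tau> powr (1 + 2 * s)) +
          ext_integral {\<rho><..} (\<lambda>\<tau>. second_diff v x (\<tau> *\<^sub>R \<xi>) / \<tau> powr (1 + 2 * s))"
        by (metis add_left_mono)
      also have "\<dots> \<le> (SUP \<xi>\<in>sphere 0 1. ext_integral {0<..<\<rho>} (\<lambda>\<tau>. second_diff P x (\<tau> *\<^sub>R \<xi>) / \<tau> powr (1 + 2 * s)) +
          ext_integral {\<rho><..} (\<lambda>\<tau>. second_diff v x (\<tau> *\<^sub>R \<xi>) / \<tau> powr (1 + 2 * s)))"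
        using \<xi> by (intro SUP_upper) simp
      finally show ?thesis
        unfolding I1_plus_def using C by (intro ereal_mult_left_mono) auto
    qed
    ultimately have "ereal (frac_const s) * ereal (i + j) + ereal (\<mu> * v x) \<le> 0"
      by (meson add_right_mono order_trans)
    then have "frac_const s * (i + j) \<le> - (\<mu> * w x)"
      using w(4) by (simp add: zero_ereal_def)
    then show ?thesis
      using C by (simp add: field_simps)
  qed
  then obtain k where "hl_integral (dq w x \<xi>) k" "k \<le> - (\<mu> / frac_const s * w x)"
    by (rule hl_integral_dq_of_cutoffs[OF w(1,2) touch \<xi>])
  then show "\<exists>j\<le>- (\<mu> / frac_const s * w x). hl_integral (dq w x \<xi>) j"
    by blast
qed

text \<open>The test function yields a touching paraboloid, so the directional integrals of
  \<open>u\<close> exist. Inserting the smaller second differences of the test function only lowers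
  the extended integral, possibly to minus infinity.\<close>

lemma viscosity_supersol_if_super_at:
  fixes u :: "'a::euclidean_space \<Rightarrow> real"
  assumes "Linf u" "lsc_on \<Omega> u" and super: "\<And>x. x \<in> \<Omega> \<Longrightarrow> super_at u x (- (l * u x))"
  shows "viscosity_supersol s \<Omega> (frac_const s * l) u"
  unfolding viscosity_supersol_def
proof (intro conjI ballI allI impI assms(1,2))
  fix x \<rho> \<phi> assume x: "x \<in> \<Omega>" and \<rho>: "(0::real) < \<rho>"
    and *: "C2_on (ball x \<rho>) \<phi> \<and> (\<forall>y\<in>ball x \<rho>. u x - \<phi> x \<le> u y - \<phi> y)"
  obtain M where M: "\<And>z. \<bar>u z\<bar> \<le> M"
    using assms(1) by (auto simp: Linf_def bounded_iff)
  obtain K where K: "touch_below K u x"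
    using touch_below_if_C2_on[of x \<rho> \<phi> u M] * \<rho> M by blast
  have sd: "second_diff \<phi> x y \<le> second_diff u x y" if "norm y < \<rho>" for y
  proof -
    have "x + y \<in> ball x \<rho>" "x - y \<in> ball x \<rho>"
      using that by (auto simp: dist_norm)
    then have "u x - \<phi> x \<le> u (x + y) - \<phi> (x + y)" "u x - \<phi> x \<le> u (x - y) - \<phi> (x - y)"
      using * by blast+
    then show ?thesis
      unfolding second_diff_def by linarith
  qed
  have "(SUP \<xi>\<in>sphere 0 1. ext_integral {0<..<\<rho>} (\<lambda>\<tau>. second_diff \<phi> x (\<tau> *\<^sub>R \<xi>) / \<tau> powr (1 + 2 * s)) +
      ext_integral {\<rho><..} (\<lambda>\<tau>. second_diff u x (\<tau> *\<^sub>R \<xi>) / \<tau> powr (1 + 2 * s))) \<le> ereal (- (l * u x))"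
  proof (rule SUP_least)
    fix \<xi> :: 'a assume "\<xi> \<in> sphere 0 1"
    then have \<xi>: "norm \<xi> = 1"
      by simp
    obtain j where j: "j \<le> - (l * u x)" "hl_integral (dq u x \<xi>) j"
      using super[OF x] K \<xi> unfolding super_at_def by blast
    have "ext_integral {0<..<\<rho>} (\<lambda>\<tau>. second_diff \<phi> x (\<tau> *\<^sub>R \<xi>) / \<tau> powr (1 + 2 * s)) \<le> ext_integral {0<..<\<rho>} (dq u x \<xi>)"
      unfolding dq_def[abs_def] using \<xi> by (intro ext_integral_mono divide_right_mono sd) auto
    moreover have "ext_integral {0<..<\<rho>} (dq u x \<xi>) + ext_integral {\<rho><..} (dq u x \<xi>) = ereal j"
      by (rule ext_integral_split[OF j(2) \<rho>])
    ultimately have "ext_integral {0<..<\<rho>} (\<lambda>\<tau>. second_diff \<phi> x (\<tau> *\<^sub>R \<xi>) / \<tau> powr (1 + 2 * s)) +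
      ext_integral {\<rho><..} (dq u x \<xi>) \<le> ereal j"
      using add_right_mono by metis
    moreover have "ereal j \<le> ereal (- (l * u x))"
      using j(1) by simp
    ultimately show "ext_integral {0<..<\<rho>} (\<lambda>\<tau>. second_diff \<phi> x (\<tau> *\<^sub>R \<xi>) / \<tau> powr (1 + 2 * s)) +
      ext_integral {\<rho><..} (\<lambda>\<tau>. second_diff u x (\<tau> *\<^sub>R \<xi>) / \<tau> powr (1 + 2 * s)) \<le> ereal (- (l * u x))"
      unfolding dq_def[abs_def] by (rule order_trans)
  qed
  then have "I1_plus s \<rho> \<phi> u x \<le> ereal (frac_const s) * ereal (- (l * u x))"
    unfolding I1_plus_def using frac_const_pos[of s] s_gt s_lt by (intro ereal_mult_left_mono) auto
  then have "I1_plus s \<rho> \<phi> u x + ereal (frac_const s * l * u x)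
      \<le> ereal (frac_const s) * ereal (- (l * u x)) + ereal (frac_const s * l * u x)"
    by (rule add_right_mono)
  then show "I1_plus s \<rho> \<phi> u x + ereal (frac_const s * l * u x) \<le> 0"
    by (simp add: mult.assoc zero_ereal_def)
qed

text \<open>The direction supplied by \<open>sub_at\<close> bounds the supremum from below, and a
  test function touching from above only raises the inner integral.\<close>

lemma viscosity_subsol_if_sub_at:
  fixes u :: "'a::euclidean_space \<Rightarrow> real"
  assumes "Linf u" "usc_on \<Omega> u" and sub: "\<And>x. x \<in> \<Omega> \<Longrightarrow> sub_at u x (- (l * u x))"
  shows "viscosity_subsol s \<Omega> (frac_const s * l) u"
  unfolding viscosity_subsol_def
proof (intro conjI ballI allI impI assms(1,2))
  fix x \<rho> \<phi> assume x: "x \<in> \<Omega>" and \<rho>: "(0::real) < \<rho>"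
    and *: "C2_on (ball x \<rho>) \<phi> \<and> (\<forall>y\<in>ball x \<rho>. u y - \<phi> y \<le> u x - \<phi> x)"
  obtain M where M: "\<And>z. \<bar>u z\<bar> \<le> M"
    using assms(1) by (auto simp: Linf_def bounded_iff)
  have "\<exists>K. touch_below K (\<lambda>z. - u z) x"
  proof (rule touch_below_if_C2_on)
    show "C2_on (ball x \<rho>) (\<lambda>z. - \<phi> z)"
      using * by (intro C2_on_uminus) blast
    show "- u x - - \<phi> x \<le> - u y - - \<phi> y" if "y \<in> ball x \<rho>" for y
      using *[THEN conjunct2, rule_format, OF that] by linarith
    show "\<bar>- u z\<bar> \<le> M" for z
      using M by simp
  qed (rule \<rho>)
  then obtain \<xi> j where \<xi>: "norm \<xi> = 1" and j: "- (l * u x) \<le> j" "hl_integral (dq u x \<xi>) j"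
    using sub[OF x] unfolding sub_at_def by blast
  have sd: "second_diff u x y \<le> second_diff \<phi> x y" if "norm y < \<rho>" for y
  proof -
    have "x + y \<in> ball x \<rho>" "x - y \<in> ball x \<rho>"
      using that by (auto simp: dist_norm)
    then have "u (x + y) - \<phi> (x + y) \<le> u x - \<phi> x" "u (x - y) - \<phi> (x - y) \<le> u x - \<phi> x"
      using * by blast+
    then show ?thesis
      unfolding second_diff_def by linarith
  qed
  have "ereal (- (l * u x)) \<le> ereal j"
    using j(1) by simp
  also have "ereal j = ext_integral {0<..<\<rho>} (dq u x \<xi>) + ext_integral {\<rho><..} (dq u x \<xi>)"
    by (rule ext_integral_split[OF j(2) \<rho>, symmetric])
  also have "\<dots> \<le> ext_integral {0<..<\<rho>} (\<lambda>\<tau>. second_diff \<phi> x (\<tau> *\<^sub>R \<xi>) / \<tau> powr (1 + 2 * s)) +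
      ext_integral {\<rho><..} (\<lambda>\<tau>. second_diff u x (\<tau> *\<^sub>R \<xi>) / \<tau> powr (1 + 2 * s))"
    unfolding dq_def[abs_def] using \<xi> by (intro add_right_mono ext_integral_mono divide_right_mono sd) auto
  also have "\<dots> \<le> (SUP \<xi>\<in>sphere 0 1. ext_integral {0<..<\<rho>} (\<lambda>\<tau>. second_diff \<phi> x (\<tau> *\<^sub>R \<xi>) / \<tau> powr (1 + 2 * s)) +
      ext_integral {\<rho><..} (\<lambda>\<tau>. second_diff u x (\<tau> *\<^sub>R \<xi>) / \<tau> powr (1 + 2 * s)))"
    using \<xi> by (intro SUP_upper) simp
  finally have "ereal (frac_const s) * ereal (- (l * u x)) \<le> I1_plus s \<rho> \<phi> u x"
    unfolding I1_plus_def using frac_const_pos[of s] s_gt s_lt by (intro ereal_mult_left_mono) auto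
  then have "ereal (frac_const s) * ereal (- (l * u x)) + ereal (frac_const s * l * u x)
      \<le> I1_plus s \<rho> \<phi> u x + ereal (frac_const s * l * u x)"
    by (rule add_right_mono)
  then show "0 \<le> I1_plus s \<rho> \<phi> u x + ereal (frac_const s * l * u x)"
    by (simp add: mult.assoc zero_ereal_def)
qed

end

text \<open>A centre in \<open>closure Y\<close> at distance exactly \<open>R\<close> from \<open>x \<in> \<Omega>\<close> is impossible: moving \<open>x\<close> away from
  it stays inside the open set \<open>\<Omega>\<close>.\<close>

lemma uniformly_convex_domain_ball_hull:
  fixes \<Omega> :: "'a::euclidean_space set"
  assumes "uniformly_convex_domain \<Omega>" "1/2 < s" "s < 1"
  obtains Y R where "ball_hull s \<Omega> Y R"
proof -
  obtain R Y where dom: "open \<Omega>" "\<Omega> \<noteq> {}" "bounded \<Omega>" and R: "0 < R" and \<Omega>: "\<Omega> = (\<Inter>y\<in>Y. ball y R)"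
    using assms(1) by (auto simp: uniformly_convex_domain_def)
  have ne: "Y \<noteq> {}"
    using dom(3) \<Omega> not_bounded_UNIV by auto
  have near: "norm (x - y) \<le> R" if "x \<in> \<Omega>" "y \<in> closure Y" for x y
  proof -
    have "Y \<subseteq> cball x R"
      using \<Omega> that(1) by (auto simp: dist_commute less_imp_le)
    then have "closure Y \<subseteq> cball x R"
      by (rule closure_minimal) simp
    then show ?thesis
      using that(2) by (auto simp: dist_norm)
  qed
  have strict: "norm (x - y) < R" if x: "x \<in> \<Omega>" and y: "y \<in> closure Y" for x y
  proof (rule ccontr)
    assume "\<not> ?thesis"
    then have eq: "norm (x - y) = R"
      using near[OF x y] by simp
    obtain e where e: "0 < e" "ball x e \<subseteq> \<Omega>"
      using dom(1) x open_contains_ball by blast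
    define c where "c = e / (2 * R)"
    have c: "0 < c" "c * R < e"
      using e(1) R by (auto simp: c_def)
    have "dist x (x + c *\<^sub>R (x - y)) < e"
      using eq c by (simp add: dist_norm)
    then have "norm (x + c *\<^sub>R (x - y) - y) \<le> R"
      using near[OF _ y] e(2) by auto
    moreover have "x + c *\<^sub>R (x - y) - y = (1 + c) *\<^sub>R (x - y)"
      by (simp add: algebra_simps)
    ultimately have "(1 + c) * R \<le> R"
      using eq c(1) by simp
    then show False
      using mult_pos_pos[OF c(1) R] by (simp add: distrib_right)
  qed
  obtain x0 where "x0 \<in> \<Omega>"
    using dom(2) by blast
  then have "closure Y \<subseteq> cball x0 R"
    using near by (auto simp: dist_norm)
  then have "compact (closure Y)"
    using bounded_subset[OF bounded_cball] by (simp add: compact_eq_bounded_closed)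
  moreover have "x \<in> \<Omega> \<longleftrightarrow> (\<forall>y\<in>closure Y. norm (x - y) < R)" for x
  proof
    assume "\<forall>y\<in>closure Y. norm (x - y) < R"
    then show "x \<in> \<Omega>"
      unfolding \<Omega> using closure_subset[of Y] by (auto simp: dist_norm norm_minus_commute)
  qed (use strict in blast)
  ultimately have "ball_hull s \<Omega> (closure Y) R"
    using assms(2,3) R ne dom by unfold_locales auto
  then show ?thesis
    by (rule that)
qed

theorem theorem8p1:
  fixes \<Omega> :: "'a::euclidean_space set" and s :: real
  assumes "1/2 < s" and "s < 1"
    and "uniformly_convex_domain \<Omega>"
  shows "\<exists>(\<mu>1 :: real) (\<psi>1 :: 'a \<Rightarrow> real).
           principal_eigenvalue s \<Omega> = ereal \<mu>1 \<and>
           holder_on (2 * s - 1) (closure \<Omega>) \<psi>1 \<and>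
           (\<forall>x\<in>\<Omega>. 0 < \<psi>1 x) \<and>
           viscosity_sol s \<Omega> \<mu>1 \<psi>1 \<and>
           (\<forall>x\<in>- \<Omega>. \<psi>1 x = 0)"
proof -
  obtain Y R where "ball_hull s \<Omega> Y R"
    using uniformly_convex_domain_ball_hull assms by blast
  then interpret ball_hull s \<Omega> Y R .
  have C: "0 < frac_const s"
    using frac_const_pos s_gt s_lt by auto
  obtain u L where u: "supersol \<Omega> eigenvalue 0 u" and sub: "\<And>x. x \<in> \<Omega> \<Longrightarrow> sub_at u x (- (eigenvalue * u x))"
    and holder: "\<And>x y. \<bar>u x - u y\<bar> \<le> L * norm (x - y) powr (2 * s - 1)" and pos: "\<And>x. x \<in> \<Omega> \<Longrightarrow> 0 < u x"
    using eigenfunction_exists by metis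
  have cont: "continuous_on UNIV u"
    by (rule holder_imp_continuous[OF holder])
  then have cont\<Omega>: "continuous_on \<Omega> u"
    by (rule continuous_on_subset) simp
  have linf: "Linf u"
    using u by (simp add: Linf_def supersol_def)
  have lsc: "lsc_on \<Omega> u" and usc: "usc_on \<Omega> u"
    using cont\<Omega> by (auto simp: lsc_on_def usc_on_def continuous_on_def intro: order_tendstoD)
  let ?\<mu> = "frac_const s * eigenvalue"
  have super: "viscosity_supersol s \<Omega> ?\<mu> u"
    by (rule viscosity_supersol_if_super_at[OF linf lsc]) (use u in \<open>simp add: supersol_def\<close>)
  have "viscosity_subsol s \<Omega> ?\<mu> u"
    by (rule viscosity_subsol_if_sub_at[OF linf usc sub])
  then have sol: "viscosity_sol s \<Omega> ?\<mu> u"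
    using super cont\<Omega> by (simp add: viscosity_sol_def)
  have "principal_eigenvalue s \<Omega> = ereal ?\<mu>"
    unfolding principal_eigenvalue_def
  proof (rule Sup_eqI)
    fix m assume "m \<in> ereal ` {\<mu>. \<exists>v. lsc_on \<Omega> v \<and> Linf v \<and> (\<forall>x\<in>\<Omega>. 0 < v x) \<and> (\<forall>x. 0 \<le> v x) \<and>
      viscosity_supersol s \<Omega> \<mu> v}"
    then obtain \<mu> v where m: "m = ereal \<mu>" and v: "lsc_on \<Omega> v" "Linf v" "\<And>x. x \<in> \<Omega> \<Longrightarrow> 0 < v x"
      "\<And>x. 0 \<le> v x" "viscosity_supersol s \<Omega> \<mu> v"
      by blast
    \<comment> \<open>Competitors may be positive outside \<Omega>, while \<open>supersol\<close>
      demands zero values there. Cutting off lowers the tails and keeps lower semicontinuity because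
      \<open>v\<close> is nonnegative.\<close>
    define w where "w x = (if x \<in> \<Omega> then v x else 0)" for x
    obtain M where M: "\<And>x. \<bar>v x\<bar> \<le> M"
      using v(2) by (auto simp: Linf_def bounded_iff)
    have wM: "\<bar>w x\<bar> \<le> M" for x
      using M[of x] by (auto simp: w_def)
    have w0: "0 \<le> w x" "w x \<le> v x" for x
      using v(4) by (auto simp: w_def)
    have [measurable]: "v \<in> borel_measurable borel" "\<Omega> \<in> sets borel"
      using v(2) open_\<Omega> by (auto simp: Linf_def)
    have wmeas: "w \<in> borel_measurable borel"
      unfolding w_def by measurable
    have "lsc_on UNIV w"
      unfolding lsc_on_def
    proof (intro ballI allI impI)
      fix x c assume c: "c < w x"
      show "\<forall>\<^sub>F y in at x within UNIV. c < w y"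
      proof (cases "x \<in> \<Omega>")
        case True
        then have "\<forall>\<^sub>F y in at x within \<Omega>. c < v y"
          using v(1) c by (simp add: lsc_on_def w_def)
        then have "\<forall>\<^sub>F y in at x. c < v y"
          unfolding at_within_open[OF True open_\<Omega>] .
        moreover have "\<forall>\<^sub>F y in at x. y \<in> \<Omega>"
          by (rule eventually_at_in_open'[OF open_\<Omega> True])
        ultimately have "\<forall>\<^sub>F y in at x. c < w y"
          by eventually_elim (simp add: w_def)
        then show ?thesis
          by simp
      next
        case False
        then have "c < 0"
          using c by (simp add: w_def)
        then show ?thesis
          using less_le_trans[OF _ w0(1)] by simp
      qed
    qed
    moreover have "super_at w x (- (\<mu> / frac_const s * w x))" if "x \<in> \<Omega>" for x
      by (rule super_at_if_viscosity_supersol[OF v(5) that wmeas wM w0(2)]) (use that in \<open>simp add: w_def\<close>)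
    moreover have "bounded (range w)"
      unfolding bounded_iff using wM by auto
    ultimately have "positive_supersol (\<mu> / frac_const s) w"
      using wmeas w0(1) v(3) unfolding positive_supersol_def supersol_def by (simp add: w_def)
    then have "\<mu> / frac_const s \<le> eigenvalue"
      by (rule eigenvalue_upper)
    then show "m \<le> ereal ?\<mu>"
      using C m by (simp add: field_simps)
  next
    fix m assume "\<And>z. z \<in> ereal ` {\<mu>. \<exists>v. lsc_on \<Omega> v \<and> Linf v \<and> (\<forall>x\<in>\<Omega>. 0 < v x) \<and> (\<forall>x. 0 \<le> v x) \<and>
      viscosity_supersol s \<Omega> \<mu> v} \<Longrightarrow> z \<le> m"
    \<comment> \<open>The eigenfunction is itself a competitor, so the supremum is attained.\<close>
    then show "ereal ?\<mu> \<le> m"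
      using lsc linf pos super u by (auto simp: supersol_def)
  qed
  moreover have "holder_on (2 * s - 1) (closure \<Omega>) u"
    unfolding holder_on_def dist_norm using holder by blast
  moreover have "\<forall>x\<in>- \<Omega>. u x = 0"
    using u by (simp add: supersol_def)
  ultimately show ?thesis
    using pos sol by blast
qed

end
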